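(* Let $\nu_n\Rightarrow\nu=\delta_{\mu_0}$ (weak convergence of probability measures on $E$). Let $\psi_n\in L^\infty(E,\nu_n)$, $n\in\mathbb N$, be nonnegative functions which are uniformly bounded by some constant $C>0$ and satisfy $\int\psi_n\,d\nu_n=1$, $n\in\mathbb N$. Suppose that for some $\beta>0$ the following condition holds: there exist an algebra $\tilde C_b(E)\subseteq C_b(E)$ containing the constant functions and separating points in $E$, and a function $\xi:(0,\infty)\times\tilde C_b(E)\times\mathbb N\to(0,\infty)$ with $\lim_{n\to\infty}\xi(a_n,g,n)=0$ whenever $\lim_{n\to\infty}a_n=0$, such that, for $g\in\tilde C_b(E)$ and $\varepsilon_n:=\xi(\langle g-\beta G_{n,\beta}g,\ g-\beta G_{n,\beta}g\rangle_n^{1/2},g,n)$, one has $$\mathbb E_{\psi_n}\left(e^{-\beta\tau_{B^c}}\right)\le\varepsilon_n,\quad n\in\mathbb N,$$ where $B:=\bigcup_{n=1}^\infty\{\mu\in E_n:|g(\mu)-\beta G_{n,\beta}g(\mu)|\ge\varepsilon_n\|g\|\}$ and $\tau_{B^c}\equiv\tau^n_{B^c}$ is the first exit time of $\mathbf X^n$ from $B^c\cap E_n$. Then the processes $\mathbf X^n$ converge weakly to $\mathbf X$ as $n\to\infty$ (in the Skorohod space $D_E[0,\infty)$).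
   Context: Let $D$ be a bounded $d$-dimensional domain (or, more generally, a bounded $d$-dimensional Riemannian manifold), $d\in\mathbb N$. $\mathcal M_1(\overline D)$ is the space of all probability measures on $(\overline D,\mathcal B(\overline D))$, and $\mathcal M_\partial(\overline D)$ is the quotient of $\mathcal M_1(\overline D)$ in which $\nu_1,\nu_2$ are identified iff $\nu_1|_D=\nu_2|_D$ (all points of $\partial D$ are identified with each other). Both carry the Prohorov metric. $E$ is one of these two compact spaces. For $n\in\mathbb N$, $\mathcal M^n$ denotes the set of all $\mu\in E$ of the form $\mu=\frac1n\sum_{i=1}^n\delta_{z_i}$, $z_1,\dots,z_n\in\overline D$, and $E_n:=\mathcal M^n\setminus\bigcup_{k=1}^{n-1}\mathcal M^k$; $E_0:=E\setminus\bigcup_{n\ge1}E_n$, and $\mu_0\in E_0$. $C_b(E)=C(E)$ is the set of continuous functions and $\|\cdot\|$ the supremum norm. For each $n$, $\nu_n$ is a probability measure on $E$ with $\nu_n(E\setminus E_n)=0$, and $(T_{n,t})_{t\ge0}$ is a strongly continuous semigroup in $L^2(E,\nu_n)$ possessing a transition probability function and having $\nu_n$ as an invariant measure ($\int T_{n,t}f\,d\nu_n=\int f\,d\nu_n$ for $f\in L^\infty(E,\nu_n)$). Its resolvent is $G_{n,\beta}$, $\beta>0$, and $\langle\cdot,\cdot\rangle_n$ is the inner product of $L^2(E,\nu_n)$. $X^n=((X^n_t)_{t\ge0},(P^n_\mu)_{\mu\in\mathcal M^n})$ is a Markov process with cadlag paths corresponding to $(T_{n,t})_{t\ge0}$, taking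 values in $E_n$, where $P^n_\mu(X^n_t\in\mathcal M^n\setminus E_n)=0$ for all $\mu\in\mathcal M^n$ and $t>0$. Pointwise values $G_{n,\beta}g(\mu)$ are those given by the process. $(T_t)_{t\ge0}$ is a semigroup in the space $B_b(E)$ of bounded measurable functions possessing a transition probability function by means of which it induces a strongly continuous contraction semigroup in $L^2(E,\nu)$; $X=((X_t)_{t\ge0},(P_\mu)_{\mu\in E})$ is a cadlag Markov process associated with $(T_t)_{t\ge0}$ taking values in some subset of $E$. $P_{\psi_n\nu_n}:=\int_EP^n_\mu\,\psi_n(\mu)\,\nu_n(d\mu)$, $\mathbf X^n:=((X^n_t)_{t\ge0},P_{\psi_n\nu_n})$, $\mathbb E_{\psi_n}$ is the expectation with respect to $P_{\psi_n\nu_n}$, $P_\nu:=\int_EP_\mu\,\nu(d\mu)$ and $\mathbf X:=((X_t)_{t\ge0},P_\nu)$.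
   Formalization: The exit-time condition is required only for g not identically zero (for g = 0 it would read 1 ≤ ε_n → 0, a contradiction), and ξ is taken on [0,∞) in its first argument, since that argument is 0 for constant g. *)

theory Defs
  imports "HOL-Probability.Probability"
begin

section \<open>Topologies and weak convergence\<close>

text \<open>For a metric this is the library's metric topology (see the lemma below); the definition
  makes sense without a proof that \<open>d\<close> is a metric.\<close>

definition dist_topology :: "'e set \<Rightarrow> ('e \<Rightarrow> 'e \<Rightarrow> real) \<Rightarrow> 'e topology" where
  "dist_topology M d =
     topology (\<lambda>U. U \<subseteq> M \<and> (\<forall>x\<in>U. \<exists>r>0. \<forall>y\<in>M. d x y < r \<longrightarrow> y \<in> U))"

lemma dist_topology_eq_mtopology:
  assumes "Metric_space M d"
  shows "dist_topology M d = Metric_space.mtopology M d"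
proof -
  interpret Metric_space M d by fact
  have "(\<lambda>U. U \<subseteq> M \<and> (\<forall>x\<in>U. \<exists>r>0. \<forall>y\<in>M. d x y < r \<longrightarrow> y \<in> U)) = mopen"
    unfolding fun_eq_iff mopen_def mball_def by blast
  then show ?thesis
    by (simp add: dist_topology_def mtopology_def)
qed

definition borel_of :: "'e topology \<Rightarrow> 'e measure" where
  "borel_of Y = sigma (topspace Y) {U. openin Y U}"

definition weakly_converges :: "'e topology \<Rightarrow> (nat \<Rightarrow> 'e measure) \<Rightarrow> 'e measure \<Rightarrow> bool" where
  "weakly_converges Y Ms M \<longleftrightarrow>
     (\<forall>f. continuous_map Y euclideanreal f \<and> (\<exists>C. \<forall>x\<in>topspace Y. \<bar>f x\<bar> \<le> C) \<longrightarrow>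
        (\<lambda>n. \<integral>x. f x \<partial>Ms n) \<longlonglongrightarrow> (\<integral>x. f x \<partial>M))"

section \<open>The underlying space and the state space of the particle systems\<close>

text \<open>\<open>D\<close> sits as an open set in a metric space and has compact closure. This covers bounded
  domains in \<open>\<real>\<^sup>d\<close> (lemma below) as well as bounded Riemannian manifolds with compact completion:
  there, the ambient space is the completion of \<open>D\<close> for the geodesic distance, and the Riemannian
  structure enters only through this distance.\<close>

definition bounded_domain :: "nat \<Rightarrow> 'a::metric_space set \<Rightarrow> bool" where
  "bounded_domain d D \<longleftrightarrow>
     1 \<le> d \<and> open D \<and> connected D \<and> D \<noteq> {} \<and> compact (closure D) \<and>
     (\<forall>x\<in>D. \<exists>U V. open U \<and> x \<in> U \<and> U \<subseteq> D \<and> openin (Euclidean_space d) V \<and>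
        top_of_set U homeomorphic_space subtopology (Euclidean_space d) V)"

lemma bounded_domain_euclidean:
  fixes D :: "'a::euclidean_space set"
  assumes "open D" "connected D" "D \<noteq> {}" "bounded D"
  shows "bounded_domain DIM('a) D"
proof -
  let ?d = "DIM('a)"
  obtain b :: "nat \<Rightarrow> 'a" where b: "bij_betw b {..<?d} Basis"
    using ex_bij_betw_nat_finite[OF finite_Basis] by (metis atLeast0LessThan)
  define f :: "'a \<Rightarrow> nat \<Rightarrow> real" where "f x = (\<lambda>i. if i < ?d then x \<bullet> b i else 0)" for x
  define g :: "(nat \<Rightarrow> real) \<Rightarrow> 'a" where "g y = (\<Sum>i<?d. y i *\<^sub>R b i)" for y
  have gf: "g (f x) = x" for x
  proof -
    have "g (f x) = (\<Sum>i<?d. (x \<bullet> b i) *\<^sub>R b i)"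
      by (simp add: g_def f_def)
    also have "\<dots> = (\<Sum>u\<in>Basis. (x \<bullet> u) *\<^sub>R u)"
      by (rule sum.reindex_bij_betw[OF b])
    finally show ?thesis by (simp add: euclidean_representation)
  qed
  have inb: "b i \<bullet> b j = (if i = j then 1 else 0)" if "i < ?d" "j < ?d" for i j
  proof -
    have "b i \<in> Basis" "b j \<in> Basis" "b i = b j \<longleftrightarrow> i = j"
      using b that by (auto simp: bij_betw_def inj_on_def)
    then show ?thesis by (simp add: inner_Basis)
  qed
  have fg: "f (g y) = y" if "y \<in> topspace (Euclidean_space ?d)" for y
  proof
    fix j
    have "g y \<bullet> b j = y j" if "j < ?d"
    proof -
      have "g y \<bullet> b j = (\<Sum>i<?d. if i = j then y i else 0)"
        unfolding g_def inner_sum_left using that by (intro sum.cong) (auto simp: inb)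
      then show ?thesis using that by simp
    qed
    then show "f (g y) j = y j"
      using that by (auto simp: f_def topspace_Euclidean_space)
  qed
  have cf: "continuous_map euclidean (Euclidean_space ?d) f"
    unfolding Euclidean_space_def continuous_map_in_subtopology
  proof
    show "continuous_map euclidean (powertop_real UNIV) f"
      unfolding continuous_map_componentwise_UNIV f_def
      by (auto intro!: continuous_intros)
    show "f \<in> topspace euclidean \<rightarrow> {x. \<forall>i\<ge>?d. x i = 0}"
      by (auto simp: f_def)
  qed
  have cg: "continuous_map (Euclidean_space ?d) euclidean g"
  proof -
    have "continuous_map (powertop_real UNIV) euclidean (\<lambda>y. y i *\<^sub>R b i)" for i
    proof -
      have "continuous_map euclideanreal euclidean (\<lambda>r. r *\<^sub>R b i)"
        by (simp add: continuous_map_iff_continuous2 continuous_on_scaleR)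
      moreover have "continuous_map (powertop_real UNIV) euclideanreal (\<lambda>y. y i)"
        by (rule continuous_map_product_projection) simp
      ultimately show ?thesis
        using continuous_map_compose[of "powertop_real UNIV" euclideanreal "\<lambda>y. y i" euclidean
            "\<lambda>r. r *\<^sub>R b i"]
        by (simp add: comp_def)
    qed
    then show ?thesis
      unfolding g_def Euclidean_space_def
      by (intro continuous_map_sum continuous_map_from_subtopology) simp_all
  qed
  have hm: "homeomorphic_maps euclidean (Euclidean_space ?d) f g"
    using cf cg gf fg by (auto simp: homeomorphic_maps_def)
  have "openin (Euclidean_space ?d) (f ` D) \<and>
        top_of_set D homeomorphic_space subtopology (Euclidean_space ?d) (f ` D)"
  proof
    have "homeomorphic_map euclidean (Euclidean_space ?d) f"
      using hm homeomorphic_map_maps by blast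
    then show "openin (Euclidean_space ?d) (f ` D)"
      using assms(1) by (metis homeomorphic_imp_open_map open_map_def open_openin)
    have "f ` (topspace euclidean \<inter> D) = topspace (Euclidean_space ?d) \<inter> f ` D"
      using continuous_map_image_subset_topspace[OF cf] by auto
    then have "homeomorphic_maps (top_of_set D) (subtopology (Euclidean_space ?d) (f ` D)) f g"
      by (rule homeomorphic_maps_subtopologies[OF hm])
    then show "top_of_set D homeomorphic_space subtopology (Euclidean_space ?d) (f ` D)"
      unfolding homeomorphic_space_def by (intro exI)
  qed
  then have "\<exists>U V. open U \<and> x \<in> U \<and> U \<subseteq> D \<and> openin (Euclidean_space ?d) V \<and>
      top_of_set U homeomorphic_space subtopology (Euclidean_space ?d) V" if "x \<in> D" for x
    using assms(1) that by blast
  moreover have "1 \<le> ?d"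
    using DIM_positive[where 'a='a] by linarith
  moreover have "compact (closure D)"
    using assms(4) by (simp add: compact_closure)
  ultimately show ?thesis
    unfolding bounded_domain_def using assms by blast
qed

text \<open>\<open>Distinguished\<close> is the choice of all probability measures on the closure of \<open>D\<close>;
  \<open>Identified\<close> is the choice of the quotient in which the points of the boundary are identified.\<close>

datatype boundary = Distinguished | Identified

definition prob_measures :: "'a::metric_space set \<Rightarrow> 'a measure set" where
  "prob_measures D = space (prob_algebra (restrict_space borel (closure D)))"

text \<open>The canonical projection onto the state space. The class of \<open>\<nu>\<close> in the quotient is
  represented by the restriction of \<open>\<nu>\<close> to \<open>D\<close>, the common value on that class.\<close>

fun proj :: "boundary \<Rightarrow> 'a::metric_space set \<Rightarrow> 'a measure \<Rightarrow> 'a measure" where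
  "proj Distinguished D \<nu> = \<nu>"
| "proj Identified D \<nu> = restrict_space \<nu> D"

definition states :: "boundary \<Rightarrow> 'a::metric_space set \<Rightarrow> 'a measure set" where
  "states b D = proj b D ` prob_measures D"

text \<open>In the identified case: the quotient metric of the closure of \<open>D\<close> modulo its boundary, as a
  pseudometric on the closure. The boundary of a manifold may be empty, and \<open>infdist x {} = 0\<close>.\<close>

fun point_dist :: "boundary \<Rightarrow> 'a::metric_space set \<Rightarrow> 'a \<Rightarrow> 'a \<Rightarrow> real" where
  "point_dist Distinguished D x y = dist x y"
| "point_dist Identified D x y =
     (if frontier D = {} then dist x y
      else min (dist x y) (infdist x (frontier D) + infdist y (frontier D)))"

definition prohorov_dist ::
    "('a \<Rightarrow> 'a \<Rightarrow> real) \<Rightarrow> 'a set \<Rightarrow> 'a measure \<Rightarrow> 'a measure \<Rightarrow> real" where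
  "prohorov_dist \<delta> K \<nu>1 \<nu>2 =
     Inf {\<epsilon>. 0 < \<epsilon> \<and>
       (\<forall>A\<in>sets \<nu>1. measure \<nu>1 A \<le> measure \<nu>2 {y\<in>K. \<exists>x\<in>A. \<delta> x y < \<epsilon>} + \<epsilon>) \<and>
       (\<forall>A\<in>sets \<nu>2. measure \<nu>2 A \<le> measure \<nu>1 {y\<in>K. \<exists>x\<in>A. \<delta> x y < \<epsilon>} + \<epsilon>)}"

text \<open>The Prohorov distance for \<open>point_dist Identified D\<close> depends only on the classes of its
  arguments, so it does not matter which representatives \<open>inv_into\<close> picks.\<close>

definition state_dist ::
    "boundary \<Rightarrow> 'a::metric_space set \<Rightarrow> 'a measure \<Rightarrow> 'a measure \<Rightarrow> real" where
  "state_dist b D \<mu> \<mu>' =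
     prohorov_dist (point_dist b D) (closure D)
       (inv_into (prob_measures D) (proj b D) \<mu>) (inv_into (prob_measures D) (proj b D) \<mu>')"

text \<open>The classes of the measures \<open>(1/n) (\<delta>(z 1) + \<dots> + \<delta>(z n))\<close>.\<close>

definition particle_states :: "boundary \<Rightarrow> 'a::metric_space set \<Rightarrow> nat \<Rightarrow> 'a measure set" where
  "particle_states b D n = proj b D `
     {\<nu> \<in> prob_measures D. \<exists>z. (\<forall>i\<in>{1..n}. z i \<in> closure D) \<and>
        (\<forall>A\<in>sets \<nu>. measure \<nu> A = (\<Sum>i=1..n. indicator A (z i)) / real n)}"

definition exact_states :: "boundary \<Rightarrow> 'a::metric_space set \<Rightarrow> nat \<Rightarrow> 'a measure set" where
  "exact_states b D n = particle_states b D n - (\<Union>k\<in>{1..<n}. particle_states b D k)"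

definition limit_states :: "boundary \<Rightarrow> 'a::metric_space set \<Rightarrow> 'a measure set" where
  "limit_states b D = states b D - (\<Union>n\<in>{1..}. exact_states b D n)"

section \<open>Semigroups\<close>

text \<open>Elements of \<open>L\<^sup>2\<close> are handled as functions; equality in \<open>L\<^sup>2\<close> is equality almost everywhere.\<close>

definition L2 :: "'e measure \<Rightarrow> ('e \<Rightarrow> real) set" where
  "L2 \<nu> = {f \<in> borel_measurable \<nu>. integrable \<nu> (\<lambda>x. (f x)\<^sup>2)}"

definition L2_inner :: "'e measure \<Rightarrow> ('e \<Rightarrow> real) \<Rightarrow> ('e \<Rightarrow> real) \<Rightarrow> real" where
  "L2_inner \<nu> f g = (\<integral>x. f x * g x \<partial>\<nu>)"

definition L2_norm :: "'e measure \<Rightarrow> ('e \<Rightarrow> real) \<Rightarrow> real" where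
  "L2_norm \<nu> f = sqrt (L2_inner \<nu> f f)"

definition bounded_operator_L2 :: "'e measure \<Rightarrow> (('e \<Rightarrow> real) \<Rightarrow> 'e \<Rightarrow> real) \<Rightarrow> bool" where
  "bounded_operator_L2 \<nu> S \<longleftrightarrow>
     (\<forall>f\<in>L2 \<nu>. S f \<in> L2 \<nu>) \<and>
     (\<forall>f\<in>L2 \<nu>. \<forall>g\<in>L2 \<nu>. (AE x in \<nu>. f x = g x) \<longrightarrow> (AE x in \<nu>. S f x = S g x)) \<and>
     (\<forall>f\<in>L2 \<nu>. \<forall>g\<in>L2 \<nu>. \<forall>c. AE x in \<nu>. S (\<lambda>y. c * f y + g y) x = c * S f x + S g x) \<and>
     (\<exists>C. \<forall>f\<in>L2 \<nu>. L2_norm \<nu> (S f) \<le> C * L2_norm \<nu> f)"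

definition strongly_continuous_semigroup_L2 ::
    "'e measure \<Rightarrow> (real \<Rightarrow> ('e \<Rightarrow> real) \<Rightarrow> 'e \<Rightarrow> real) \<Rightarrow> bool" where
  "strongly_continuous_semigroup_L2 \<nu> T \<longleftrightarrow>
     (\<forall>t\<ge>0. bounded_operator_L2 \<nu> (T t)) \<and>
     (\<forall>f\<in>L2 \<nu>. AE x in \<nu>. T 0 f x = f x) \<and>
     (\<forall>s\<ge>0. \<forall>t\<ge>0. \<forall>f\<in>L2 \<nu>. AE x in \<nu>. T (s + t) f x = T s (T t f) x) \<and>
     (\<forall>f\<in>L2 \<nu>. ((\<lambda>t. L2_norm \<nu> (\<lambda>x. T t f x - f x)) \<longlongrightarrow> 0) (at_right 0))"

definition contraction_semigroup_L2 ::
    "'e measure \<Rightarrow> (real \<Rightarrow> ('e \<Rightarrow> real) \<Rightarrow> 'e \<Rightarrow> real) \<Rightarrow> bool" where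
  "contraction_semigroup_L2 \<nu> T \<longleftrightarrow>
     strongly_continuous_semigroup_L2 \<nu> T \<and>
     (\<forall>t\<ge>0. \<forall>f\<in>L2 \<nu>. L2_norm \<nu> (T t f) \<le> L2_norm \<nu> f)"

definition invariant_measure ::
    "'e measure \<Rightarrow> (real \<Rightarrow> ('e \<Rightarrow> real) \<Rightarrow> 'e \<Rightarrow> real) \<Rightarrow> bool" where
  "invariant_measure \<nu> T \<longleftrightarrow>
     (\<forall>t\<ge>0. \<forall>f\<in>borel_measurable \<nu>. (\<exists>C. AE x in \<nu>. \<bar>f x\<bar> \<le> C) \<longrightarrow>
        (\<integral>x. T t f x \<partial>\<nu>) = (\<integral>x. f x \<partial>\<nu>))"

definition bounded_measurable :: "'e measure \<Rightarrow> ('e \<Rightarrow> real) set" where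
  "bounded_measurable N = {f \<in> borel_measurable N. \<exists>C. \<forall>x\<in>space N. \<bar>f x\<bar> \<le> C}"

definition transition_function :: "'e measure \<Rightarrow> (real \<Rightarrow> 'e \<Rightarrow> 'e measure) \<Rightarrow> bool" where
  "transition_function N p \<longleftrightarrow>
     (\<forall>t\<ge>0. p t \<in> N \<rightarrow>\<^sub>M prob_algebra N) \<and>
     (\<forall>x\<in>space N. p 0 x = return N x) \<and>
     (\<forall>s\<ge>0. \<forall>t\<ge>0. \<forall>x\<in>space N. p (s + t) x = p s x \<bind> p t)"

text \<open>A semigroup in \<open>L\<^sup>2(\<nu>)\<close> given by \<open>p\<close>; bounded functions are dense in \<open>L\<^sup>2(\<nu>)\<close>.\<close>

definition given_by_L2 ::
    "'e measure \<Rightarrow> (real \<Rightarrow> ('e \<Rightarrow> real) \<Rightarrow> 'e \<Rightarrow> real) \<Rightarrow> (real \<Rightarrow> 'e \<Rightarrow> 'e measure) \<Rightarrow> bool" where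
  "given_by_L2 \<nu> T p \<longleftrightarrow>
     (\<forall>t\<ge>0. \<forall>f\<in>bounded_measurable \<nu>. AE x in \<nu>. T t f x = (\<integral>y. f y \<partial>p t x))"

section \<open>Markov processes with cadlag paths\<close>

text \<open>The time set is \<open>[0,\<infinity>)\<close>; paths are \<open>undefined\<close> at negative times.\<close>

definition cadlag_paths :: "'e topology \<Rightarrow> (real \<Rightarrow> 'e) set" where
  "cadlag_paths Y = {x \<in> extensional {0..}.
     (\<forall>t\<ge>0. limitin Y x (x t) (at_right t)) \<and>
     (\<forall>t>0. \<exists>l. limitin Y x l (at_left t))}"

definition path_of :: "(real \<Rightarrow> 'w \<Rightarrow> 'e) \<Rightarrow> 'w \<Rightarrow> real \<Rightarrow> 'e" where
  "path_of X \<omega> = (\<lambda>t\<in>{0..}. X t \<omega>)"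

definition natural_filtration ::
    "'w measure \<Rightarrow> 'e measure \<Rightarrow> (real \<Rightarrow> 'w \<Rightarrow> 'e) \<Rightarrow> real \<Rightarrow> 'w measure" where
  "natural_filtration \<Omega> N X s =
     sigma (space \<Omega>) {X u -` A \<inter> space \<Omega> |u A. 0 \<le> u \<and> u \<le> s \<and> A \<in> sets N}"

text \<open>\<open>((X\<^sub>t), (P\<^sub>\<mu>)\<^sub>\<mu>\<^sub>\<in>\<^sub>S)\<close> is a cadlag Markov process on \<open>\<Omega>\<close> with values in \<open>S\<close> and transition function
  \<open>p\<close>. The values of \<open>P\<close> outside \<open>S\<close> are irrelevant.\<close>

definition cadlag_markov_process ::
    "'e topology \<Rightarrow> 'e set \<Rightarrow> (real \<Rightarrow> 'e \<Rightarrow> 'e measure) \<Rightarrow>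
     'w measure \<Rightarrow> (real \<Rightarrow> 'w \<Rightarrow> 'e) \<Rightarrow> ('e \<Rightarrow> 'w measure) \<Rightarrow> bool" where
  "cadlag_markov_process Y S p \<Omega> X P \<longleftrightarrow>
     (let N = borel_of Y in
      (\<forall>t\<ge>0. X t \<in> \<Omega> \<rightarrow>\<^sub>M restrict_space N S) \<and>
      (\<forall>\<omega>\<in>space \<Omega>. path_of X \<omega> \<in> cadlag_paths Y) \<and>
      P \<in> restrict_space N S \<rightarrow>\<^sub>M prob_algebra \<Omega> \<and>
      (\<forall>\<mu>\<in>S. \<forall>t\<ge>0. distr (P \<mu>) N (X t) = p t \<mu>) \<and>
      (\<forall>\<mu>\<in>S. \<forall>s\<ge>0. \<forall>t\<ge>0. \<forall>A\<in>sets N.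
         AE \<omega> in P \<mu>.
           real_cond_exp (P \<mu>) (natural_filtration \<Omega> N X s) (\<lambda>\<omega>'. indicator A (X (s + t) \<omega>')) \<omega>
             = measure (P (X s \<omega>)) {\<omega>' \<in> space \<Omega>. X t \<omega>' \<in> A}))"

text \<open>The measure \<open>\<integral>P\<^sub>\<mu> \<nu>(d\<mu>)\<close>, for \<open>\<nu>\<close> concentrated on \<open>S\<close>.\<close>

definition start_from :: "'e set \<Rightarrow> 'e measure \<Rightarrow> ('e \<Rightarrow> 'w measure) \<Rightarrow> 'w measure" where
  "start_from S \<nu> P = restrict_space \<nu> S \<bind> P"

definition resolvent ::
    "'e set \<Rightarrow> (real \<Rightarrow> 'w \<Rightarrow> 'e) \<Rightarrow> ('e \<Rightarrow> 'w measure) \<Rightarrow> real \<Rightarrow> ('e \<Rightarrow> real) \<Rightarrow> 'e \<Rightarrow> real" where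
  "resolvent S X P \<beta> g \<mu> =
     (if \<mu> \<in> S then LINT t:{0..}|lborel. exp (- \<beta> * t) * (\<integral>\<omega>. g (X t \<omega>) \<partial>P \<mu>) else 0)"

definition exit_time :: "(real \<Rightarrow> 'w \<Rightarrow> 'e) \<Rightarrow> 'e set \<Rightarrow> 'w \<Rightarrow> ereal" where
  "exit_time X A \<omega> = Inf {ereal t |t. 0 < t \<and> X t \<omega> \<notin> A}"

text \<open>The exit time is in general measurable only for the completion of the probability measure. As
  \<open>nn_integral_completion\<close> holds without measurability assumptions, the integral below is the
  integral for the completion.\<close>

definition expected_discount :: "'w measure \<Rightarrow> real \<Rightarrow> ('w \<Rightarrow> ereal) \<Rightarrow> ennreal" where
  "expected_discount Q \<beta> \<tau> =
     (\<integral>\<^sup>+\<omega>. (if \<tau> \<omega> = \<infinity> then 0 else ennreal (exp (- \<beta> * real_of_ereal (\<tau> \<omega>)))) \<partial>Q)"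

section \<open>The Skorohod space\<close>

text \<open>The metric of Ethier and Kurtz, Markov Processes, Section 3.5: for \<open>\<lambda>\<close> in the set \<open>\<Lambda>\<close> of strictly
  increasing bijections of \<open>[0,\<infinity>)\<close> with \<open>\<gamma>(\<lambda>) = sup\<^sub>s\<^sub><\<^sub>t \<bar>ln ((\<lambda>(t) - \<lambda>(s)) / (t - s))\<bar> < \<infinity>\<close>,
  \<open>d(x, y) = inf\<^sub>\<lambda> max \<gamma>(\<lambda>) (\<integral> exp(-u) sup\<^sub>t (min 1 (q(x(min t u), y(min \<lambda>(t) u)))) du)\<close>.\<close>

definition log_slopes :: "(real \<Rightarrow> real) \<Rightarrow> real set" where
  "log_slopes l = {\<bar>ln ((l t - l s) / (t - s))\<bar> |s t. 0 \<le> s \<and> s < t}"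

definition time_changes :: "(real \<Rightarrow> real) set" where
  "time_changes =
     {l. strict_mono_on {0..} l \<and> bij_betw l {0..} {0..} \<and> bdd_above (log_slopes l)}"

definition skorohod_dist :: "('e \<Rightarrow> 'e \<Rightarrow> real) \<Rightarrow> (real \<Rightarrow> 'e) \<Rightarrow> (real \<Rightarrow> 'e) \<Rightarrow> real" where
  "skorohod_dist q x y =
     (INF l\<in>time_changes. max (Sup (log_slopes l))
        (LINT u:{0..}|lborel. exp (- u) *
           (SUP t\<in>{0..}. min 1 (q (x (min t u)) (y (min (l t) u))))))"

definition skorohod_topology :: "'e set \<Rightarrow> ('e \<Rightarrow> 'e \<Rightarrow> real) \<Rightarrow> (real \<Rightarrow> 'e) topology" where
  "skorohod_topology E q = dist_topology (cadlag_paths (dist_topology E q)) (skorohod_dist q)"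

definition path_law ::
    "'e set \<Rightarrow> ('e \<Rightarrow> 'e \<Rightarrow> real) \<Rightarrow> 'w measure \<Rightarrow> (real \<Rightarrow> 'w \<Rightarrow> 'e) \<Rightarrow> (real \<Rightarrow> 'e) measure" where
  "path_law E q Q X = distr Q (borel_of (skorohod_topology E q)) (path_of X)"

section \<open>Algebras of continuous functions\<close>

definition separating_algebra :: "'e topology \<Rightarrow> ('e \<Rightarrow> real) set \<Rightarrow> bool" where
  "separating_algebra Y A \<longleftrightarrow>
     (\<forall>g\<in>A. continuous_map Y euclideanreal g) \<and>
     (\<forall>c. (\<lambda>_. c) \<in> A) \<and>
     (\<forall>f\<in>A. \<forall>g\<in>A. (\<lambda>x. f x + g x) \<in> A \<and> (\<lambda>x. f x * g x) \<in> A) \<and>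
     (\<forall>x\<in>topspace Y. \<forall>y\<in>topspace Y. x \<noteq> y \<longrightarrow> (\<exists>g\<in>A. g x \<noteq> g y))"

definition sup_norm :: "'e set \<Rightarrow> ('e \<Rightarrow> real) \<Rightarrow> real" where
  "sup_norm E g = (SUP x\<in>E. \<bar>g x\<bar>)"

end

theory Submission
  imports Defs
begin

text \<open>As \<open>\<nu>\<close> is the point mass at \<open>\<mu>\<^sub>0\<close>, the limiting \<open>L\<^sup>2\<close>-space is one-dimensional, so that the limiting
  process never leaves \<open>\<mu>\<^sub>0\<close>, and it suffices to show that \<open>X\<^sup>n\<close> stays close to \<open>\<mu>\<^sub>0\<close> on compact time
  intervals with probability tending to one. Since \<open>E\<close> is compact, closeness to \<open>\<mu>\<^sub>0\<close> is detected by a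
  function \<open>k \<ge> 0\<close> of the separating algebra with \<open>k \<mu>\<^sub>0 = 0\<close>, a sum of squares \<open>(g - g \<mu>\<^sub>0)\<^sup>2\<close>. By
  invariance \<open>\<beta> G\<^sub>n k\<close> has the same \<open>\<nu>\<^sub>n\<close>-integral as \<open>k\<close>, which tends to \<open>k \<mu>\<^sub>0 = 0\<close>. As
  \<open>exp (- \<beta> t) G\<^sub>n k (X\<^sup>n\<^sub>t)\<close> is a supermartingale, Doob's inequality bounds \<open>\<beta> G\<^sub>n k\<close> along the paths, and the
  exit time estimate allows one to replace \<open>\<beta> G\<^sub>n k\<close> by \<open>k\<close>. Neither \<open>G\<^sub>n k (X\<^sup>n)\<close> nor the exit time need be
  regular, because finite sets of times suffice: only \<open>k (X\<^sup>n)\<close> has to be right-continuous.\<close>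

text \<open>The function k is used twice. It is also the test function of the exit hypothesis, whose
  error must vanish: since k and \<beta> G_n k both lie in [0, c], the square of their difference is
  at most c (k + \<beta> G_n k), and by invariance this has integral 2 c times that of k. Hence the
  L^2 distance tends to 0, and \<open>\<epsilon> k n\<close> with it. So a single integral controls
  both this error and Doob's bound; the bound C on the densities carries the latter over from the
  invariant measure to the actual starting law. Two obstacles account for most of the length. The
  state space is given by formulas on representatives of classes, so the metric axioms, compactness
  and the closedness of the n-particle states must be extracted from the Prohorov inequalities. And
  the law of a process is an image measure on the Skorohod space, whose integrals can be computed
  along the process only when the path map is Borel measurable; this is obtained by approximating
  paths by discretized ones that depend on countable data. The convergence itself is then short,
  because near a constant path the identity is a good enough time change.\<close>

section \<open>The Prohorov distance on a compact space\<close>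

text \<open>The open set \<open>U\<close> carries the part of a measure that is visible in the quotient: the points of
  \<open>K - U\<close> are identified, and \<open>\<delta>\<close> is the resulting pseudometric.\<close>

locale prohorov_space =
  fixes K U :: "'a::metric_space set" and \<delta> :: "'a \<Rightarrow> 'a \<Rightarrow> real"
  assumes compact_K: "compact K" and K_nonempty: "K \<noteq> {}" and open_U: "open U"
    and \<delta>_nonneg: "0 \<le> \<delta> x y" and \<delta>_sym: "\<delta> x y = \<delta> y x"
    and \<delta>_triangle: "\<delta> x z \<le> \<delta> x y + \<delta> y z" and \<delta>_le_dist: "\<delta> x y \<le> dist x y"
    and \<delta>_collapse: "x \<in> K - U \<Longrightarrow> y \<in> K - U \<Longrightarrow> \<delta> x y = 0"
    and \<delta>_separates: "open G \<Longrightarrow> G \<subseteq> U \<Longrightarrow> y \<in> G \<inter> K \<Longrightarrow> \<exists>r>0. \<forall>x\<in>K. \<delta> x y < r \<longrightarrow> x \<in> G"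
begin

abbreviation "BK \<equiv> restrict_space borel K"
abbreviation "probs \<equiv> space (prob_algebra BK)"

definition nbhd :: "'a set \<Rightarrow> real \<Rightarrow> 'a set" where
  "nbhd A e = {y\<in>K. \<exists>x\<in>A. \<delta> x y < e}"

text \<open>Only one of the two Prohorov inequalities. Between probability measures it implies the
  reversed one, so the distance becomes an infimum over this single condition.\<close>

definition close :: "real \<Rightarrow> 'a measure \<Rightarrow> 'a measure \<Rightarrow> bool" where
  "close e \<nu>1 \<nu>2 \<longleftrightarrow> (\<forall>A\<in>sets BK. measure \<nu>1 A \<le> measure \<nu>2 (nbhd A e) + e)"

lemma \<delta>_refl: "\<delta> x x = 0"
  using \<delta>_nonneg[of x x] \<delta>_le_dist[of x x] by simp

lemma K_borel: "K \<in> sets borel"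
  using compact_K by (simp add: borel_closed compact_imp_closed)

lemma space_BK: "space BK = K"
  by (simp add: space_restrict_space)

lemma sets_BK: "A \<in> sets BK \<longleftrightarrow> A \<in> sets borel \<and> A \<subseteq> K"
  using K_borel by (auto simp: sets_restrict_space_iff)

lemma probsD:
  assumes "\<nu> \<in> probs"
  shows "sets \<nu> = sets BK" "space \<nu> = K" "prob_space \<nu>"
  using assms sets_eq_imp_space_eq[of \<nu> BK] by (auto simp: space_prob_algebra space_BK)

text \<open>The neighbourhood is relatively open in K for an arbitrary set A: if
  \<open>\<delta> x y < e\<close>, the triangle inequality and \<open>\<delta> \<le> dist\<close>
  put the whole metric ball of radius \<open>e - \<delta> x y\<close> around y, cut with K, inside
  it.\<close>

lemma nbhd_sets: "nbhd A e \<in> sets BK"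
proof -
  have "nbhd A e = K \<inter> (\<Union>x\<in>A. \<Union>y\<in>{y\<in>K. \<delta> x y < e}. ball y (e - \<delta> x y))"
  proof (intro equalityI subsetI)
    fix z assume "z \<in> nbhd A e"
    then show "z \<in> K \<inter> (\<Union>x\<in>A. \<Union>y\<in>{y\<in>K. \<delta> x y < e}. ball y (e - \<delta> x y))"
      by (force simp: nbhd_def)
  next
    fix z assume "z \<in> K \<inter> (\<Union>x\<in>A. \<Union>y\<in>{y\<in>K. \<delta> x y < e}. ball y (e - \<delta> x y))"
    then obtain x y where "z \<in> K" "x \<in> A" "dist y z < e - \<delta> x y" by auto
    moreover have "\<delta> x z \<le> \<delta> x y + dist y z"
      using \<delta>_triangle[of x z y] \<delta>_le_dist[of y z] by linarith
    ultimately show "z \<in> nbhd A e" by (auto simp: nbhd_def intro!: bexI[of _ x])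
  qed
  then show ?thesis
    unfolding sets_BK using sets.Int[OF K_borel borel_open[OF open_UN]]
    by (metis (no_types, lifting) inf_le1 open_UN open_ball)
qed

lemma nbhd_mono: "A \<subseteq> B \<Longrightarrow> e \<le> e' \<Longrightarrow> nbhd A e \<subseteq> nbhd B e'"
  by (force simp: nbhd_def)

lemma nbhd_superset: "A \<subseteq> K \<Longrightarrow> 0 < e \<Longrightarrow> A \<subseteq> nbhd A e"
  by (auto simp: nbhd_def \<delta>_refl intro!: bexI)

lemma close_mono:
  assumes "close e \<nu>1 \<nu>2" "e \<le> e'" "\<nu>2 \<in> probs"
  shows "close e' \<nu>1 \<nu>2"
  unfolding close_def
proof
  fix A assume "A \<in> sets BK"
  interpret prob_space \<nu>2 using probsD[OF assms(3)] by simp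
  have "measure \<nu>1 A \<le> measure \<nu>2 (nbhd A e) + e"
    using assms(1) \<open>A \<in> sets BK\<close> by (auto simp: close_def)
  moreover have "measure \<nu>2 (nbhd A e) \<le> measure \<nu>2 (nbhd A e')"
    by (intro finite_measure_mono nbhd_mono) (use assms nbhd_sets probsD in auto)
  ultimately show "measure \<nu>1 A \<le> measure \<nu>2 (nbhd A e') + e'"
    using assms(2) by linarith
qed

text \<open>Strassen's observation: apply the inequality to the complement of the neighbourhood.\<close>

lemma close_sym:
  assumes "close e \<nu>1 \<nu>2" "\<nu>1 \<in> probs" "\<nu>2 \<in> probs"
  shows "close e \<nu>2 \<nu>1"
  unfolding close_def
proof
  fix A assume A: "A \<in> sets BK"
  interpret p1: prob_space \<nu>1 using probsD[OF assms(2)] by simp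
  interpret p2: prob_space \<nu>2 using probsD[OF assms(3)] by simp
  have s: "nbhd X e \<in> sets \<nu>1" "nbhd X e \<in> sets \<nu>2" "A \<in> sets \<nu>2" for X
    using nbhd_sets probsD assms A by auto
  define B where "B = K - nbhd A e"
  have B: "B \<in> sets BK"
    unfolding B_def using nbhd_sets K_borel sets_BK by auto
  have "nbhd B e \<subseteq> K - A"
    unfolding B_def nbhd_def using \<delta>_sym by (auto) metis
  then have "A \<subseteq> K - nbhd B e" using A sets_BK by auto
  then have "measure \<nu>2 A \<le> measure \<nu>2 (K - nbhd B e)"
    using sets.compl_sets[OF s(2)] probsD(2)[OF assms(3)] by (intro p2.finite_measure_mono) auto
  also have "\<dots> = 1 - measure \<nu>2 (nbhd B e)"
    using p2.prob_compl[OF s(2)] probsD[OF assms(3)] by simp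
  also have "\<dots> \<le> 1 - measure \<nu>1 B + e"
    using assms(1) B by (auto simp: close_def)
  also have "measure \<nu>1 B = 1 - measure \<nu>1 (nbhd A e)"
    unfolding B_def using p1.prob_compl[OF s(1)] probsD[OF assms(2)] by simp
  finally show "measure \<nu>2 A \<le> measure \<nu>1 (nbhd A e) + e" by simp
qed

lemma close_trans:
  assumes "close e \<nu>1 \<nu>2" "close e' \<nu>2 \<nu>3" "\<nu>3 \<in> probs"
  shows "close (e + e') \<nu>1 \<nu>3"
  unfolding close_def
proof
  fix A assume A: "A \<in> sets BK"
  interpret prob_space \<nu>3 using probsD[OF assms(3)] by simp
  have "nbhd (nbhd A e) e' \<subseteq> nbhd A (e + e')"
  proof
    fix z assume "z \<in> nbhd (nbhd A e) e'"
    then obtain x y where "z \<in> K" "x \<in> A" "\<delta> x y < e" "\<delta> y z < e'"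
      by (auto simp: nbhd_def)
    then show "z \<in> nbhd A (e + e')"
      using \<delta>_triangle[of x z y] by (auto simp: nbhd_def intro!: bexI[of _ x])
  qed
  then have "measure \<nu>3 (nbhd (nbhd A e) e') \<le> measure \<nu>3 (nbhd A (e + e'))"
    by (intro finite_measure_mono) (use nbhd_sets probsD assms in auto)
  moreover have "measure \<nu>2 (nbhd A e) \<le> measure \<nu>3 (nbhd (nbhd A e) e') + e'"
    using assms(2) nbhd_sets by (auto simp: close_def)
  moreover have "measure \<nu>1 A \<le> measure \<nu>2 (nbhd A e) + e"
    using assms(1) A by (auto simp: close_def)
  ultimately show "measure \<nu>1 A \<le> measure \<nu>3 (nbhd A (e + e')) + (e + e')" by linarith
qed

lemma prohorov_dist_eq:
  assumes "\<nu>1 \<in> probs" "\<nu>2 \<in> probs"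
  shows "prohorov_dist \<delta> K \<nu>1 \<nu>2 = Inf {e. 0 < e \<and> close e \<nu>1 \<nu>2}"
proof -
  have "close e \<nu>1 \<nu>2 \<longleftrightarrow> (\<forall>A\<in>sets \<nu>1. measure \<nu>1 A \<le> measure \<nu>2 {y\<in>K. \<exists>x\<in>A. \<delta> x y < e} + e) \<and>
       (\<forall>A\<in>sets \<nu>2. measure \<nu>2 A \<le> measure \<nu>1 {y\<in>K. \<exists>x\<in>A. \<delta> x y < e} + e)" for e
    using close_sym[of e \<nu>1 \<nu>2] assms probsD(1)[OF assms(1)] probsD(1)[OF assms(2)]
    unfolding close_def nbhd_def by auto
  then show ?thesis unfolding prohorov_dist_def by simp
qed

lemma prohorov_dist_le:
  assumes "close e \<nu>1 \<nu>2" "0 < e" "\<nu>1 \<in> probs" "\<nu>2 \<in> probs"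
  shows "prohorov_dist \<delta> K \<nu>1 \<nu>2 \<le> e"
  unfolding prohorov_dist_eq[OF assms(3,4)]
  by (rule cInf_lower) (use assms in \<open>auto intro!: bdd_belowI[of _ 0]\<close>)

lemma prohorov_dist_set_nonempty:
  assumes "\<nu>1 \<in> probs" "\<nu>2 \<in> probs"
  shows "{e. 0 < e \<and> close e \<nu>1 \<nu>2} \<noteq> {}"
proof -
  interpret prob_space \<nu>1 using probsD[OF assms(1)] by simp
  have "close 1 \<nu>1 \<nu>2"
    unfolding close_def using prob_le_1 by (smt (verit) measure_nonneg)
  then have "1 \<in> {e. 0 < e \<and> close e \<nu>1 \<nu>2}" by simp
  then show ?thesis by blast
qed

lemma prohorov_dist_nonneg:
  assumes "\<nu>1 \<in> probs" "\<nu>2 \<in> probs"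
  shows "0 \<le> prohorov_dist \<delta> K \<nu>1 \<nu>2"
  unfolding prohorov_dist_eq[OF assms]
  by (rule cInf_greatest[OF prohorov_dist_set_nonempty[OF assms]]) auto

lemma prohorov_dist_lessD:
  assumes "prohorov_dist \<delta> K \<nu>1 \<nu>2 < e" "\<nu>1 \<in> probs" "\<nu>2 \<in> probs"
  shows "close e \<nu>1 \<nu>2"
proof -
  obtain e' where "e' < e" "close e' \<nu>1 \<nu>2"
    using cInf_lessD[OF prohorov_dist_set_nonempty[OF assms(2,3)]] assms(1)
    unfolding prohorov_dist_eq[OF assms(2,3)] by blast
  then show ?thesis using close_mono assms by auto
qed

lemma prohorov_dist_sym:
  assumes "\<nu>1 \<in> probs" "\<nu>2 \<in> probs"
  shows "prohorov_dist \<delta> K \<nu>1 \<nu>2 = prohorov_dist \<delta> K \<nu>2 \<nu>1"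
proof -
  have "{e. 0 < e \<and> close e \<nu>1 \<nu>2} = {e. 0 < e \<and> close e \<nu>2 \<nu>1}"
    using close_sym assms by blast
  then show ?thesis by (simp add: prohorov_dist_eq assms)
qed

lemma prohorov_dist_triangle:
  assumes "\<nu>1 \<in> probs" "\<nu>2 \<in> probs" "\<nu>3 \<in> probs"
  shows "prohorov_dist \<delta> K \<nu>1 \<nu>3 \<le> prohorov_dist \<delta> K \<nu>1 \<nu>2 + prohorov_dist \<delta> K \<nu>2 \<nu>3"
    (is "_ \<le> ?a + ?b")
proof (rule field_le_epsilon)
  fix e :: real assume "0 < e"
  then have "close (?a + e/2) \<nu>1 \<nu>2" "close (?b + e/2) \<nu>2 \<nu>3"
    by (auto intro!: prohorov_dist_lessD assms)
  then have "close (?a + e/2 + (?b + e/2)) \<nu>1 \<nu>3"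
    using close_trans assms by blast
  moreover have "0 \<le> ?a" "0 \<le> ?b" using prohorov_dist_nonneg assms by auto
  ultimately have "prohorov_dist \<delta> K \<nu>1 \<nu>3 \<le> ?a + e/2 + (?b + e/2)"
    using \<open>0 < e\<close> assms by (intro prohorov_dist_le) auto
  then show "prohorov_dist \<delta> K \<nu>1 \<nu>3 \<le> ?a + ?b + e" by simp
qed

text \<open>A subset of U has the same mass under both measures. Any other A contains a point of K -
  U, which is at distance 0 from all of K - U, so the neighbourhood of A swallows K - U; the masses
  are then compared through the complement of A inside U, where the measures agree.\<close>

lemma close_if_restrict_eq:
  assumes "restrict_space \<nu>1 (K \<inter> U) = restrict_space \<nu>2 (K \<inter> U)"
    and \<nu>: "\<nu>1 \<in> probs" "\<nu>2 \<in> probs" and "0 < e"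
  shows "close e \<nu>1 \<nu>2"
  unfolding close_def
proof
  fix A assume A: "A \<in> sets BK"
  interpret p1: prob_space \<nu>1 using probsD[OF \<nu>(1)] by simp
  interpret p2: prob_space \<nu>2 using probsD[OF \<nu>(2)] by simp
  have KU: "K \<inter> U \<in> sets BK" using K_borel open_U sets_BK by auto
  have eq: "measure \<nu>1 B = measure \<nu>2 B" if "B \<in> sets BK" "B \<subseteq> U" for B
  proof -
    have "B \<subseteq> K \<inter> U" using that sets_BK by auto
    then have "measure (restrict_space \<nu>1 (K \<inter> U)) B = measure \<nu>1 B"
      "measure (restrict_space \<nu>2 (K \<inter> U)) B = measure \<nu>2 B"
      using KU probsD[OF \<nu>(1)] probsD[OF \<nu>(2)]
      by (auto intro!: measure_restrict_space simp: Int_absorb2 sets.Int_space_eq2)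
    then show ?thesis using assms(1) by simp
  qed
  show "measure \<nu>1 A \<le> measure \<nu>2 (nbhd A e) + e"
  proof (cases "A \<subseteq> U")
    case True
    then have "measure \<nu>1 A = measure \<nu>2 A" using eq A by simp
    also have "\<dots> \<le> measure \<nu>2 (nbhd A e)"
      using nbhd_superset[of A e] \<open>0 < e\<close> A sets_BK nbhd_sets probsD[OF \<nu>(2)]
      by (intro p2.finite_measure_mono) auto
    finally show ?thesis using \<open>0 < e\<close> by simp
  next
    case False
    then obtain a where a: "a \<in> A" "a \<in> K - U" using A sets_BK by auto
    define C where "C = (K \<inter> U) - A"
    have C: "C \<in> sets BK" "C \<subseteq> U" using A KU by (auto simp: C_def)
    have "A \<subseteq> K - C" using A sets_BK by (auto simp: C_def)
    then have "measure \<nu>1 A \<le> measure \<nu>1 (K - C)"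
      by (intro p1.finite_measure_mono) (use C probsD[OF \<nu>(1)] in auto)
    also have "\<dots> = 1 - measure \<nu>1 C"
      using p1.prob_compl[of C] C probsD[OF \<nu>(1)] by simp
    also have "\<dots> = 1 - measure \<nu>2 C" using eq C by simp
    also have "\<dots> = measure \<nu>2 (K - C)"
      using p2.prob_compl[of C] C probsD[OF \<nu>(2)] by simp
    also have "\<dots> \<le> measure \<nu>2 (nbhd A e)"
    proof (intro p2.finite_measure_mono)
      show "K - C \<subseteq> nbhd A e"
      proof
        fix y assume y: "y \<in> K - C"
        show "y \<in> nbhd A e"
        proof (cases "y \<in> U")
          case True
          then show ?thesis using y nbhd_superset[of A e] \<open>0 < e\<close> A sets_BK by (auto simp: C_def)
        next
          case False
          then have "\<delta> a y = 0" using a y \<delta>_collapse by auto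
          then show ?thesis using a y \<open>0 < e\<close> by (auto simp: nbhd_def intro!: bexI[of _ a])
        qed
      qed
    qed (use nbhd_sets probsD[OF \<nu>(2)] in auto)
    finally show ?thesis using \<open>0 < e\<close> by simp
  qed
qed

text \<open>The neighbourhoods of K - G of radius 1/(n+1) shrink to K - G itself, because
  \<open>\<delta>_separates\<close> keeps every point of G at positive distance from it. Continuity
  from above then gives the limit of the inequalities.\<close>

lemma measure_closed_le_if_close:
  assumes "open G" "G \<subseteq> U" and close: "\<And>e. 0 < e \<Longrightarrow> close e \<nu> \<nu>'" and \<nu>: "\<nu> \<in> probs" "\<nu>' \<in> probs"
  shows "measure \<nu> (K - G) \<le> measure \<nu>' (K - G)"
proof -
  interpret prob_space \<nu>' using probsD[OF \<nu>(2)] by simp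
  define F where "F = K - G"
  have F: "F \<in> sets BK" unfolding F_def sets_BK using K_borel assms by auto
  have "(\<lambda>n. measure \<nu>' (nbhd F (inverse (real (Suc n))))) \<longlonglongrightarrow> measure \<nu>' (\<Inter>n. nbhd F (inverse (real (Suc n))))"
  proof (rule finite_Lim_measure_decseq)
    show "range (\<lambda>n. nbhd F (inverse (real (Suc n)))) \<subseteq> sets \<nu>'"
      using nbhd_sets probsD[OF \<nu>(2)] by auto
    show "decseq (\<lambda>n. nbhd F (inverse (real (Suc n))))"
      unfolding decseq_def
    proof (intro allI impI nbhd_mono)
      fix m n :: nat assume "m \<le> n"
      then show "inverse (real (Suc n)) \<le> inverse (real (Suc m))"
        by (intro le_imp_inverse_le) simp_all
    qed simp
  qed
  moreover have "(\<Inter>n. nbhd F (inverse (real (Suc n)))) = F"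
  proof
    show "F \<subseteq> (\<Inter>n. nbhd F (inverse (real (Suc n))))"
    proof
      fix y assume "y \<in> F"
      have "F \<subseteq> nbhd F (inverse (real (Suc n)))" for n
        by (rule nbhd_superset) (simp_all add: F_def)
      then show "y \<in> (\<Inter>n. nbhd F (inverse (real (Suc n))))" using \<open>y \<in> F\<close> by (meson INT_I subsetD)
    qed
    show "(\<Inter>n. nbhd F (inverse (real (Suc n)))) \<subseteq> F"
    proof
      fix y assume y: "y \<in> (\<Inter>n. nbhd F (inverse (real (Suc n))))"
      then have "y \<in> nbhd F (inverse (real (Suc 0)))" by blast
      then have "y \<in> K" unfolding nbhd_def by blast
      show "y \<in> F"
      proof (rule ccontr)
        assume "y \<notin> F"
        then have "y \<in> G \<inter> K" using \<open>y \<in> K\<close> by (auto simp: F_def)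
        then obtain r where r: "r > 0" "\<forall>x\<in>K. \<delta> x y < r \<longrightarrow> x \<in> G"
          using \<delta>_separates assms(1,2) by meson
        obtain n where n: "inverse (real (Suc n)) < r" using reals_Archimedean r(1) by blast
        have "y \<in> nbhd F (inverse (real (Suc n)))" using y by blast
        then obtain x where "x \<in> F" "\<delta> x y < inverse (real (Suc n))" unfolding nbhd_def by blast
        then have "x \<in> K" "x \<notin> G" "\<delta> x y < r" using n by (simp_all add: F_def)
        then show False using r by blast
      qed
    qed
  qed
  ultimately have "(\<lambda>n. measure \<nu>' (nbhd F (inverse (real (Suc n))))) \<longlonglongrightarrow> measure \<nu>' F"
    by (simp only:)
  then have lim: "(\<lambda>n. measure \<nu>' (nbhd F (inverse (real (Suc n)))) + inverse (real (Suc n)))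
      \<longlonglongrightarrow> measure \<nu>' F + 0"
    by (rule tendsto_add[OF _ LIMSEQ_inverse_real_of_nat])
  have "measure \<nu> F \<le> measure \<nu>' (nbhd F (inverse (real (Suc n)))) + inverse (real (Suc n))" for n
    using close[of "inverse (real (Suc n))"] F unfolding close_def by simp
  then have "measure \<nu> F \<le> measure \<nu>' F + 0"
    by (rule LIMSEQ_le_const[OF lim, OF exI, OF allI, OF impI])
  then show ?thesis unfolding F_def by simp
qed

text \<open>Complements turn the inequality for relatively closed sets, used in both directions,
  into equality on the traces of open subsets of U. These traces are stable under intersection and
  generate the Borel sets of the visible part.\<close>

lemma restrict_eq_if_close:
  assumes close: "\<And>e. 0 < e \<Longrightarrow> close e \<nu>1 \<nu>2" and \<nu>: "\<nu>1 \<in> probs" "\<nu>2 \<in> probs"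
  shows "restrict_space \<nu>1 (K \<inter> U) = restrict_space \<nu>2 (K \<inter> U)"
proof -
  interpret p1: prob_space \<nu>1 using probsD[OF \<nu>(1)] by simp
  interpret p2: prob_space \<nu>2 using probsD[OF \<nu>(2)] by simp
  have KU: "K \<inter> U \<in> sets BK" using K_borel open_U sets_BK by auto
  have open_eq: "measure \<nu>1 (K \<inter> G) = measure \<nu>2 (K \<inter> G)" if G: "open G" "G \<subseteq> U" for G
  proof -
    have KG: "K \<inter> G \<in> sets BK" unfolding sets_BK using K_borel that by auto
    have "measure \<nu>1 (K - G) = measure \<nu>2 (K - G)"
      using measure_closed_le_if_close[OF G close \<nu>]
        measure_closed_le_if_close[OF G close_sym[OF close \<nu>] \<nu>(2,1)] by simp
    moreover have "measure \<nu>1 (K - K \<inter> G) = 1 - measure \<nu>1 (K \<inter> G)"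
      "measure \<nu>2 (K - K \<inter> G) = 1 - measure \<nu>2 (K \<inter> G)"
      using p1.prob_compl[of "K \<inter> G"] p2.prob_compl[of "K \<inter> G"] KG probsD[OF \<nu>(1)] probsD[OF \<nu>(2)]
      by auto
    moreover have "K - K \<inter> G = K - G" by auto
    ultimately show ?thesis by simp
  qed
  let ?E = "(\<inter>) (K \<inter> U) ` {S. open S}"
  have sets_eq: "sets (restrict_space \<nu> (K \<inter> U)) = sigma_sets (K \<inter> U) ?E" if "\<nu> \<in> probs" for \<nu>
  proof -
    have "sets (restrict_space \<nu> (K \<inter> U)) = sets (restrict_space borel (K \<inter> U))"
    proof -
      have "sets (restrict_space \<nu> (K \<inter> U)) = sets (restrict_space BK (K \<inter> U))"
        using probsD(1)[OF that] by (simp only: sets_restrict_space)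
      also have "restrict_space BK (K \<inter> U) = restrict_space borel (K \<inter> U)"
        using K_borel open_U by (subst restrict_restrict_space) (auto simp: Int_absorb1)
      finally show ?thesis .
    qed
    also have "\<dots> = sigma_sets (K \<inter> U) ?E"
      unfolding sets_restrict_space
      using sigma_sets_Int[of "K \<inter> U" UNIV "{S. open S}"] sets.Int[OF K_borel borel_open[OF open_U]]
      by (simp add: borel_def sets_measure_of)
    finally show ?thesis .
  qed
  show ?thesis
  proof (rule measure_eqI_generator_eq[where E = ?E and \<Omega> = "K \<inter> U" and A = "\<lambda>_. K \<inter> U"])
    show "Int_stable ?E"
    proof (rule Int_stableI)
      fix a b assume "a \<in> ?E" "b \<in> ?E"
      then obtain S T where "open S" "open T" "a = K \<inter> U \<inter> S" "b = K \<inter> U \<inter> T" by auto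
      then show "a \<inter> b \<in> ?E" by (intro image_eqI[of _ _ "S \<inter> T"]) auto
    qed
    show "?E \<subseteq> Pow (K \<inter> U)" by auto
    fix X assume "X \<in> ?E"
    then obtain S where S: "open S" "X = K \<inter> U \<inter> S" by auto
    have "emeasure \<nu>1 X = emeasure \<nu>2 X"
      using open_eq[of "U \<inter> S"] S open_U
      by (simp add: p1.emeasure_eq_measure p2.emeasure_eq_measure open_Int Int_assoc)
    then show "emeasure (restrict_space \<nu>1 (K \<inter> U)) X = emeasure (restrict_space \<nu>2 (K \<inter> U)) X"
      using KU probsD[OF \<nu>(1)] probsD[OF \<nu>(2)] S
      by (subst (1 2) emeasure_restrict_space) (auto simp: sets.Int_space_eq2)
  next
    show "sets (restrict_space \<nu>1 (K \<inter> U)) = sigma_sets (K \<inter> U) ?E" by (rule sets_eq[OF \<nu>(1)])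
    show "sets (restrict_space \<nu>2 (K \<inter> U)) = sigma_sets (K \<inter> U) ?E" by (rule sets_eq[OF \<nu>(2)])
    show "range (\<lambda>_. K \<inter> U) \<subseteq> ?E" by (auto intro!: image_eqI[of _ _ UNIV])
    show "(\<Union>i. K \<inter> U) = K \<inter> U" by simp
    have "emeasure (restrict_space \<nu>1 (K \<inter> U)) (K \<inter> U) = emeasure \<nu>1 (K \<inter> U)"
      using KU probsD[OF \<nu>(1)] by (intro emeasure_restrict_space) (auto simp: sets.Int_space_eq2)
    then show "emeasure (restrict_space \<nu>1 (K \<inter> U)) (K \<inter> U) \<noteq> \<infinity>"
      using p1.emeasure_finite by simp
  qed
qed

definition visible_states :: "'a measure set" where
  "visible_states = (\<lambda>\<nu>. restrict_space \<nu> (K \<inter> U)) ` probs"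

definition rep :: "'a measure \<Rightarrow> 'a measure" where
  "rep = inv_into probs (\<lambda>\<nu>. restrict_space \<nu> (K \<inter> U))"

definition sdist :: "'a measure \<Rightarrow> 'a measure \<Rightarrow> real" where
  "sdist \<mu> \<mu>' = prohorov_dist \<delta> K (rep \<mu>) (rep \<mu>')"

lemma rep:
  assumes "\<mu> \<in> visible_states"
  shows "rep \<mu> \<in> probs" "restrict_space (rep \<mu>) (K \<inter> U) = \<mu>"
  using inv_into_into[OF assms[unfolded visible_states_def]] f_inv_into_f[OF assms[unfolded visible_states_def]]
  by (simp_all add: rep_def)

text \<open>Allows any representatives to be used for estimates: the ones picked by
  \<open>rep\<close> have the same visible part, so the two detours cost an arbitrarily small
  \<eta>.\<close>

lemma sdist_restrict_le:
  assumes "close e \<nu> \<nu>'" "0 < e" "\<nu> \<in> probs" "\<nu>' \<in> probs"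
  shows "sdist (restrict_space \<nu> (K \<inter> U)) (restrict_space \<nu>' (K \<inter> U)) \<le> e"
proof (rule field_le_epsilon)
  fix \<eta> :: real assume \<eta>: "0 < \<eta>"
  let ?r = "\<lambda>\<nu>. rep (restrict_space \<nu> (K \<inter> U))"
  have r: "?r \<nu> \<in> probs" "restrict_space (?r \<nu>) (K \<inter> U) = restrict_space \<nu> (K \<inter> U)"
    if "\<nu> \<in> probs" for \<nu>
    using rep[of "restrict_space \<nu> (K \<inter> U)"] that unfolding visible_states_def by auto
  have "close (\<eta>/2) (?r \<nu>) \<nu>" "close (\<eta>/2) \<nu>' (?r \<nu>')"
    using close_if_restrict_eq r assms \<eta> by auto
  then have "close (\<eta>/2 + e + \<eta>/2) (?r \<nu>) (?r \<nu>')"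
    using close_trans r assms by meson
  then have "prohorov_dist \<delta> K (?r \<nu>) (?r \<nu>') \<le> \<eta>/2 + e + \<eta>/2"
    using r assms \<eta> by (intro prohorov_dist_le) auto
  then show "sdist (restrict_space \<nu> (K \<inter> U)) (restrict_space \<nu>' (K \<inter> U)) \<le> e + \<eta>"
    unfolding sdist_def by simp
qed

text \<open>Extended by 0 because \<open>Metric_space\<close> asks for nonnegativity and symmetry at
  all arguments, while \<open>rep\<close> is arbitrary outside the states.\<close>

definition state_metric :: "'a measure \<Rightarrow> 'a measure \<Rightarrow> real" where
  "state_metric \<mu> \<mu>' = (if \<mu> \<in> visible_states \<and> \<mu>' \<in> visible_states then sdist \<mu> \<mu>' else 0)"

lemma Metric_space_states: "Metric_space visible_states state_metric"
proof
  show "0 \<le> state_metric \<mu> \<mu>'" for \<mu> \<mu>'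
    unfolding state_metric_def sdist_def using prohorov_dist_nonneg rep by simp
  show "state_metric \<mu> \<mu>' = state_metric \<mu>' \<mu>" for \<mu> \<mu>'
    unfolding state_metric_def sdist_def using prohorov_dist_sym rep by simp
  show "state_metric \<mu> \<mu>' = 0 \<longleftrightarrow> \<mu> = \<mu>'" if "\<mu> \<in> visible_states" "\<mu>' \<in> visible_states" for \<mu> \<mu>'
  proof
    assume "state_metric \<mu> \<mu>' = 0"
    then have "close e (rep \<mu>) (rep \<mu>')" if "0 < e" for e
      using \<open>\<mu> \<in> visible_states\<close> \<open>\<mu>' \<in> visible_states\<close> that rep
      by (intro prohorov_dist_lessD) (auto simp: state_metric_def sdist_def)
    then have "restrict_space (rep \<mu>) (K \<inter> U) = restrict_space (rep \<mu>') (K \<inter> U)"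
      using restrict_eq_if_close rep that by blast
    then show "\<mu> = \<mu>'" using rep that by simp
  next
    assume "\<mu> = \<mu>'"
    have "sdist \<mu> \<mu> \<le> e" if "0 < e" for e
      unfolding sdist_def using rep[OF \<open>\<mu> \<in> visible_states\<close>] that
      by (intro prohorov_dist_le close_if_restrict_eq) auto
    then have "sdist \<mu> \<mu> \<le> 0" by (meson dense leD leI)
    moreover have "0 \<le> sdist \<mu> \<mu>"
      unfolding sdist_def using prohorov_dist_nonneg rep that by simp
    ultimately show "state_metric \<mu> \<mu>' = 0" using \<open>\<mu> = \<mu>'\<close> that by (simp add: state_metric_def)
  qed
  show "state_metric \<mu> \<mu>'' \<le> state_metric \<mu> \<mu>' + state_metric \<mu>' \<mu>''"
    if "\<mu> \<in> visible_states" "\<mu>' \<in> visible_states" "\<mu>'' \<in> visible_states" for \<mu> \<mu>' \<mu>''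
    unfolding state_metric_def sdist_def using that rep prohorov_dist_triangle by simp
qed

end

section \<open>Compactness of the space of probability measures\<close>

text \<open>This stands in for a diagonal argument: by Tychonoff the functions into K form a compact
  set, and over a countable index type the product is metrizable, so compactness gives convergent
  subsequences.\<close>

lemma seq_compact_fun:
  fixes f :: "nat \<Rightarrow> 'c::countable \<Rightarrow> 'a::metric_space"
  assumes "compact K" "\<And>j w. f j w \<in> K"
  obtains m r where "strict_mono r" "\<And>w. m w \<in> K" "\<And>w. (\<lambda>j. f (r j) w) \<longlonglongrightarrow> m w"
proof -
  have "compactin (product_topology (\<lambda>_. euclidean) (UNIV :: 'c set)) (PiE UNIV (\<lambda>_. K))"
    using assms(1) by (simp add: compactin_PiE compactin_euclidean_iff)
  then have "compact (PiE UNIV (\<lambda>_ :: 'c. K))"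
    unfolding euclidean_product_topology by (simp add: compactin_euclidean_iff)
  then have "seq_compact (PiE UNIV (\<lambda>_ :: 'c. K))"
    using compact_eq_seq_compact_metric by blast
  moreover have "\<forall>j. f j \<in> PiE UNIV (\<lambda>_. K)" using assms(2) by auto
  ultimately obtain m r where mr: "m \<in> PiE UNIV (\<lambda>_. K)" "strict_mono r" "(f \<circ> r) \<longlonglongrightarrow> m"
    unfolding seq_compact_def by meson
  have "(\<lambda>j. f (r j) w) \<longlonglongrightarrow> m w" for w
  proof -
    have "isCont (\<lambda>x. x w) m"
      using continuous_on_product_coordinates[of w] continuous_on_eq_continuous_at[of UNIV "\<lambda>x. x w"]
      by blast
    then show ?thesis using isCont_tendsto_compose[OF _ mr(3)] by (simp add: o_def)
  qed
  moreover have "m w \<in> K" for w using mr(1) by auto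
  ultimately show thesis using that mr(2) by blast
qed

text \<open>Words over \<open>nat\<close> are read from right to left. Given a consistent assignment of masses, the words
  of length \<open>k\<close> label disjoint subintervals of \<open>[0, 1)\<close> whose lengths are the masses.\<close>

locale word_masses =
  fixes m :: "nat list \<Rightarrow> real" and M :: "nat \<Rightarrow> nat"
  assumes m_nonneg: "0 \<le> m v" and m_Nil: "m [] = 1"
    and m_split: "m v = (\<Sum>i<M (length v). m (i # v))"
    and m_zero: "M (length v) \<le> i \<Longrightarrow> m (i # v) = 0"
begin

text \<open>The left end of the interval of a word: within the interval of its parent, the siblings
  with smaller last-read digit come first.\<close>

primrec left :: "nat list \<Rightarrow> real" where
  "left [] = 0"
| "left (i # v) = left v + (\<Sum>i'<i. m (i' # v))"

definition digit :: "nat list \<Rightarrow> real \<Rightarrow> nat" where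
  "digit v u = (LEAST i. u < left v + (\<Sum>i'<Suc i. m (i' # v)))"

primrec word :: "nat \<Rightarrow> real \<Rightarrow> nat list" where
  "word 0 u = []"
| "word (Suc k) u = digit (word k u) u # word k u"

lemma length_word [simp]: "length (word k u) = k"
  by (induction k) auto

lemma sum_m_le: "(\<Sum>i'<i. m (i' # v)) \<le> m v"
proof -
  have "(\<Sum>i'<i. m (i' # v)) = (\<Sum>i'\<in>{..<i} \<inter> {..<M (length v)}. m (i' # v))"
    by (rule sum.mono_neutral_right) (auto intro: m_zero)
  also have "\<dots> \<le> (\<Sum>i'<M (length v). m (i' # v))"
    by (rule sum_mono2) (auto intro: m_nonneg)
  finally show ?thesis using m_split[of v] by simp
qed

lemma left_nested: "left v \<le> left (i # v)" "left (i # v) + m (i # v) \<le> left v + m v"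
  using sum_m_le[of v "Suc i"] by (auto intro!: sum_nonneg m_nonneg)

lemma left_bounds: "0 \<le> left v \<and> left v + m v \<le> 1"
proof (induction v)
  case (Cons i v)
  then show ?case using left_nested[where v = v and i = i] by linarith
qed (simp add: m_Nil)

lemma digit_eq_iff:
  assumes "left v \<le> u" "u < left v + m v"
  shows "digit v u = i \<longleftrightarrow> left (i # v) \<le> u \<and> u < left (i # v) + m (i # v)"
proof
  let ?P = "\<lambda>i. u < left v + (\<Sum>i'<Suc i. m (i' # v))"
  have "0 < M (length v)"
    using assms m_split[of v] by (cases "M (length v)") auto
  \<comment> \<open>The interval of v is nonempty, so it has children, and the last of them ends
    where it ends. This witness keeps the \<open>LEAST\<close> in \<open>digit\<close>
    meaningful.\<close>
  then have ex: "?P (M (length v) - 1)"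
    using assms(2) m_split[of v] by simp
  assume i: "digit v u = i"
  have "?P i" using LeastI[of ?P, OF ex] i unfolding digit_def by simp
  moreover have "left (i # v) \<le> u"
  proof (cases i)
    case (Suc j)
    then have "\<not> ?P j" using not_less_Least[of j ?P] i unfolding digit_def by simp
    then show ?thesis using Suc by simp
  qed (use assms in simp)
  ultimately show "left (i # v) \<le> u \<and> u < left (i # v) + m (i # v)" by simp
next
  assume i: "left (i # v) \<le> u \<and> u < left (i # v) + m (i # v)"
  show "digit v u = i"
    unfolding digit_def
  proof (rule Least_equality)
    show "u < left v + (\<Sum>i'<Suc i. m (i' # v))" using i by simp
    fix j assume j: "u < left v + (\<Sum>i'<Suc j. m (i' # v))"
    show "i \<le> j"
    proof (rule ccontr)
      assume "\<not> i \<le> j"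
      then have "(\<Sum>i'<Suc j. m (i' # v)) \<le> (\<Sum>i'<i. m (i' # v))"
        by (intro sum_mono2) (auto intro: m_nonneg)
      then show False using i j by simp
    qed
  qed
qed

lemma word_eq_iff:
  assumes "0 \<le> u" "u < 1"
  shows "word k u = v \<longleftrightarrow> length v = k \<and> left v \<le> u \<and> u < left v + m v"
proof (induction k arbitrary: v)
  case 0
  then show ?case using assms by (auto simp: m_Nil)
next
  case (Suc k)
  show ?case
  proof (cases v)
    case (Cons i w)
    have "word (Suc k) u = v \<longleftrightarrow> word k u = w \<and> digit w u = i"
      using Cons by auto
    also have "\<dots> \<longleftrightarrow> (length w = k \<and> left w \<le> u \<and> u < left w + m w) \<and> digit w u = i"
      using Suc.IH by simp
    also have "\<dots> \<longleftrightarrow> length w = k \<and> left (i # w) \<le> u \<and> u < left (i # w) + m (i # w)"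
      using digit_eq_iff[of w u i] left_nested[where v = w and i = i] by (smt (verit))
    finally show ?thesis using Cons by simp
  qed simp
qed

lemma word_vimage:
  "word k -` {v} \<inter> {0..<1} = (if length v = k then {left v..<left v + m v} else {})"
  using word_eq_iff[of _ k v] left_bounds[of v] by (auto simp del: word.simps)

abbreviation unit_lebesgue :: "real measure" where
  "unit_lebesgue \<equiv> restrict_space lborel {0..<1}"

lemma prob_space_unit_lebesgue: "prob_space unit_lebesgue"
  by standard (simp add: emeasure_restrict_space space_restrict_space)

lemma measurable_word [measurable]: "word k \<in> unit_lebesgue \<rightarrow>\<^sub>M count_space UNIV"
  by (subst measurable_count_space_eq2_countable)
    (auto simp: space_restrict_space word_vimage left_bounds sets_restrict_space_iff simp del: word.simps)

lemma measure_word: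
  "measure unit_lebesgue (word k -` {v} \<inter> {0..<1}) = (if length v = k then m v else 0)"
  unfolding word_vimage using left_bounds[of v] m_nonneg[of v]
  by (auto simp: measure_restrict_space)

end

text \<open>The points whose codes at the scales 0, 1, 2, ... are the digits of the word read from
  the right. Consing a digit refines, so a tail of a word names a coarser cylinder.\<close>

primrec cylinder :: "'a set \<Rightarrow> (nat \<Rightarrow> 'a \<Rightarrow> nat) \<Rightarrow> nat list \<Rightarrow> 'a set" where
  "cylinder K c [] = K"
| "cylinder K c (i # v) = {x \<in> cylinder K c v. c (length v) x = i}"

primrec words :: "(nat \<Rightarrow> nat) \<Rightarrow> nat \<Rightarrow> nat list set" where
  "words M 0 = {[]}"
| "words M (Suc n) = (\<Union>v\<in>words M n. (\<lambda>i. i # v) ` {..<M n})"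

lemma finite_words: "finite (words M n)"
  by (induction n) auto

lemma length_words: "v \<in> words M n \<Longrightarrow> length v = n"
  by (induction n arbitrary: v) auto

lemma cylinder_subset: "cylinder K c v \<subseteq> K"
  by (induction v) auto

lemma cylinder_cover:
  assumes "x \<in> K" "\<And>k. c k x < M k"
  shows "\<exists>v\<in>words M n. x \<in> cylinder K c v"
proof (induction n)
  case (Suc n)
  then obtain v where v: "v \<in> words M n" "x \<in> cylinder K c v" by blast
  then show ?case
    using assms(2)[of n] by (auto simp: length_words intro!: bexI[of _ v])
qed (use assms in auto)

section \<open>Sequential compactness of the probability measures, and closedness of the particle
  states\<close>

context prohorov_space
begin

lemma cylinder_sets:
  assumes "\<And>k. c k \<in> BK \<rightarrow>\<^sub>M count_space UNIV"
  shows "cylinder K c v \<in> sets BK"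
proof (induction v)
  case Nil
  then show ?case using K_borel sets_BK by simp
next
  case (Cons i v)
  have "c (length v) -` {i} \<inter> K \<in> sets BK"
    using measurable_sets[OF assms, of "{i}"] space_BK by simp
  moreover have "cylinder K c (i # v) = cylinder K c v \<inter> (c (length v) -` {i} \<inter> K)"
    using cylinder_subset[of K c v] by auto
  ultimately show ?case using Cons by auto
qed

text \<open>At scale k, finitely many balls of radius (1/2)^(k+1) cover K, and a point is coded by
  the first ball that contains it. Two points with the same code share a ball, which gives the
  distance (1/2)^k; taking the first ball makes the code measurable.\<close>

lemma obtain_coding:
  obtains c :: "nat \<Rightarrow> 'a \<Rightarrow> nat" and M where "\<And>k. c k \<in> BK \<rightarrow>\<^sub>M count_space UNIV"
    "\<And>k x. x \<in> K \<Longrightarrow> c k x < M k"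
    "\<And>k x y. x \<in> K \<Longrightarrow> y \<in> K \<Longrightarrow> c k x = c k y \<Longrightarrow> dist x y < (1/2)^k"
proof -
  have "\<exists>b n. K \<subseteq> (\<Union>i<(n::nat). ball (b i) ((1/2)^Suc k))" for k
  proof -
    obtain S where S: "finite S" "K \<subseteq> (\<Union>x\<in>S. ball x ((1/2)^Suc k))"
      using compact_K unfolding compact_eq_totally_bounded by (metis half_gt_zero zero_less_one zero_less_power)
    obtain b where "bij_betw b {0..<card S} S" using ex_bij_betw_nat_finite[OF S(1)] by blast
    then obtain n :: nat where "S = b ` {..<n}" by (metis bij_betw_def atLeast0LessThan)
    then show ?thesis using S(2) by (intro exI[of _ b] exI[of _ n]) simp
  qed
  then obtain b M where b: "\<And>k. K \<subseteq> (\<Union>i<(M k::nat). ball (b k i) ((1/2)^Suc k))" by metis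
  define c where "c k x = (LEAST i. dist (b k i) x < (1/2)^Suc k)" for k x
  have ex: "\<exists>i<M k. dist (b k i) x < (1/2)^Suc k" if "x \<in> K" for k x
  proof -
    obtain i where "i < M k" "x \<in> ball (b k i) ((1/2)^Suc k)" using b[of k] \<open>x \<in> K\<close> by blast
    then show ?thesis by auto
  qed
  show thesis
  proof
    fix k
    have "c k -` {i} \<inter> K \<in> sets BK" for i
    proof -
      have "c k -` {i} \<inter> K = K \<inter> (ball (b k i) ((1/2)^Suc k) - (\<Union>j<i. ball (b k j) ((1/2)^Suc k)))"
      proof (intro equalityI subsetI)
        fix x assume x: "x \<in> c k -` {i} \<inter> K"
        then have i: "i = (LEAST i. dist (b k i) x < (1/2)^Suc k)" by (auto simp: c_def)
        have "dist (b k i) x < (1/2)^Suc k"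
          unfolding i by (rule LeastI_ex) (use ex[of x k] x in auto)
        moreover have "\<not> dist (b k j) x < (1/2)^Suc k" if "j < i" for j
          using that not_less_Least unfolding i by blast
        ultimately show "x \<in> K \<inter> (ball (b k i) ((1/2)^Suc k) - (\<Union>j<i. ball (b k j) ((1/2)^Suc k)))"
          using x by auto
      next
        fix x assume x: "x \<in> K \<inter> (ball (b k i) ((1/2)^Suc k) - (\<Union>j<i. ball (b k j) ((1/2)^Suc k)))"
        then have "c k x = i"
          unfolding c_def by (intro Least_equality) (auto simp: not_less[symmetric])
        then show "x \<in> c k -` {i} \<inter> K" using x by simp
      qed
      then show ?thesis
        unfolding sets_BK using K_borel by auto
    qed
    then show "c k \<in> BK \<rightarrow>\<^sub>M count_space UNIV"
      by (subst measurable_count_space_eq2_countable) (auto simp: space_BK)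
  next
    fix k x assume "x \<in> K"
    then obtain i where i: "i < M k" "dist (b k i) x < (1/2)^Suc k" using ex by blast
    then have "c k x \<le> i" unfolding c_def by (intro Least_le)
    then show "c k x < M k" using i by simp
  next
    fix k x y assume xy: "x \<in> K" "y \<in> K" "c k x = c k y"
    have "dist (b k (c k x)) x < (1/2)^Suc k" if "x \<in> K" for x
      unfolding c_def by (rule LeastI_ex) (use ex[of x k] that in auto)
    from this[OF xy(1)] this[OF xy(2)] xy(3) have "dist x y < (1/2)^Suc k + (1/2)^Suc k"
      by (metis add_strict_mono dist_commute dist_triangle2 dist_triangle_less_add)
    then show "dist x y < (1/2)^k" by simp
  qed
qed

lemma measure_cylinder_split:
  assumes c: "\<And>k. c k \<in> BK \<rightarrow>\<^sub>M count_space UNIV" "\<And>k x. x \<in> K \<Longrightarrow> c k x < M k" and "\<nu> \<in> probs"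
  shows "measure \<nu> (cylinder K c v) = (\<Sum>i<M (length v). measure \<nu> (cylinder K c (i # v)))"
proof -
  interpret prob_space \<nu> using probsD[OF assms(3)] by simp
  have "cylinder K c v = (\<Union>i\<in>{..<M (length v)}. cylinder K c (i # v))"
    using c(2) cylinder_subset[of K c v] by auto
  moreover have "measure \<nu> (\<Union>i\<in>{..<M (length v)}. cylinder K c (i # v))
      = (\<Sum>i<M (length v). measure \<nu> (cylinder K c (i # v)))"
  proof (rule finite_measure_finite_Union)
    show "(\<lambda>i. cylinder K c (i # v)) ` {..<M (length v)} \<subseteq> sets \<nu>"
      using cylinder_sets[of c, OF c(1)] probsD(1)[OF assms(3)] by blast
  qed (auto simp: disjoint_family_on_def)
  ultimately show ?thesis by (simp only:)
qed

text \<open>There are countably many words, so along a subsequence all cylinder masses converge, and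
  the limits are again consistent. They are realized as lengths of nested intervals in [0, 1): a
  number u selects a chain of cylinders, these shrink to a point \<phi> u, and \<nu>' is the image
  of Lebesgue measure under \<phi>. The limit masses need not be the \<nu>'-masses of the cylinders,
  as \<phi> u may lie just outside; but it stays within (1/2)^k of them, which the Prohorov
  inequality tolerates.\<close>

lemma probs_seq_compact:
  fixes \<nu> :: "nat \<Rightarrow> 'a measure"
  assumes \<nu>: "\<And>j. \<nu> j \<in> probs"
  obtains \<nu>' r where "\<nu>' \<in> probs" "strict_mono r"
    "\<And>e. 0 < e \<Longrightarrow> \<forall>\<^sub>F j in sequentially. close e (\<nu> (r j)) \<nu>'"
proof -
  obtain c :: "nat \<Rightarrow> 'a \<Rightarrow> nat" and M where c: "\<And>k. c k \<in> BK \<rightarrow>\<^sub>M count_space UNIV"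
    "\<And>k x. x \<in> K \<Longrightarrow> c k x < M k"
    "\<And>k x y. x \<in> K \<Longrightarrow> y \<in> K \<Longrightarrow> c k x = c k y \<Longrightarrow> dist x y < (1/2)^k"
    using obtain_coding by blast
  have meas01: "measure (\<nu> j) A \<in> {0..1}" for j A
  proof -
    interpret prob_space "\<nu> j" using probsD[OF \<nu>] by simp
    show ?thesis by simp
  qed
  obtain m r where r: "strict_mono r"
    and m01: "\<And>v. m v \<in> {0..1::real}"
    and m: "\<And>v. (\<lambda>j. measure (\<nu> (r j)) (cylinder K c v)) \<longlonglongrightarrow> m v"
    by (rule seq_compact_fun[of "{0..1::real}" "\<lambda>j v. measure (\<nu> j) (cylinder K c v)", OF compact_Icc meas01]) (rule that)
  interpret word_masses m M
  proof
    show "0 \<le> m v" for v using m01[of v] by simp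
    have "measure (\<nu> j) K = 1" for j
      using prob_space.prob_space[of "\<nu> j"] probsD[OF \<nu>[of j]] by simp
    then have "(\<lambda>j. 1) \<longlonglongrightarrow> m []" using m[of "[]"] by simp
    then show "m [] = 1" by (simp add: LIMSEQ_const_iff)
    show "m v = (\<Sum>i<M (length v). m (i # v))" for v
    proof (rule LIMSEQ_unique[OF m])
      have "(\<lambda>j. \<Sum>i<M (length v). measure (\<nu> (r j)) (cylinder K c (i # v))) \<longlonglongrightarrow> (\<Sum>i<M (length v). m (i # v))"
        by (intro tendsto_sum m)
      then show "(\<lambda>j. measure (\<nu> (r j)) (cylinder K c v)) \<longlonglongrightarrow> (\<Sum>i<M (length v). m (i # v))"
        using measure_cylinder_split[of c, OF c(1,2) \<nu>] by simp
    qed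
    show "m (i # v) = 0" if "M (length v) \<le> i" for i v
    proof -
      have "c (length v) x < i" if "x \<in> cylinder K c v" for x
        using c(2)[of x "length v"] that \<open>M (length v) \<le> i\<close> cylinder_subset[of K c v] by auto
      then have "cylinder K c (i # v) = {}" by fastforce
      then have "(\<lambda>j. 0) \<longlonglongrightarrow> m (i # v)" using m[of "i # v"] by (simp only: measure_empty)
      then show ?thesis by (simp add: LIMSEQ_const_iff)
    qed
  qed
  define pt where "pt v = (SOME x. x \<in> cylinder K c v)" for v
  \<comment> \<open>An empty cylinder would have limit mass 0, whereas u lies in an interval whose
    length is the mass of its word. So \<open>SOME\<close> in \<open>pt\<close> always picks a
    genuine point along such words.\<close>
  have word_cyl: "cylinder K c (word k u) \<noteq> {}" if "u \<in> {0..<1}" for k u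
  proof
    assume e: "cylinder K c (word k u) = {}"
    have "0 < m (word k u)"
      using word_eq_iff[of u k "word k u"] that by auto
    moreover have "(\<lambda>j. 0) \<longlonglongrightarrow> m (word k u)" using m[of "word k u"] e by (simp only: measure_empty)
    then have "m (word k u) = 0" by (simp add: LIMSEQ_const_iff)
    ultimately show False by simp
  qed
  have pt: "pt (word l u) \<in> cylinder K c (word k u)" if "u \<in> {0..<1}" "k \<le> l" for k l u
    using that(2)
  proof (induction l rule: dec_induct)
    case base
    show ?case unfolding pt_def using word_cyl[OF that(1)] by (simp add: some_in_eq)
  next
    case (step l)
    have "cylinder K c (word (l + d) u) \<subseteq> cylinder K c (word l u)" for l d
      by (induction d) auto
    then have "cylinder K c (word (Suc l) u) \<subseteq> cylinder K c (word k u)"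
      using step.hyps by (metis le_add_diff_inverse le_SucI)
    moreover have "pt (word (Suc l) u) \<in> cylinder K c (word (Suc l) u)"
      unfolding pt_def using word_cyl[OF that(1), of "Suc l"] by (simp add: some_in_eq del: word.simps)
    ultimately show ?case by blast
  qed
  \<comment> \<open>The head of a word of length k + 1 is the code at scale k, whence the shift by
    one.\<close>
  have small: "dist x y < (1/2)^k" if "x \<in> cylinder K c (word (Suc k) u)" "y \<in> cylinder K c (word (Suc k) u)" for x y k u
    using that c(3)[of x y k] cylinder_subset by fastforce
  have Cauchy: "Cauchy (\<lambda>k. pt (word k u))" if "u \<in> {0..<1}" for u
  proof (rule metric_CauchyI)
    fix e :: real assume "0 < e"
    then obtain k where k: "(1/2)^k < e" using real_arch_pow_inv[of e "1/2"] by auto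
    show "\<exists>M. \<forall>a\<ge>M. \<forall>b\<ge>M. dist (pt (word a u)) (pt (word b u)) < e"
      using small[OF pt[OF that] pt[OF that], of "k"] k by (meson order_less_trans)
  qed
  have ptK: "pt (word k u) \<in> K" if "u \<in> {0..<1}" for k u
    by (rule subsetD[OF cylinder_subset pt[OF that order_refl]])
  have "\<exists>l\<in>K. (\<lambda>k. pt (word k u)) \<longlonglongrightarrow> l" if "u \<in> {0..<1}" for u
    using completeE[OF compact_imp_complete[OF compact_K], of "\<lambda>k. pt (word k u)"]
      Cauchy[OF that] ptK[OF that] by metis
  then obtain \<phi> where \<phi>: "\<And>u. u \<in> {0..<1} \<Longrightarrow> \<phi> u \<in> K"
    "\<And>u. u \<in> {0..<1} \<Longrightarrow> (\<lambda>k. pt (word k u)) \<longlonglongrightarrow> \<phi> u" by metis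
  have \<phi>_dist: "dist x (\<phi> u) \<le> (1/2)^k"
    if "u \<in> {0..<1}" "x \<in> cylinder K c (word (Suc k) u)" for x u k
  proof (rule LIMSEQ_le_const2)
    show "(\<lambda>l. dist x (pt (word l u))) \<longlonglongrightarrow> dist x (\<phi> u)"
      by (intro tendsto_dist tendsto_const \<phi> that)
    show "\<exists>N. \<forall>l\<ge>N. dist x (pt (word l u)) \<le> (1/2)^k"
      using small[OF that(2) pt[OF that(1)]] less_imp_le by blast
  qed
  interpret u: prob_space unit_lebesgue by (rule prob_space_unit_lebesgue)
  have space_u: "space unit_lebesgue = {0..<1}" by (simp add: space_restrict_space)
  have "\<phi> \<in> borel_measurable unit_lebesgue"
  proof (rule borel_measurable_LIMSEQ_metric[of "\<lambda>k u. pt (word k u)"])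
    show "(\<lambda>u. pt (word k u)) \<in> borel_measurable unit_lebesgue" for k
      by (rule measurable_compose[OF measurable_word]) simp
  qed (use \<phi> space_u in auto)
  then have \<phi>_meas: "\<phi> \<in> unit_lebesgue \<rightarrow>\<^sub>M BK"
    by (intro measurable_restrict_space2) (use \<phi> space_u in auto)
  define \<nu>' where "\<nu>' = distr unit_lebesgue BK \<phi>"
  have \<nu>_inf: "\<nu>' \<in> probs"
    unfolding \<nu>'_def space_prob_algebra using u.prob_space_distr[OF \<phi>_meas] by simp
  have "\<forall>\<^sub>F j in sequentially. close e (\<nu> (r j)) \<nu>'" if "0 < e" for e
  proof -
    obtain k where k: "(1/2)^k < e" using real_arch_pow_inv[of e "1/2"] \<open>0 < e\<close> by auto
    let ?V = "words M (Suc k)"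
    \<comment> \<open>Only finitely many words have length k + 1, so the errors of all their masses
      can be summed into one quantity that is eventually below e, uniformly in the set A
      below.\<close>
    have "(\<lambda>j. \<Sum>v\<in>?V. \<bar>measure (\<nu> (r j)) (cylinder K c v) - m v\<bar>) \<longlonglongrightarrow> (\<Sum>v\<in>?V. \<bar>m v - m v\<bar>)"
      by (intro tendsto_intros m)
    then have "\<forall>\<^sub>F j in sequentially. (\<Sum>v\<in>?V. \<bar>measure (\<nu> (r j)) (cylinder K c v) - m v\<bar>) < e"
      using \<open>0 < e\<close> by (intro order_tendstoD) auto
    then show ?thesis
    proof eventually_elim
      case (elim j)
      interpret p: prob_space "\<nu> (r j)" using probsD[OF \<nu>] by simp
      show ?case
        unfolding close_def
      proof
        fix A assume A: "A \<in> sets BK"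
        \<comment> \<open>The cylinders that meet A cover it, which bounds its mass from above.
          Conversely, if the word of u belongs to F, then \<phi> u is within (1/2)^k < e of a point
          of A, so those u are counted by the mass of the neighbourhood.\<close>
        define F where "F = {v \<in> ?V. A \<inter> cylinder K c v \<noteq> {}}"
        have F: "finite F" "F \<subseteq> ?V" using finite_words unfolding F_def by auto
        have "A \<subseteq> (\<Union>v\<in>F. cylinder K c v)"
        proof
          fix x assume "x \<in> A"
          then obtain v where "v \<in> ?V" "x \<in> cylinder K c v"
            using cylinder_cover[of x K c M "Suc k"] c(2) A sets_BK by blast
          then show "x \<in> (\<Union>v\<in>F. cylinder K c v)" using \<open>x \<in> A\<close> unfolding F_def by blast
        qed
        then have "measure (\<nu> (r j)) A \<le> measure (\<nu> (r j)) (\<Union>v\<in>F. cylinder K c v)"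
          using cylinder_sets[of c, OF c(1)] probsD[OF \<nu>] F(1)
          by (intro p.finite_measure_mono) (auto intro!: sets.finite_UN simp del: cylinder.simps)
        also have "\<dots> \<le> (\<Sum>v\<in>F. measure (\<nu> (r j)) (cylinder K c v))"
          using cylinder_sets[of c, OF c(1)] probsD[OF \<nu>] F(1)
          by (intro measure_UNION_le) auto
        also have "\<dots> = (\<Sum>v\<in>F. m v) + (\<Sum>v\<in>F. measure (\<nu> (r j)) (cylinder K c v) - m v)"
          by (simp add: sum_subtractf)
        also have "(\<Sum>v\<in>F. measure (\<nu> (r j)) (cylinder K c v) - m v)
            \<le> (\<Sum>v\<in>F. \<bar>measure (\<nu> (r j)) (cylinder K c v) - m v\<bar>)"
          by (intro sum_mono) simp
        also have "\<dots> \<le> (\<Sum>v\<in>?V. \<bar>measure (\<nu> (r j)) (cylinder K c v) - m v\<bar>)"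
          using F finite_words by (intro sum_mono2) auto
        also have "\<dots> \<le> e" using elim by simp
        also have "(\<Sum>v\<in>F. m v) = (\<Sum>v\<in>F. measure unit_lebesgue (word (Suc k) -` {v} \<inter> {0..<1}))"
          using F(2) length_words by (intro sum.cong) (auto simp: measure_word simp del: words.simps word.simps)
        also have "\<dots> = measure unit_lebesgue (\<Union>v\<in>F. word (Suc k) -` {v} \<inter> {0..<1})"
          using F(1) measurable_sets[OF measurable_word[of "Suc k"]] space_u
          by (intro u.finite_measure_finite_Union[symmetric]) (auto simp: disjoint_family_on_def simp del: word.simps)
        also have "\<dots> \<le> measure unit_lebesgue (\<phi> -` nbhd A e \<inter> {0..<1})"
        proof (rule u.finite_measure_mono)
          show "\<phi> -` nbhd A e \<inter> {0..<1} \<in> sets unit_lebesgue"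
            using measurable_sets[OF \<phi>_meas nbhd_sets] space_u by simp
          show "(\<Union>v\<in>F. word (Suc k) -` {v} \<inter> {0..<1}) \<subseteq> \<phi> -` nbhd A e \<inter> {0..<1}"
          proof
            fix u assume "u \<in> (\<Union>v\<in>F. word (Suc k) -` {v} \<inter> {0..<1})"
            then have u: "u \<in> {0..<1}" "word (Suc k) u \<in> F" by auto
            then obtain x where x: "x \<in> A" "x \<in> cylinder K c (word (Suc k) u)"
              unfolding F_def by blast
            have "\<delta> x (\<phi> u) < e"
              using \<phi>_dist[OF u(1) x(2)] \<delta>_le_dist[of x "\<phi> u"] k by linarith
            then show "u \<in> \<phi> -` nbhd A e \<inter> {0..<1}"
              unfolding nbhd_def using u(1) x(1) \<phi>(1) by blast
          qed
        qed
        also have "\<dots> = measure \<nu>' (nbhd A e)"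
          unfolding \<nu>'_def using space_u by (simp add: measure_distr[OF \<phi>_meas nbhd_sets])
        finally show "measure (\<nu> (r j)) A \<le> measure \<nu>' (nbhd A e) + e" by simp
      qed
    qed
  qed
  then show thesis using that \<nu>_inf r by blast
qed

lemma compact_space_states: "compact_space (Metric_space.mtopology visible_states state_metric)"
proof -
  interpret S: Metric_space visible_states state_metric by (rule Metric_space_states)
  show ?thesis
    unfolding S.compact_space_sequentially
  proof (intro allI impI)
    fix \<mu> :: "nat \<Rightarrow> 'a measure" assume "range \<mu> \<subseteq> visible_states"
    then have \<mu>: "\<mu> j \<in> visible_states" for j by auto
    obtain \<nu> r where \<nu>: "\<nu> \<in> probs" "strict_mono r"
      "\<And>e. 0 < e \<Longrightarrow> \<forall>\<^sub>F j in sequentially. close e (rep (\<mu> (r j))) \<nu>"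
      using probs_seq_compact[of "\<lambda>j. rep (\<mu> j)"] rep(1)[OF \<mu>] by blast
    define l where "l = restrict_space \<nu> (K \<inter> U)"
    have l: "l \<in> visible_states" using \<nu>(1) unfolding l_def visible_states_def by simp
    have "limitin S.mtopology (\<mu> \<circ> r) l sequentially"
      unfolding S.limitin_metric
    proof (intro conjI allI impI l)
      fix e :: real assume "0 < e"
      then have "\<forall>\<^sub>F j in sequentially. close (e/2) (rep (\<mu> (r j))) \<nu>" using \<nu>(3) by simp
      then show "\<forall>\<^sub>F j in sequentially. (\<mu> \<circ> r) j \<in> visible_states \<and> state_metric ((\<mu> \<circ> r) j) l < e"
      proof eventually_elim
        case (elim j)
        then have "sdist (\<mu> (r j)) l \<le> e/2"
          using sdist_restrict_le[OF elim _ rep(1)[OF \<mu>] \<nu>(1)] \<open>0 < e\<close> rep(2)[OF \<mu>]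
          unfolding l_def by simp
        then show ?case using \<mu> l \<open>0 < e\<close> by (simp add: state_metric_def)
      qed
    qed
    then show "\<exists>l r. l \<in> visible_states \<and> strict_mono r \<and> limitin S.mtopology (\<mu> \<circ> r) l sequentially"
      using \<nu>(2) l by blast
  qed
qed

text \<open>K is compact, so the n positions converge along a subsequence, and the uniform measure
  on their limits represents the limit state. The lemma makes the n-particle states, and hence the
  exact ones, Borel sets.\<close>

lemma closedin_empirical_states:
  assumes "1 \<le> n"
  defines "F \<equiv> {\<nu> \<in> probs. \<exists>z. (\<forall>i\<in>{1..n}. z i \<in> K) \<and>
        (\<forall>A\<in>sets \<nu>. measure \<nu> A = (\<Sum>i=1..n. indicator A (z i)) / real n)}"
  shows "closedin (Metric_space.mtopology visible_states state_metric) ((\<lambda>\<nu>. restrict_space \<nu> (K \<inter> U)) ` F)"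
proof -
  interpret S: Metric_space visible_states state_metric by (rule Metric_space_states)
  let ?pr = "\<lambda>\<nu>. restrict_space \<nu> (K \<inter> U)"
  show ?thesis
    unfolding S.metric_closedin_iff_sequentially_closed
  proof (intro conjI allI impI)
    show "?pr ` F \<subseteq> visible_states" unfolding F_def visible_states_def by auto
    fix \<sigma> l assume "range \<sigma> \<subseteq> ?pr ` F \<and> limitin S.mtopology \<sigma> l sequentially"
    then have lim: "limitin S.mtopology \<sigma> l sequentially" and "\<And>j. \<exists>\<nu>\<in>F. \<sigma> j = ?pr \<nu>" by auto
    then obtain \<nu> where \<nu>: "\<And>j. \<nu> j \<in> F" "\<And>j. \<sigma> j = ?pr (\<nu> j)" by metis
    then have "\<forall>j. \<exists>z. (\<forall>i\<in>{1..n}. z i \<in> K) \<and>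
        (\<forall>A\<in>sets (\<nu> j). measure (\<nu> j) A = (\<Sum>i=1..n. indicator A (z i)) / real n)"
      unfolding F_def by blast
    then obtain z where z: "\<And>j i. i \<in> {1..n} \<Longrightarrow> z j i \<in> K"
      "\<And>j A. A \<in> sets (\<nu> j) \<Longrightarrow> measure (\<nu> j) A = (\<Sum>i=1..n. indicator A (z j i)) / real n" by metis
    obtain x0 where x0: "x0 \<in> K" using K_nonempty by blast
    \<comment> \<open>Indices outside 1, ..., n are padded with a fixed point, so that the positions
      form a function on all natural numbers with values in K.\<close>
    obtain y r where r: "strict_mono r" "\<And>i. y i \<in> K"
      "\<And>i. (\<lambda>j. if i \<in> {1..n} then z (r j) i else x0) \<longlonglongrightarrow> y i"
      using seq_compact_fun[OF compact_K, of "\<lambda>j i. if i \<in> {1..n} then z j i else x0"] z(1) x0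
      by (smt (verit))
    define \<rho> where "\<rho> = distr (uniform_count_measure {1..n}) BK y"
    have y_meas: "y \<in> uniform_count_measure {1..n} \<rightarrow>\<^sub>M BK"
      using r(2) by (auto simp: measurable_def space_BK)
    interpret uc: prob_space "uniform_count_measure {1..n}"
      using assms(1) by (intro prob_space_uniform_count_measure) auto
    have \<rho>: "\<rho> \<in> probs"
      unfolding \<rho>_def space_prob_algebra using uc.prob_space_distr[OF y_meas] by simp
    have \<rho>_meas: "measure \<rho> A = (\<Sum>i=1..n. indicator A (y i)) / real n" if "A \<in> sets BK" for A
    proof -
      have "measure \<rho> A = measure (uniform_count_measure {1..n}) (y -` A \<inter> {1..n})"
        unfolding \<rho>_def using measure_distr[OF y_meas that] by (simp add: space_uniform_count_measure)
      also have "\<dots> = real (card (y -` A \<inter> {1..n})) / real n"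
        by (subst measure_uniform_count_measure) auto
      also have "real (card (y -` A \<inter> {1..n})) = (\<Sum>i=1..n. indicator A (y i))"
        by (simp add: indicator_def sum.If_cases Int_def vimage_def conj_commute)
      finally show ?thesis .
    qed
    have "\<rho> \<in> F"
      unfolding F_def using \<rho> r(2) \<rho>_meas probsD(1)[OF \<rho>] by blast
    have "limitin S.mtopology (\<sigma> \<circ> r) (?pr \<rho>) sequentially"
      unfolding S.limitin_metric
    proof (intro conjI allI impI)
      show "?pr \<rho> \<in> visible_states" using \<rho> unfolding visible_states_def by blast
      fix e :: real assume "0 < e"
      have "\<forall>\<^sub>F j in sequentially. \<forall>i\<in>{1..n}. dist (z (r j) i) (y i) < e/2"
      proof (rule eventually_ball_finite)
        show "\<forall>i\<in>{1..n}. \<forall>\<^sub>F j in sequentially. dist (z (r j) i) (y i) < e/2"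
        proof
          fix i assume "i \<in> {1..n}"
          then show "\<forall>\<^sub>F j in sequentially. dist (z (r j) i) (y i) < e/2"
            using tendstoD[OF r(3)[of i], of "e/2"] \<open>0 < e\<close> by simp
        qed
      qed simp
      then show "\<forall>\<^sub>F j in sequentially. (\<sigma> \<circ> r) j \<in> visible_states \<and> state_metric ((\<sigma> \<circ> r) j) (?pr \<rho>) < e"
      proof eventually_elim
        case (elim j)
        have \<nu>p: "\<nu> (r j) \<in> probs" using \<nu>(1) unfolding F_def by simp
        have "close (e/2) (\<nu> (r j)) \<rho>"
          unfolding close_def
        proof
          fix A assume A: "A \<in> sets BK"
          have "measure (\<nu> (r j)) A = (\<Sum>i=1..n. indicator A (z (r j) i)) / real n"
            using z(2) A probsD(1)[OF \<nu>p] by simp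
          also have "\<dots> \<le> (\<Sum>i=1..n. indicator (nbhd A (e/2)) (y i)) / real n"
          proof (intro divide_right_mono sum_mono)
            fix i assume i: "i \<in> {1..n}"
            show "indicator A (z (r j) i) \<le> (indicator (nbhd A (e/2)) (y i) :: real)"
            proof (cases "z (r j) i \<in> A")
              case True
              have "\<delta> (z (r j) i) (y i) < e/2"
                using elim i \<delta>_le_dist[of "z (r j) i" "y i"] by fastforce
              then have "y i \<in> nbhd A (e/2)" unfolding nbhd_def using r(2) True by blast
              then show ?thesis by simp
            qed simp
          qed simp
          also have "\<dots> = measure \<rho> (nbhd A (e/2))" using \<rho>_meas nbhd_sets by simp
          finally show "measure (\<nu> (r j)) A \<le> measure \<rho> (nbhd A (e/2)) + e/2" using \<open>0 < e\<close> by simp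
        qed
        then have "sdist (\<sigma> (r j)) (?pr \<rho>) \<le> e/2"
          using sdist_restrict_le[OF _ _ \<nu>p \<rho>, of "e/2"] \<open>0 < e\<close> \<nu>(2) by simp
        moreover have "\<sigma> (r j) \<in> visible_states" "?pr \<rho> \<in> visible_states"
          using \<nu>p \<rho> \<nu>(2) unfolding visible_states_def by auto
        ultimately show ?case using \<open>0 < e\<close> by (simp add: state_metric_def)
      qed
    qed
    moreover have "limitin S.mtopology (\<sigma> \<circ> r) l sequentially"
      using lim r(1) by (rule limitin_subsequence[rotated])
    ultimately have "l = ?pr \<rho>"
      using S.limitin_metric_unique trivial_limit_sequentially by blast
    then show "l \<in> ?pr ` F" using \<open>\<rho> \<in> F\<close> by blast
  qed
qed

end

section \<open>Topologies given by distances and right-continuous processes\<close>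

text \<open>Stated for an arbitrary function d: it is applied to \<open>skorohod_dist\<close>, for
  which only symmetry and the triangle inequality are established below.\<close>

lemma openin_dist_topology:
  "openin (dist_topology M d) U \<longleftrightarrow> U \<subseteq> M \<and> (\<forall>x\<in>U. \<exists>r>0. \<forall>y\<in>M. d x y < r \<longrightarrow> y \<in> U)"
proof -
  let ?P = "\<lambda>U. U \<subseteq> M \<and> (\<forall>x\<in>U. \<exists>r>0. \<forall>y\<in>M. d x y < r \<longrightarrow> y \<in> U)"
  have "istopology ?P"
    unfolding istopology_def
  proof (intro conjI allI impI)
    fix S T assume S: "?P S" and T: "?P T"
    show "S \<inter> T \<subseteq> M" using S by blast
    show "\<forall>x\<in>S \<inter> T. \<exists>r>0. \<forall>y\<in>M. d x y < r \<longrightarrow> y \<in> S \<inter> T"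
    proof
      fix x assume "x \<in> S \<inter> T"
      then have "x \<in> S" "x \<in> T" by auto
      then obtain r r' where "r > 0" "\<forall>y\<in>M. d x y < r \<longrightarrow> y \<in> S" "r' > 0" "\<forall>y\<in>M. d x y < r' \<longrightarrow> y \<in> T"
        using S T by blast
      then show "\<exists>r>0. \<forall>y\<in>M. d x y < r \<longrightarrow> y \<in> S \<inter> T"
        by (intro exI[of _ "min r r'"]) auto
    qed
  next
    fix \<K> assume K: "\<forall>K\<in>\<K>. ?P K"
    show "\<Union>\<K> \<subseteq> M" using K by blast
    show "\<forall>x\<in>\<Union>\<K>. \<exists>r>0. \<forall>y\<in>M. d x y < r \<longrightarrow> y \<in> \<Union>\<K>"
    proof
      fix x assume "x \<in> \<Union>\<K>"
      then obtain V where V: "V \<in> \<K>" "x \<in> V" by blast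
      then obtain r where "r > 0" "\<forall>y\<in>M. d x y < r \<longrightarrow> y \<in> V" using K by blast
      then show "\<exists>r>0. \<forall>y\<in>M. d x y < r \<longrightarrow> y \<in> \<Union>\<K>" using V by blast
    qed
  qed
  then show ?thesis unfolding dist_topology_def by (simp add: topology_inverse')
qed

lemma topspace_dist_topology [simp]: "topspace (dist_topology M d) = M"
proof
  show "topspace (dist_topology M d) \<subseteq> M"
    using openin_topspace[of "dist_topology M d"] unfolding openin_dist_topology by blast
  have "openin (dist_topology M d) M"
    unfolding openin_dist_topology by (auto intro: exI[of _ 1])
  then show "M \<subseteq> topspace (dist_topology M d)" by (rule openin_subset)
qed

lemma dist_topology_cong:
  assumes "\<And>x y. x \<in> M \<Longrightarrow> y \<in> M \<Longrightarrow> d x y = d' x y"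
  shows "dist_topology M d = dist_topology M d'"
  unfolding topology_eq openin_dist_topology using assms by (metis subsetD)

lemma space_borel_of [simp]: "space (borel_of Y) = topspace Y"
  by (simp add: borel_of_def space_measure_of_conv)

lemma sets_borel_of: "sets (borel_of Y) = sigma_sets (topspace Y) {U. openin Y U}"
  unfolding borel_of_def by (rule sets_measure_of) (auto dest: openin_subset)

lemma borel_of_open: "openin Y U \<Longrightarrow> U \<in> sets (borel_of Y)"
  unfolding sets_borel_of by auto

lemma borel_of_closed:
  assumes "closedin Y F" shows "F \<in> sets (borel_of Y)"
proof -
  have "topspace Y - F \<in> sets (borel_of Y)"
    using assms by (intro borel_of_open) (simp add: closedin_def)
  then have "space (borel_of Y) - (topspace Y - F) \<in> sets (borel_of Y)" by (rule sets.compl_sets)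
  moreover have "topspace Y - (topspace Y - F) = F" using closedin_subset[OF assms] by blast
  ultimately show ?thesis by simp
qed

lemma continuous_map_borel_of:
  fixes f :: "'a \<Rightarrow> real"
  assumes "continuous_map Y euclideanreal f"
  shows "f \<in> borel_measurable (borel_of Y)"
proof (rule borel_measurableI)
  fix S :: "real set" assume "open S"
  then have "openin Y {x \<in> topspace Y. f x \<in> S}"
    using assms by (auto simp: continuous_map_def)
  moreover have "f -` S \<inter> space (borel_of Y) = {x \<in> topspace Y. f x \<in> S}" by auto
  ultimately show "f -` S \<inter> space (borel_of Y) \<in> sets (borel_of Y)"
    using borel_of_open by simp
qed

text \<open>Replace t by a grid point to its right. The approximation depends on t only through a
  countable index, hence is jointly measurable, and it converges by right-continuity as the grid is
  refined.\<close>

lemma measurable_right_continuous_process: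
  fixes Z :: "real \<Rightarrow> 'w \<Rightarrow> real"
  assumes Z: "\<And>t. 0 \<le> t \<Longrightarrow> Z t \<in> borel_measurable \<Omega>"
    and right: "\<And>\<omega> t. \<omega> \<in> space \<Omega> \<Longrightarrow> 0 \<le> t \<Longrightarrow> ((\<lambda>s. Z s \<omega>) \<longlongrightarrow> Z t \<omega>) (at_right t)"
  shows "(\<lambda>(t, \<omega>). indicator {0..} t * Z t \<omega>) \<in> borel_measurable (borel \<Otimes>\<^sub>M \<Omega>)"
proof -
  \<comment> \<open>The summand 1 puts the grid point strictly to the right of t even when t itself
    is on the grid, as a limit along \<open>at_right t\<close> requires.\<close>
  define g where "g n t = (real (nat \<lfloor>t * real (Suc n)\<rfloor>) + 1) / real (Suc n)" for n :: nat and t :: real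
  have lim: "(\<lambda>n. g n t) \<longlonglongrightarrow> t" and gt: "t < g n t" if "0 \<le> t" for t n
  proof -
    have e: "real (nat \<lfloor>t * real (Suc n)\<rfloor>) = of_int \<lfloor>t * real (Suc n)\<rfloor>" for n
      using that by (subst of_nat_nat) (auto simp del: of_nat_Suc)
    have lo: "t < g n t" for n
      unfolding g_def e pos_less_divide_eq[OF of_nat_0_less_iff[THEN iffD2, OF zero_less_Suc]]
      by linarith
    have hi: "g n t \<le> t + inverse (real (Suc n))" for n
    proof -
      have "g n t \<le> (t * real (Suc n) + 1) / real (Suc n)"
        unfolding g_def e by (intro divide_right_mono) (simp_all del: of_nat_Suc)
      also have "\<dots> = t + inverse (real (Suc n))" by (simp add: field_simps)
      finally show ?thesis .
    qed
    show "t < g n t" by (rule lo)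
    have "(\<lambda>n. t + inverse (real (Suc n))) \<longlonglongrightarrow> t + 0"
      by (intro tendsto_intros LIMSEQ_inverse_real_of_nat)
    then show "(\<lambda>n. g n t) \<longlonglongrightarrow> t"
      by (intro tendsto_sandwich[of "\<lambda>_. t" "\<lambda>n. g n t" _ "\<lambda>n. t + inverse (real (Suc n))"])
        (auto intro!: always_eventually hi less_imp_le[OF lo] simp del: of_nat_Suc)
  qed
  show ?thesis
  proof (rule borel_measurable_LIMSEQ_metric[of "\<lambda>n (t, \<omega>). indicator {0..} t * Z (g n t) \<omega>"])
    fix n
    have Zi: "(\<lambda>x. Z ((real i + 1) / real (Suc n)) (snd x)) \<in> borel_measurable (borel \<Otimes>\<^sub>M \<Omega>)" for i
      by (rule measurable_compose[OF measurable_snd Z]) simp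
    have [measurable]: "(\<lambda>x. Z ((real (nat \<lfloor>fst x * real (Suc n)\<rfloor>) + 1) / real (Suc n)) (snd x))
        \<in> borel_measurable (borel \<Otimes>\<^sub>M \<Omega>)"
    proof (rule measurable_compose_countable'[where I = UNIV
          and f = "\<lambda>i x. Z ((real i + 1) / real (Suc n)) (snd x)"
          and g = "\<lambda>x. nat \<lfloor>fst x * real (Suc n)\<rfloor>"])
      show "(\<lambda>x. nat \<lfloor>fst x * real (Suc n)\<rfloor>) \<in> borel \<Otimes>\<^sub>M \<Omega> \<rightarrow>\<^sub>M count_space UNIV" by measurable
    qed (use Zi in simp_all)
    then show "(\<lambda>(t, \<omega>). indicator {0..} t * Z (g n t) \<omega>) \<in> borel_measurable (borel \<Otimes>\<^sub>M \<Omega>)"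
      unfolding case_prod_beta g_def by measurable
  next
    fix x :: "real \<times> 'w" assume "x \<in> space (borel \<Otimes>\<^sub>M \<Omega>)"
    then obtain t \<omega> where x: "x = (t, \<omega>)" "\<omega> \<in> space \<Omega>" by (auto simp: space_pair_measure)
    have "(\<lambda>n. Z (g n t) \<omega>) \<longlonglongrightarrow> Z t \<omega>" if "0 \<le> t"
    proof -
      have "filterlim (\<lambda>n. g n t) (at_right t) sequentially"
        using lim[OF that] gt[OF that] by (intro tendsto_imp_filterlim_at_right) auto
      then show ?thesis using right[OF x(2) that] filterlim_compose by blast
    qed
    then show "(\<lambda>n. case x of (t, \<omega>) \<Rightarrow> indicator {0..} t * Z (g n t) \<omega>) \<longlonglongrightarrow> (case x of (t, \<omega>) \<Rightarrow> indicator {0..} t * Z t \<omega>)"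
      unfolding x by (cases "0 \<le> t") (auto intro!: tendsto_mult)
  qed
qed

lemma nn_integral_exp_atLeast:
  assumes "0 < (\<beta> :: real)"
  shows "(\<integral>\<^sup>+u. ennreal (exp (- \<beta> * u)) * indicator {a..} u \<partial>lborel) = ennreal (exp (- \<beta> * a) / \<beta>)"
proof -
  have "((\<lambda>u. - exp (- \<beta> * u) / \<beta>) \<longlongrightarrow> 0) at_top"
  proof -
    have "filterlim (\<lambda>u. - \<beta> * u) at_bot at_top"
      using assms by (intro filterlim_tendsto_neg_mult_at_bot[OF tendsto_const] filterlim_ident) auto
    then have "((\<lambda>u. exp (- \<beta> * u)) \<longlongrightarrow> 0) at_top"
      by (rule filterlim_compose[OF exp_at_bot])
    then show ?thesis using tendsto_divide[OF tendsto_minus tendsto_const[of \<beta>]] assms by fastforce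
  qed
  then have "(\<integral>\<^sup>+u. ennreal (exp (- \<beta> * u)) * indicator {a..} u \<partial>lborel) = ennreal (0 - (- exp (- \<beta> * a) / \<beta>))"
    using assms by (intro nn_integral_FTC_atLeast) (auto intro!: derivative_eq_intros)
  then show ?thesis by simp
qed

lemma exp_atLeast:
  assumes "0 < (\<beta> :: real)"
  shows "set_integrable lborel {a..} (\<lambda>u. exp (- \<beta> * u))"
    and "(LINT u:{a..}|lborel. exp (- \<beta> * u)) = exp (- \<beta> * a) / \<beta>"
proof -
  have "(\<integral>\<^sup>+u. ennreal (indicat_real {a..} u * exp (- \<beta> * u)) \<partial>lborel) = ennreal (exp (- \<beta> * a) / \<beta>)"
    using nn_integral_exp_atLeast[OF assms, of a] by (simp add: ennreal_mult' mult.commute ennreal_indicator)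
  then have "has_bochner_integral lborel (\<lambda>u. indicat_real {a..} u * exp (- \<beta> * u)) (exp (- \<beta> * a) / \<beta>)"
    using assms by (intro has_bochner_integral_nn_integral) auto
  then show "set_integrable lborel {a..} (\<lambda>u. exp (- \<beta> * u))"
    "(LINT u:{a..}|lborel. exp (- \<beta> * u)) = exp (- \<beta> * a) / \<beta>"
    unfolding set_integrable_def set_lebesgue_integral_def
    by (auto dest: has_bochner_integral_integral_eq intro: integrable.intros)
qed

section \<open>The Skorohod distance\<close>

lemma time_changesD:
  assumes "l \<in> time_changes"
  shows "strict_mono_on {0..} l" "bij_betw l {0..} {0..}" "bdd_above (log_slopes l)"
    "0 \<le> t \<Longrightarrow> 0 \<le> l t"
  using assms unfolding time_changes_def by (auto dest: bij_betwE)

lemma log_slopesI: "0 \<le> s \<Longrightarrow> s < t \<Longrightarrow> \<bar>ln ((l t - l s) / (t - s))\<bar> \<in> log_slopes l"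
  unfolding log_slopes_def by blast

lemma log_slopes_nonempty: "log_slopes l \<noteq> {}"
  using log_slopesI[of 0 1 l] by auto

lemma Sup_log_slopes_nonneg: "l \<in> time_changes \<Longrightarrow> 0 \<le> Sup (log_slopes l)"
  using cSup_upper[OF log_slopesI[of 0 1 l]] time_changesD(3)[of l] by fastforce

lemma time_change_less_iff:
  assumes "l \<in> time_changes" "0 \<le> s" "0 \<le> t"
  shows "l s < l t \<longleftrightarrow> s < t" "l s \<le> l t \<longleftrightarrow> s \<le> t"
  using strict_mono_on_less[OF time_changesD(1)[OF assms(1)]]
    strict_mono_on_less_eq[OF time_changesD(1)[OF assms(1)]] assms by auto

lemma id_time_change: "(\<lambda>t. t) \<in> time_changes" "Sup (log_slopes (\<lambda>t. t)) = 0"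
proof -
  have "log_slopes (\<lambda>t. t) = {0}"
  proof -
    have "(t - s) / (t - s) = 1" if "s < t" for s t :: real using that by simp
    then have "log_slopes (\<lambda>t. t) \<subseteq> {0}" unfolding log_slopes_def by force
    then show ?thesis using log_slopes_nonempty[of "\<lambda>t. t"] by blast
  qed
  then show "(\<lambda>t. t) \<in> time_changes" "Sup (log_slopes (\<lambda>t. t)) = 0"
    unfolding time_changes_def by (auto simp: strict_mono_on_def bij_betw_def)
qed

text \<open>The slopes of the inverse are the reciprocals of the slopes, and the absolute value of
  the logarithm does not see the difference.\<close>

lemma inv_time_change:
  assumes "l \<in> time_changes"
  shows "inv_into {0..} l \<in> time_changes" "Sup (log_slopes (inv_into {0..} l)) = Sup (log_slopes l)"
proof -
  let ?i = "inv_into {0..} l"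
  note bij = time_changesD(2)[OF assms]
  have ibij: "bij_betw ?i {0..} {0..}" by (rule bij_betw_inv_into[OF bij])
  have li: "l (?i t) = t" "0 \<le> ?i t" if "0 \<le> t" for t
    using bij_betw_inv_into_right[OF bij, of t] ibij that by (auto dest: bij_betwE)
  have il: "?i (l t) = t" if "0 \<le> t" for t
    using bij_betw_inv_into_left[OF bij, of t] that by auto
  have mono: "?i s < ?i t" if "0 \<le> s" "s < t" for s t
    using time_change_less_iff(1)[OF assms, of "?i s" "?i t"] li[of s] li[of t] that by auto
  have swap: "\<bar>ln (a / b)\<bar> = \<bar>ln (b / a)\<bar>" if "0 < a" "0 < b" for a b :: real
    using that by (simp add: ln_div)
  have eq: "log_slopes ?i = log_slopes l"
  proof (intro equalityI subsetI)
    fix v assume "v \<in> log_slopes ?i"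
    then obtain s t where st: "0 \<le> s" "s < t" "v = \<bar>ln ((?i t - ?i s) / (t - s))\<bar>"
      unfolding log_slopes_def by blast
    then have "v = \<bar>ln ((l (?i t) - l (?i s)) / (?i t - ?i s))\<bar>"
      using swap[of "?i t - ?i s" "t - s"] mono[of s t] li(1)[of s] li(1)[of t] by simp
    then show "v \<in> log_slopes l"
      using log_slopesI[of "?i s" "?i t" l] mono[of s t] li(2)[of s] st by simp
  next
    fix v assume "v \<in> log_slopes l"
    then obtain s t where st: "0 \<le> s" "s < t" "v = \<bar>ln ((l t - l s) / (t - s))\<bar>"
      unfolding log_slopes_def by blast
    have "l s < l t" using time_change_less_iff[OF assms] st by simp
    then have "v = \<bar>ln ((?i (l t) - ?i (l s)) / (l t - l s))\<bar>"
      using swap[of "l t - l s" "t - s"] st il by simp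
    then show "v \<in> log_slopes ?i"
      using log_slopesI[of "l s" "l t" ?i] \<open>l s < l t\<close> time_changesD(4)[OF assms st(1)] by simp
  qed
  show "?i \<in> time_changes"
    unfolding time_changes_def using ibij mono eq time_changesD(3)[OF assms]
    by (auto simp: strict_mono_on_def)
  show "Sup (log_slopes ?i) = Sup (log_slopes l)" using eq by simp
qed

text \<open>Slopes multiply under composition, so their logarithms add.\<close>

lemma comp_time_change:
  assumes "l \<in> time_changes" "l' \<in> time_changes"
  shows "l' \<circ> l \<in> time_changes" "Sup (log_slopes (l' \<circ> l)) \<le> Sup (log_slopes l) + Sup (log_slopes l')"
proof -
  have le: "v \<le> Sup (log_slopes l) + Sup (log_slopes l')" if v: "v \<in> log_slopes (l' \<circ> l)" for v
  proof -
    obtain s t where "v = \<bar>ln (((l' \<circ> l) t - (l' \<circ> l) s) / (t - s))\<bar> \<and> 0 \<le> s \<and> s < t"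
      using v unfolding log_slopes_def by blast
    then have st: "0 \<le> s" "s < t" "v = \<bar>ln ((l' (l t) - l' (l s)) / (t - s))\<bar>" by simp_all
    have "0 \<le> l s" "l s < l t"
      using time_changesD(4)[OF assms(1) st(1)] time_change_less_iff(1)[OF assms(1), of s t] st by simp_all
    moreover from this have "l' (l s) < l' (l t)"
      using time_change_less_iff(1)[OF assms(2), of "l s" "l t"] by simp
    ultimately have lt: "0 \<le> l s" "l s < l t" "l' (l s) < l' (l t)" by auto
    have "ln ((l' (l t) - l' (l s)) / (t - s))
        = ln ((l' (l t) - l' (l s)) / (l t - l s)) + ln ((l t - l s) / (t - s))"
      using lt st by (simp add: ln_div)
    moreover have "\<bar>ln ((l' (l t) - l' (l s)) / (l t - l s))\<bar> \<le> Sup (log_slopes l')"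
      using cSup_upper[OF log_slopesI[OF lt(1,2)] time_changesD(3)[OF assms(2)]] .
    moreover have "\<bar>ln ((l t - l s) / (t - s))\<bar> \<le> Sup (log_slopes l)"
      using cSup_upper[OF log_slopesI[OF st(1,2)] time_changesD(3)[OF assms(1)]] .
    ultimately show ?thesis using st(3) by linarith
  qed
  have "strict_mono_on {0..} (l' \<circ> l)"
    using time_change_less_iff(1)[OF assms(1)] time_change_less_iff(1)[OF assms(2)] time_changesD(4)[OF assms(1)]
    by (auto simp: strict_mono_on_def)
  moreover have "bij_betw (l' \<circ> l) {0..} {0..}"
    using bij_betw_trans time_changesD(2) assms by blast
  ultimately show "l' \<circ> l \<in> time_changes"
    unfolding time_changes_def using le by (auto intro!: bdd_aboveI)
  show "Sup (log_slopes (l' \<circ> l)) \<le> Sup (log_slopes l) + Sup (log_slopes l')"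
    by (rule cSup_least[OF log_slopes_nonempty le])
qed

text \<open>The integrand of \<open>skorohod_dist\<close> without its exponential weight; both paths
  are frozen at time u.\<close>

definition path_gap :: "('e \<Rightarrow> 'e \<Rightarrow> real) \<Rightarrow> (real \<Rightarrow> real) \<Rightarrow> (real \<Rightarrow> 'e) \<Rightarrow> (real \<Rightarrow> 'e) \<Rightarrow> real \<Rightarrow> real" where
  "path_gap q l x y u = (SUP t\<in>{0..}. min 1 (q (x (min t u)) (y (min (l t) u))))"

section \<open>Cadlag paths in a metric space; symmetry and triangle inequality of the Skorohod
  distance\<close>

context Metric_space
begin

abbreviation "cadlag \<equiv> cadlag_paths mtopology"

lemma cadlag_in: "x \<in> cadlag \<Longrightarrow> 0 \<le> t \<Longrightarrow> x t \<in> M"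
  unfolding cadlag_paths_def limitin_metric by blast

lemma cadlag_right:
  assumes "x \<in> cadlag" "0 \<le> t" "0 < e"
  obtains b where "t < b" "\<And>s. t \<le> s \<Longrightarrow> s < b \<Longrightarrow> d (x s) (x t) < e"
proof -
  have "\<forall>\<^sub>F s in at_right t. d (x s) (x t) < e"
    using assms unfolding cadlag_paths_def limitin_metric by (fastforce elim: eventually_mono)
  then obtain b where "t < b" "\<And>s. t < s \<Longrightarrow> s < b \<Longrightarrow> d (x s) (x t) < e"
    unfolding eventually_at_right_field by blast
  then show thesis
    using that[of b] assms cadlag_in[OF assms(1,2)] by (metis mdist_zero order_le_less)
qed

lemma cadlag_left:
  assumes "x \<in> cadlag" "0 < t" "0 < e"
  obtains a where "0 \<le> a" "a < t" "\<And>s s'. a < s \<Longrightarrow> s < t \<Longrightarrow> a < s' \<Longrightarrow> s' < t \<Longrightarrow> d (x s) (x s') < e"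
proof -
  obtain l where "limitin mtopology x l (at_left t)"
    using assms unfolding cadlag_paths_def by blast
  then have l: "l \<in> M" "\<forall>\<^sub>F s in at_left t. x s \<in> M \<and> d (x s) l < e/2"
    using assms(3) unfolding limitin_metric by (meson half_gt_zero)+
  then obtain a where a: "a < t" "\<And>s. a < s \<Longrightarrow> s < t \<Longrightarrow> x s \<in> M \<and> d (x s) l < e/2"
    unfolding eventually_at_left_field by blast
  have "d (x s) (x s') < e" if "a < s" "s < t" "a < s'" "s' < t" for s s'
    using a(2)[OF that(1,2)] a(2)[OF that(3,4)] triangle[of "x s" l "x s'"] l(1) commute[of l "x s'"]
    by (smt (verit) field_sum_of_halves)
  then show thesis using that[of "max 0 a"] a assms(2) by auto
qed

lemma cadlag_right_stopped:
  assumes "x \<in> cadlag" "0 \<le> t" "0 \<le> c" "0 < e"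
  obtains b where "t < b" "\<And>s. t \<le> s \<Longrightarrow> s < b \<Longrightarrow> d (x (min c s)) (x (min c t)) < e"
proof (cases "t < c")
  case True
  then obtain b where b: "t < b" "\<And>s. t \<le> s \<Longrightarrow> s < b \<Longrightarrow> d (x s) (x t) < e"
    using cadlag_right assms by metis
  show thesis
    by (rule that[of "min b c"]) (use True b in auto)
next
  case False
  then have "d (x (min c s)) (x (min c t)) < e" if "t \<le> s" for s
    using that assms cadlag_in[OF assms(1,3)] by (auto simp: min_def)
  then show thesis using that[of "t + 1"] by simp
qed

lemma min_1_add: "a \<le> b + c \<Longrightarrow> 0 \<le> b \<Longrightarrow> 0 \<le> c \<Longrightarrow> min 1 a \<le> min 1 b + min 1 c"
  for a b c :: real
  by (auto simp: min_def)

lemma dist_diff_le: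
  assumes "a \<in> M" "b \<in> M" "a' \<in> M" "b' \<in> M"
  shows "\<bar>d a b - d a' b'\<bar> \<le> d a a' + d b b'"
  using triangle[of a a' b] triangle[of a' b' b] triangle[of a' a b'] triangle[of a b b'] assms
    commute by (smt (verit))

lemma path_gap_upper:
  assumes "0 \<le> t"
  shows "min 1 (d (x (min t u)) (y (min (l t) u))) \<le> path_gap d l x y u"
  unfolding path_gap_def using assms by (intro cSUP_upper bdd_aboveI[of _ 1]) auto

lemma path_gap_least:
  assumes "\<And>t. 0 \<le> t \<Longrightarrow> min 1 (d (x (min t u)) (y (min (l t) u))) \<le> c"
  shows "path_gap d l x y u \<le> c"
  unfolding path_gap_def using assms by (intro cSUP_least) auto

lemma path_gap_bounds: "0 \<le> path_gap d l x y u" "path_gap d l x y u \<le> 1"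
proof -
  have "0 \<le> min 1 (d (x (min 0 u)) (y (min (l 0) u)))" by simp
  then show "0 \<le> path_gap d l x y u" using path_gap_upper[of 0 x u y l] by linarith
  show "path_gap d l x y u \<le> 1" by (rule path_gap_least) simp
qed

text \<open>Both frozen paths are right-continuous in t, also after the time change, so rational
  times determine the supremum. A countable supremum is what makes the gap measurable in u.\<close>

lemma path_gap_rational:
  assumes x: "x \<in> cadlag" and y: "y \<in> cadlag" and l: "l \<in> time_changes" and "0 \<le> u"
  shows "path_gap d l x y u = (SUP t\<in>{0..} \<inter> \<rat>. min 1 (d (x (min t u)) (y (min (l t) u))))"
    (is "_ = ?R")
proof (rule antisym)
  let ?f = "\<lambda>t. min 1 (d (x (min t u)) (y (min (l t) u)))"
  have upper: "?f t \<le> ?R" if "t \<in> {0..} \<inter> \<rat>" for t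
    using that by (intro cSUP_upper bdd_aboveI[of _ 1]) auto
  show "path_gap d l x y u \<le> ?R"
  proof (rule path_gap_least)
    fix t :: real assume t: "0 \<le> t"
    show "?f t \<le> ?R"
    proof (rule field_le_epsilon)
      fix e :: real assume "0 < e"
      obtain b where b: "t < b" "\<And>s. t \<le> s \<Longrightarrow> s < b \<Longrightarrow> d (x (min u s)) (x (min u t)) < e/2"
        using cadlag_right_stopped[OF x t \<open>0 \<le> u\<close>, of "e/2"] \<open>0 < e\<close> by auto
      obtain c where c: "l t < c" "\<And>s. l t \<le> s \<Longrightarrow> s < c \<Longrightarrow> d (y (min u s)) (y (min u (l t))) < e/2"
        using cadlag_right_stopped[OF y time_changesD(4)[OF l t] \<open>0 \<le> u\<close>, of "e/2"] \<open>0 < e\<close> by auto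
      \<comment> \<open>The preimage c' of c replaces continuity of l at t: by monotonicity every s
        between t and c' is mapped between l t and c.\<close>
      have "c \<in> l ` {0..}"
        using time_changesD(2)[OF l] time_changesD(4)[OF l t] c(1) by (auto simp: bij_betw_def)
      then obtain c' where c': "0 \<le> c'" "l c' = c" by auto
      have "t < c'" using time_change_less_iff[OF l t c'(1)] c c' by simp
      then obtain s where s: "s \<in> \<rat>" "t < s" "s < min b c'"
        using Rats_dense_in_real[of t "min b c'"] b(1) by auto
      have ls: "l t \<le> l s" "l s < c"
        using time_change_less_iff[OF l] s t c' by auto
      have "\<bar>d (x (min t u)) (y (min (l t) u)) - d (x (min s u)) (y (min (l s) u))\<bar>
          \<le> d (x (min t u)) (x (min s u)) + d (y (min (l t) u)) (y (min (l s) u))"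
        using t s \<open>0 \<le> u\<close> time_changesD(4)[OF l] by (intro dist_diff_le cadlag_in[OF x] cadlag_in[OF y]) auto
      moreover have "d (x (min t u)) (x (min s u)) < e/2"
        using b(2)[of s] s by (simp add: commute min.commute)
      moreover have "d (y (min (l t) u)) (y (min (l s) u)) < e/2"
        using c(2)[OF ls] by (simp add: commute min.commute)
      ultimately have "d (x (min t u)) (y (min (l t) u)) \<le> d (x (min s u)) (y (min (l s) u)) + e" by linarith
      then have "?f t \<le> ?f s + e" using \<open>0 < e\<close> by (simp add: min_le_iff_disj) linarith
      also have "?f s \<le> ?R" using s t by (intro upper) auto
      finally show "?f t \<le> ?R + e" by simp
    qed
  qed
  show "?R \<le> path_gap d l x y u"
    by (rule cSUP_least) (auto intro!: path_gap_upper intro: Rats_0)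
qed

lemma path_gap_measurable:
  assumes x: "x \<in> cadlag" and y: "y \<in> cadlag" and l: "l \<in> time_changes"
  shows "(\<lambda>u. indicator {0..} u * path_gap d l x y u) \<in> borel_measurable borel"
proof -
  have f: "(\<lambda>u. indicator {0..} u * min 1 (d (x (min t u)) (y (min (l t) u)))) \<in> borel_measurable borel"
    if "0 \<le> t" for t
  proof -
    let ?Z = "\<lambda>u (_::unit). min 1 (d (x (min t u)) (y (min (l t) u)))"
    have "(\<lambda>(u, \<omega>). indicator {0..} u * ?Z u \<omega>) \<in> borel_measurable (borel \<Otimes>\<^sub>M count_space (UNIV :: unit set))"
    proof (rule measurable_right_continuous_process)
      fix u :: real assume u: "0 \<le> u"
      have "((\<lambda>s. d (x (min t s)) (y (min (l t) s))) \<longlongrightarrow> d (x (min t u)) (y (min (l t) u))) (at_right u)"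
      proof (rule tendstoI)
        fix e :: real assume "0 < e"
        obtain b where b: "u < b" "\<And>s. u \<le> s \<Longrightarrow> s < b \<Longrightarrow> d (x (min t s)) (x (min t u)) < e/2"
          using cadlag_right_stopped[OF x u \<open>0 \<le> t\<close>, of "e/2"] \<open>0 < e\<close> by auto
        obtain c where c: "u < c" "\<And>s. u \<le> s \<Longrightarrow> s < c \<Longrightarrow> d (y (min (l t) s)) (y (min (l t) u)) < e/2"
          using cadlag_right_stopped[OF y u time_changesD(4)[OF l \<open>0 \<le> t\<close>], of "e/2"] \<open>0 < e\<close> by auto
        have "dist (d (x (min t s)) (y (min (l t) s))) (d (x (min t u)) (y (min (l t) u))) < e"
          if "u < s" "s < min b c" for s
        proof -
          have "\<bar>d (x (min t s)) (y (min (l t) s)) - d (x (min t u)) (y (min (l t) u))\<bar>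
            \<le> d (x (min t s)) (x (min t u)) + d (y (min (l t) s)) (y (min (l t) u))"
            using that u \<open>0 \<le> t\<close> time_changesD(4)[OF l] by (intro dist_diff_le cadlag_in[OF x] cadlag_in[OF y]) auto
          then show ?thesis using b(2)[of s] c(2)[of s] that by (simp add: dist_real_def)
        qed
        then show "\<forall>\<^sub>F s in at_right u. dist (d (x (min t s)) (y (min (l t) s))) (d (x (min t u)) (y (min (l t) u))) < e"
          unfolding eventually_at_right_field using b(1) c(1) by (intro exI[of _ "min b c"]) auto
      qed
      then show "((\<lambda>s. ?Z s \<omega>) \<longlongrightarrow> ?Z u \<omega>) (at_right u)" for \<omega>
        by (intro tendsto_intros)
    qed simp
    then have "(\<lambda>u. (\<lambda>(u, \<omega>). indicator {0..} u * ?Z u \<omega>) (u, ())) \<in> borel_measurable borel"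
      by (rule measurable_compose[rotated]) simp
    then show ?thesis by simp
  qed
  have "(\<lambda>u. SUP t\<in>{0..} \<inter> \<rat>. indicator {0..} u * min 1 (d (x (min t u)) (y (min (l t) u)))) \<in> borel_measurable borel"
    by (intro borel_measurable_cSUP f)
      (auto simp: countable_rat countable_Int2 intro!: bdd_aboveI[of _ 1] split: split_indicator)
  moreover have "indicator {0..} u * path_gap d l x y u
      = (SUP t\<in>{0..} \<inter> \<rat>. indicator {0..} u * min 1 (d (x (min t u)) (y (min (l t) u))))" for u
  proof (cases "0 \<le> u")
    case True
    then show ?thesis using path_gap_rational[OF x y l] by simp
  next
    case False
    moreover have "{0..} \<inter> \<rat> \<noteq> ({} :: real set)" using Rats_0 by fastforce
    ultimately show ?thesis by (simp add: cSUP_const)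
  qed
  ultimately show ?thesis by simp
qed

lemma path_gap_integrable:
  assumes "x \<in> cadlag" "y \<in> cadlag" "l \<in> time_changes"
  shows "set_integrable lborel {0..} (\<lambda>u. exp (- u) * path_gap d l x y u)"
  unfolding set_integrable_def
proof (rule Bochner_Integration.integrable_bound)
  show "integrable lborel (\<lambda>u. indicator {0..} u *\<^sub>R (exp (- 1 * u) :: real))"
    using exp_atLeast(1)[OF zero_less_one, of 0] unfolding set_integrable_def by simp
  have "(\<lambda>u. exp (- u) * (indicator {0..} u * path_gap d l x y u)) \<in> borel_measurable borel"
    by (rule borel_measurable_times[OF _ path_gap_measurable[OF assms]]) measurable
  then show "(\<lambda>u. indicator {0..} u *\<^sub>R (exp (- u) * path_gap d l x y u)) \<in> borel_measurable lborel"
    by (simp add: mult_ac)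
  show "AE u in lborel. norm (indicator {0..} u *\<^sub>R (exp (- u) * path_gap d l x y u)) \<le> norm (indicator {0..} u *\<^sub>R (exp (- 1 * u) :: real))"
    using path_gap_bounds by (auto split: split_indicator simp: abs_mult)
qed

definition path_cost :: "(real \<Rightarrow> real) \<Rightarrow> (real \<Rightarrow> 'a) \<Rightarrow> (real \<Rightarrow> 'a) \<Rightarrow> real" where
  "path_cost l x y = max (Sup (log_slopes l)) (LINT u:{0..}|lborel. exp (- u) * path_gap d l x y u)"

lemma skorohod_dist_eq: "skorohod_dist d x y = (INF l\<in>time_changes. path_cost l x y)"
  unfolding skorohod_dist_def path_cost_def path_gap_def by simp

lemma path_cost_nonneg: "l \<in> time_changes \<Longrightarrow> 0 \<le> path_cost l x y"
  unfolding path_cost_def using Sup_log_slopes_nonneg by fastforce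

lemma skorohod_dist_le: "l \<in> time_changes \<Longrightarrow> skorohod_dist d x y \<le> path_cost l x y"
  unfolding skorohod_dist_eq
  by (rule cINF_lower) (auto intro!: bdd_belowI[of _ 0] path_cost_nonneg)

lemma skorohod_dist_lessD:
  assumes "skorohod_dist d x y < e"
  obtains l where "l \<in> time_changes" "path_cost l x y < e"
proof -
  have "time_changes \<noteq> {}" using id_time_change by blast
  moreover have "bdd_below ((\<lambda>l. path_cost l x y) ` time_changes)"
    by (auto intro!: bdd_belowI[of _ 0] path_cost_nonneg)
  ultimately show thesis
    using assms that unfolding skorohod_dist_eq by (subst (asm) cINF_less_iff) auto
qed

text \<open>Substituting s = l t shows that l from x to y and its inverse from y to x have the same
  gap, and they have the same slopes.\<close>

lemma skorohod_dist_sym: "skorohod_dist d x y = skorohod_dist d y x"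
proof -
  have le: "skorohod_dist d y x \<le> skorohod_dist d x y" for x y
  proof (rule field_le_epsilon)
    fix e :: real assume "0 < e"
    then obtain l where l: "l \<in> time_changes" "path_cost l x y < skorohod_dist d x y + e"
      using skorohod_dist_lessD[of x y "skorohod_dist d x y + e"] by auto
    let ?i = "inv_into {0..} l"
    note bij = time_changesD(2)[OF l(1)]
    have "path_gap d ?i y x u \<le> path_gap d l x y u" for u
    proof (rule path_gap_least)
      fix t :: real assume t: "0 \<le> t"
      have i: "0 \<le> ?i t" "l (?i t) = t"
        using time_changesD(4)[OF inv_time_change(1)[OF l(1)] t] bij_betw_inv_into_right[OF bij, of t] t by auto
      show "min 1 (d (y (min t u)) (x (min (?i t) u))) \<le> path_gap d l x y u"
        using path_gap_upper[OF i(1), of x u y l] unfolding i(2) by (simp add: commute)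
    qed
    moreover have "path_gap d l x y u \<le> path_gap d ?i y x u" for u
    proof (rule path_gap_least)
      fix t :: real assume t: "0 \<le> t"
      have i: "0 \<le> l t" "?i (l t) = t"
        using time_changesD(4)[OF l(1) t] bij_betw_inv_into_left[OF bij, of t] t by auto
      show "min 1 (d (x (min t u)) (y (min (l t) u))) \<le> path_gap d ?i y x u"
        using path_gap_upper[OF i(1), of y u x ?i] unfolding i(2) by (simp add: commute)
    qed
    ultimately have "path_gap d ?i y x = path_gap d l x y" by (intro ext antisym)
    then have "path_cost ?i y x = path_cost l x y"
      unfolding path_cost_def using inv_time_change(2)[OF l(1)] by simp
    then show "skorohod_dist d y x \<le> skorohod_dist d x y + e"
      using skorohod_dist_le[OF inv_time_change(1)[OF l(1)], of y x] l(2) by simp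
  qed
  show ?thesis using le[of x y] le[of y x] by simp
qed

text \<open>Compose two nearly optimal time changes: the logarithmic slopes add, and the gap at time
  t is split at the value of y at l t.\<close>

lemma skorohod_dist_triangle:
  assumes x: "x \<in> cadlag" and y: "y \<in> cadlag" and z: "z \<in> cadlag"
  shows "skorohod_dist d x z \<le> skorohod_dist d x y + skorohod_dist d y z"
proof (rule field_le_epsilon)
  fix e :: real assume "0 < e"
  obtain l where l: "l \<in> time_changes" "path_cost l x y < skorohod_dist d x y + e/2"
    using skorohod_dist_lessD[of x y "skorohod_dist d x y + e/2"] \<open>0 < e\<close> by auto
  obtain l' where l': "l' \<in> time_changes" "path_cost l' y z < skorohod_dist d y z + e/2"
    using skorohod_dist_lessD[of y z "skorohod_dist d y z + e/2"] \<open>0 < e\<close> by auto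
  note c = comp_time_change[OF l(1) l'(1)]
  have gap: "path_gap d (l' \<circ> l) x z u \<le> path_gap d l x y u + path_gap d l' y z u" if "0 \<le> u" for u
  proof (rule path_gap_least)
    fix t :: real assume t: "0 \<le> t"
    note lt = time_changesD(4)[OF l(1) t]
    have "d (x (min t u)) (z (min (l' (l t)) u))
        \<le> d (x (min t u)) (y (min (l t) u)) + d (y (min (l t) u)) (z (min (l' (l t)) u))"
      using t lt time_changesD(4)[OF l'(1) lt] that
      by (intro triangle cadlag_in[OF x] cadlag_in[OF y] cadlag_in[OF z]) auto
    then have "min 1 (d (x (min t u)) (z (min (l' (l t)) u)))
        \<le> min 1 (d (x (min t u)) (y (min (l t) u))) + min 1 (d (y (min (l t) u)) (z (min (l' (l t)) u)))"
      by (rule min_1_add) simp_all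
    also have "\<dots> \<le> path_gap d l x y u + path_gap d l' y z u"
      by (intro add_mono path_gap_upper t lt)
    finally show "min 1 (d (x (min t u)) (z (min ((l' \<circ> l) t) u))) \<le> path_gap d l x y u + path_gap d l' y z u"
      by simp
  qed
  note int = path_gap_integrable[OF x y l(1)] path_gap_integrable[OF y z l'(1)] path_gap_integrable[OF x z c(1)]
  have "(LINT u:{0..}|lborel. exp (- u) * path_gap d (l' \<circ> l) x z u)
      \<le> (LINT u:{0..}|lborel. exp (- u) * path_gap d l x y u + exp (- u) * path_gap d l' y z u)"
  proof (rule set_integral_mono[OF int(3) set_integral_add(1)[OF int(1,2)]])
    fix u :: real assume "u \<in> {0..}"
    then show "exp (- u) * path_gap d (l' \<circ> l) x z u \<le> exp (- u) * path_gap d l x y u + exp (- u) * path_gap d l' y z u"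
      using gap[of u] by (simp flip: distrib_left)
  qed
  also have "\<dots> = (LINT u:{0..}|lborel. exp (- u) * path_gap d l x y u) + (LINT u:{0..}|lborel. exp (- u) * path_gap d l' y z u)"
    by (rule set_integral_add(2)) (rule int)+
  finally have "path_cost (l' \<circ> l) x z \<le> path_cost l x y + path_cost l' y z"
    using c(2) unfolding path_cost_def by linarith
  then show "skorohod_dist d x z \<le> skorohod_dist d x y + skorohod_dist d y z + e"
    using skorohod_dist_le[OF c(1), of x z] l(2) l'(2) by linarith
qed

end

subsection \<open>Discretization of cadlag paths\<close>

context Metric_space
begin

text \<open>A cadlag path has finitely many large jumps on a bounded interval. That F misses
  {s<..s'} says that s and s' lie in the same half-open piece of the partition. Bisection reduces
  the claim to short intervals around a point p, where the left and right limits allow F =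
  {p}.\<close>

lemma cadlag_partition:
  assumes x: "x \<in> cadlag" and "0 < e" "0 \<le> T"
  obtains F where "finite F"
    "\<And>s s'. 0 \<le> s \<Longrightarrow> s < s' \<Longrightarrow> s' < T \<Longrightarrow> F \<inter> {s<..s'} = {} \<Longrightarrow> d (x s) (x s') < e"
proof -
  define P where "P a b \<longleftrightarrow> (\<exists>F. finite F \<and> (\<forall>s s'. 0 \<le> s \<and> a \<le> s \<and> s < s' \<and> s' < b \<and> F \<inter> {s<..s'} = {}
    \<longrightarrow> d (x s) (x s') < e))" for a b :: real
  have "P 0 T"
    using \<open>0 \<le> T\<close>
  proof (induction rule: Bolzano)
    case (trans a b c)
    obtain F where F: "finite F" "\<And>s s'. 0 \<le> s \<and> a \<le> s \<and> s < s' \<and> s' < b \<and> F \<inter> {s<..s'} = {} \<Longrightarrow> d (x s) (x s') < e"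
      using trans(1) unfolding P_def by blast
    obtain G where G: "finite G" "\<And>s s'. 0 \<le> s \<and> b \<le> s \<and> s < s' \<and> s' < c \<and> G \<inter> {s<..s'} = {} \<Longrightarrow> d (x s) (x s') < e"
      using trans(2) unfolding P_def by blast
    \<comment> \<open>The common end b joins the division points, so that no admissible pair s < s'
      straddles it.\<close>
    have "d (x s) (x s') < e"
      if "0 \<le> s \<and> a \<le> s \<and> s < s' \<and> s' < c \<and> insert b (F \<union> G) \<inter> {s<..s'} = {}" for s s'
    proof -
      have "s' < b \<or> b \<le> s" using that by force
      moreover have "F \<inter> {s<..s'} = {}" "G \<inter> {s<..s'} = {}" using that by auto
      ultimately show ?thesis using F(2)[of s s'] G(2)[of s s'] that by blast
    qed
    then show ?case
      unfolding P_def using F(1) G(1) by (intro exI[of _ "insert b (F \<union> G)"]) simp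
  next
    case (local p)
    obtain b where b: "p < b" "\<And>s. p \<le> s \<Longrightarrow> s < b \<Longrightarrow> d (x s) (x p) < e/2"
      using cadlag_right[OF x local(1), of "e/2"] \<open>0 < e\<close> by auto
    obtain c where c: "c < p" "\<And>s s'. 0 \<le> s \<Longrightarrow> c < s \<Longrightarrow> s < p \<Longrightarrow> c < s' \<Longrightarrow> s' < p \<Longrightarrow> d (x s) (x s') < e"
    proof (cases "p = 0")
      case True
      then show thesis using that[of "-1"] by simp
    next
      case False
      then show thesis using cadlag_left[OF x, of p e] local(1) \<open>0 < e\<close> that by (metis less_eq_real_def)
    qed
    have "P a' b'" if ab: "a' \<le> p" "p \<le> b'" "b' - a' < min (b - p) (p - c)" for a' b'
    proof -
      have "d (x s) (x s') < e"
        if s: "0 \<le> s \<and> a' \<le> s \<and> s < s' \<and> s' < b' \<and> {p} \<inter> {s<..s'} = {}" for s s'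
      proof (cases "s' < p")
        case True
        then show ?thesis using c(2)[of s s'] s ab by linarith
      next
        case False
        then have "p \<le> s" using s by force
        then have "d (x s) (x p) < e/2" "d (x s') (x p) < e/2"
          using b(2)[of s] b(2)[of s'] s ab by linarith+
        moreover have "d (x s) (x s') \<le> d (x s) (x p) + d (x p) (x s')"
          using s local(1) by (intro triangle cadlag_in[OF x]) auto
        ultimately show ?thesis by (simp add: commute)
      qed
      then show ?thesis unfolding P_def by (intro exI[of _ "{p}"]) simp
    qed
    then show ?case using b(1) c(1) by (intro exI[of _ "min (b - p) (p - c)"]) auto
  qed
  then obtain F where "finite F" "\<And>s s'. 0 \<le> s \<and> 0 \<le> s \<and> s < s' \<and> s' < T \<and> F \<inter> {s<..s'} = {} \<Longrightarrow> d (x s) (x s') < e"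
    unfolding P_def by blast
  then show thesis using that[of F] by blast
qed

end

text \<open>Finitely many points can be moved to the right by small amounts with a time change of small slope:
  add McShane's Lipschitz extension of the displacements.\<close>

lemma displacing_time_change:
  assumes F: "finite F" "F \<subseteq> {0<..}" and e: "0 < e" "e \<le> 1/2"
  obtains \<delta> where "0 < (\<delta>::real)"
    "\<And>c. (\<And>p. p \<in> F \<Longrightarrow> 0 \<le> c p \<and> c p < \<delta>) \<Longrightarrow>
      \<exists>l\<in>time_changes. Sup (log_slopes l) \<le> 2 * e \<and> (\<forall>p\<in>F. l p = p + c p)"
proof -
  define G where "G = insert 1 ((\<lambda>(p, q). \<bar>p - q\<bar>) ` ((insert 0 F \<times> insert 0 F) - Id))"
  \<comment> \<open>\<open>Min G\<close> is the smallest spacing of the points of F and 0, capped at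
    1. Displacements below e times this spacing are e-Lipschitz on these points, which is what
    McShane's extension needs in order to keep their values.\<close>
  define \<delta> where "\<delta> = e * Min G"
  have G: "finite G" "G \<noteq> {}" "\<And>g. g \<in> G \<Longrightarrow> 0 < g" unfolding G_def using F(1) by auto
  have gap: "\<delta> \<le> e * \<bar>p - q\<bar>" if "p \<in> insert 0 F" "q \<in> insert 0 F" "p \<noteq> q" for p q
  proof -
    have "\<bar>p - q\<bar> \<in> G" unfolding G_def using that by (intro insertI2 image_eqI[of _ _ "(p, q)"]) auto
    then show ?thesis unfolding \<delta>_def using Min_le[OF G(1)] e(1) by simp
  qed
  have "0 < \<delta>" unfolding \<delta>_def using e G by simp
  show thesis
  proof (rule that[OF \<open>0 < \<delta>\<close>])
    fix c :: "real \<Rightarrow> real" assume c: "\<And>p. p \<in> F \<Longrightarrow> 0 \<le> c p \<and> c p < \<delta>"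
    \<comment> \<open>Time 0 joins the interpolation points with displacement 0, since a time change
      must fix it.\<close>
    define c' where "c' p = (if p = 0 then 0 else c p)" for p
    have c': "0 \<le> c' p" "c' p < \<delta>" if "p \<in> insert 0 F" for p
      using c[of p] that \<open>0 < \<delta>\<close> unfolding c'_def by auto
    define \<phi> where "\<phi> t = Min ((\<lambda>p. c' p + e * \<bar>t - p\<bar>) ` insert 0 F)" for t
    have fin: "finite ((\<lambda>p. c' p + e * \<bar>t - p\<bar>) ` insert 0 F)" for t using F(1) by blast
    have \<phi>_le: "\<phi> t \<le> c' p + e * \<bar>t - p\<bar>" if "p \<in> insert 0 F" for t p
      unfolding \<phi>_def using fin that by (intro Min_le) blast+
    have \<phi>_in: "\<exists>p\<in>insert 0 F. \<phi> t = c' p + e * \<bar>t - p\<bar>" for t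
    proof -
      have "\<phi> t \<in> (\<lambda>p. c' p + e * \<bar>t - p\<bar>) ` insert 0 F"
        unfolding \<phi>_def by (rule Min_in[OF fin]) blast
      then show ?thesis by blast
    qed
    have \<phi>_F: "\<phi> p = c' p" if p: "p \<in> insert 0 F" for p
    proof -
      obtain q where q: "q \<in> insert 0 F" "\<phi> p = c' q + e * \<bar>p - q\<bar>" using \<phi>_in by blast
      have "c' p \<le> \<phi> p" using gap[OF p q(1)] c'[OF q(1)] c'[OF p] q(2) by (cases "p = q") auto
      then show ?thesis using \<phi>_le[OF p, of p] by simp
    qed
    have \<phi>_nonneg: "0 \<le> \<phi> t" for t
      using \<phi>_in[of t] c'(1) e(1) by (metis abs_ge_zero add_nonneg_nonneg less_imp_le mult_nonneg_nonneg)
    have lip: "\<phi> t \<le> \<phi> s + e * \<bar>t - s\<bar>" for s t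
    proof -
      obtain p where p: "p \<in> insert 0 F" "\<phi> s = c' p + e * \<bar>s - p\<bar>" using \<phi>_in by blast
      have "e * \<bar>t - p\<bar> \<le> e * (\<bar>s - p\<bar> + \<bar>t - s\<bar>)" using e(1) by (intro mult_left_mono) auto
      then show ?thesis using \<phi>_le[OF p(1), of t] p(2) by (simp add: distrib_left)
    qed
    define l where "l t = t + \<phi> t" for t
    have slope: "(1 - e) * (t - s) \<le> l t - l s" "l t - l s \<le> (1 + e) * (t - s)" if "s < t" for s t
      using lip[of s t] lip[of t s] that unfolding l_def by (simp_all add: algebra_simps)
    have mono: "l s < l t" if "s < t" for s t
    proof -
      have "0 < (1 - e) * (t - s)" using that e by simp
      then show ?thesis using slope(1)[OF that] by linarith
    qed
    have l0: "l 0 = 0" unfolding l_def using \<phi>_F[of 0] by (simp add: c'_def)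
    have "continuous_on A l" for A
    proof -
      have "e-lipschitz_on A \<phi>"
        using lip[THEN order_trans] e(1) lip
        by (intro lipschitz_onI) (auto simp: dist_real_def abs_le_iff abs_minus_commute diff_le_eq add.commute minus_le_iff)
      then show ?thesis unfolding l_def by (intro continuous_intros lipschitz_on_continuous_on)
    qed
    then have surj: "\<exists>t\<ge>0. l t = y" if "0 \<le> y" for y
      using IVT'[of l 0 y y] l0 \<phi>_nonneg[of y] that unfolding l_def[of y] by auto
    \<comment> \<open>Slopes lie between 1 - e and 1 + e. The lower side ln (1 - e) \<ge> - e - 2
      e^2 is at least - 2 e because e \<le> 1/2; this explains the factor 2 and the bound on
      e.\<close>
    have slopes: "v \<le> 2 * e" if "v \<in> log_slopes l" for v
    proof -
      obtain s t where st: "s < t" "v = \<bar>ln ((l t - l s) / (t - s))\<bar>"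
        using \<open>v \<in> log_slopes l\<close> unfolding log_slopes_def by blast
      define r where "r = (l t - l s) / (t - s)"
      have r: "1 - e \<le> r" "r \<le> 1 + e"
        unfolding r_def using slope[OF st(1)] st(1) by (simp_all add: pos_le_divide_eq pos_divide_le_eq)
      have "ln r \<le> ln (1 + e)" "ln (1 - e) \<le> ln r" using r e by simp_all
      moreover have "ln (1 + e) \<le> e" using e by (intro ln_add_one_self_le_self) simp
      moreover have "- e - 2 * e\<^sup>2 \<le> ln (1 - e)" using e by (intro ln_one_minus_pos_lower_bound) auto
      moreover have "2 * e\<^sup>2 \<le> e" using e mult_left_mono[of "2 * e" 1 e] by (simp add: power2_eq_square)
      ultimately show ?thesis using st(2) e unfolding r_def[symmetric] by linarith
    qed
    have "bij_betw l {0..} {0..}"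
      unfolding bij_betw_def
    proof
      show "inj_on l {0..}" using mono by (metis inj_onI linorder_less_linear order_less_irrefl)
      have "0 \<le> l t" if "0 \<le> t" for t using \<phi>_nonneg[of t] that unfolding l_def by simp
      then show "l ` {0..} = {0..}" using surj by (auto simp: image_iff Bex_def)
    qed
    then have "l \<in> time_changes"
      unfolding time_changes_def using mono slopes by (auto simp: strict_mono_on_def intro!: bdd_aboveI)
    moreover have "Sup (log_slopes l) \<le> 2 * e" by (rule cSup_least[OF log_slopes_nonempty slopes])
    moreover have "\<forall>p\<in>F. l p = p + c p"
      unfolding l_def using \<phi>_F F(2) by (auto simp: c'_def)
    ultimately show "\<exists>l\<in>time_changes. Sup (log_slopes l) \<le> 2 * e \<and> (\<forall>p\<in>F. l p = p + c p)" by blast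
  qed
qed

text \<open>Freezing the path at time \<open>m\<close> makes it depend on finitely many of the values \<open>a i\<close>.\<close>

definition grid_path :: "nat \<Rightarrow> (nat \<Rightarrow> 'e) \<Rightarrow> real \<Rightarrow> 'e" where
  "grid_path m a = (\<lambda>t\<in>{0..}. a (min (nat \<lfloor>t * real m\<rfloor>) (m * m)))"

context Metric_space
begin

lemma grid_path_cadlag:
  assumes "0 < m" and a: "\<And>i. i \<le> m * m \<Longrightarrow> a i \<in> M"
  shows "grid_path m a \<in> cadlag"
  unfolding cadlag_paths_def
proof (intro CollectI conjI allI impI)
  let ?x = "grid_path m a"
  show "?x \<in> extensional {0..}" unfolding grid_path_def by simp
  fix t :: real assume t: "0 \<le> t"
  let ?k = "\<lfloor>t * real m\<rfloor>"
  have lt: "t < (of_int ?k + 1) / real m" using assms(1) by (simp add: pos_less_divide_eq)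
  have "?x s = ?x t" if "t < s" "s < (of_int ?k + 1) / real m" for s
  proof -
    have "t * real m \<le> s * real m" using that(1) by (intro mult_right_mono) auto
    then have "of_int ?k \<le> s * real m" using of_int_floor_le[of "t * real m"] by linarith
    moreover have "s * real m < of_int ?k + 1" using that assms(1) by (simp add: pos_less_divide_eq)
    ultimately have "\<lfloor>s * real m\<rfloor> = ?k" by (simp add: floor_eq_iff)
    then show ?thesis using that t unfolding grid_path_def by simp
  qed
  moreover have "?x t \<in> M" using t a unfolding grid_path_def by simp
  ultimately show "limitin mtopology ?x (?x t) (at_right t)"
    unfolding limitin_metric eventually_at_right_field using lt by (metis mdist_zero)
next
  let ?x = "grid_path m a"
  fix t :: real assume t: "0 < t"
  let ?k = "\<lceil>t * real m\<rceil> - 1"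
  have k: "0 \<le> ?k" "of_int ?k < t * real m" using t assms(1) by (simp, linarith)
  then have lt: "of_int ?k / real m < t" using assms(1) by (simp add: pos_divide_less_eq)
  let ?l = "a (min (nat ?k) (m * m))"
  have "?x s = ?l" if "of_int ?k / real m < s" "s < t" for s
  proof -
    have "of_int ?k < s * real m" using that(1) assms(1) by (simp add: pos_divide_less_eq)
    moreover have "s * real m < t * real m" using that(2) assms(1) by simp
    then have "s * real m < of_int ?k + 1" using le_of_int_ceiling[of "t * real m"] by simp linarith
    ultimately have "\<lfloor>s * real m\<rfloor> = ?k" by (simp add: floor_eq_iff)
    moreover have "0 \<le> s" using that(1) k(1) assms(1) by (smt (verit) divide_nonneg_nonneg of_int_0_le_iff of_nat_0_le_iff)
    ultimately show ?thesis unfolding grid_path_def by simp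
  qed
  moreover have "?l \<in> M" using a by simp
  ultimately have "limitin mtopology ?x ?l (at_left t)"
    unfolding limitin_metric eventually_at_left_field using lt by (metis mdist_zero)
  then show "\<exists>l. limitin mtopology ?x l (at_left t)" by blast
qed

text \<open>The time change moves each partition point p of x up to the next grid point, so the
  jumps of the two paths are aligned. This can fail only through the freezing at u: when p \<le> u
  but the image of p exceeds u, one frozen path has jumped and the other has not. Such u lie within
  1/m after p and are excluded.\<close>

lemma grid_path_gap:
  assumes x: "x \<in> cadlag" and m: "0 < m" "T < real m"
    and F: "\<And>s s'. 0 \<le> s \<Longrightarrow> s < s' \<Longrightarrow> s' < T + 1 \<Longrightarrow> F \<inter> {s<..s'} = {} \<Longrightarrow> d (x s) (x s') < e"
    and a: "\<And>i. i \<le> m * m \<Longrightarrow> a i \<in> M \<and> d (a i) (x (real i / real m)) < e"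
    and l: "l \<in> time_changes" "\<And>p. p \<in> F \<Longrightarrow> 0 < p \<Longrightarrow> l p = of_int \<lceil>p * real m\<rceil> / real m"
    and u: "0 \<le> u" "u \<le> T" "\<And>p. p \<in> F \<Longrightarrow> 0 < p \<Longrightarrow> u \<notin> {p..p + 1 / real m}"
    and "0 < e"
  shows "path_gap d l x (grid_path m a) u \<le> 2 * e"
proof (rule path_gap_least)
  fix t :: real assume t: "0 \<le> t"
  note lt = time_changesD(4)[OF l(1) t]
  define s where "s = min t u"
  define b where "b = min (l t) u"
  define i where "i = nat \<lfloor>b * real m\<rfloor>"
  define b' where "b' = real i / real m"
  have sb: "0 \<le> s" "s \<le> T" "0 \<le> b" "b \<le> T" unfolding s_def b_def using t u lt by auto
  have i: "real i = of_int \<lfloor>b * real m\<rfloor>" unfolding i_def using sb by simp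
  have b': "0 \<le> b'" "b' \<le> b"
    unfolding b'_def i using sb m by (simp_all add: pos_divide_le_eq)
  have "b * real m \<le> real m * real m" using sb m by (intro mult_right_mono) auto
  then have "real i \<le> real (m * m)" unfolding i using of_int_floor_le[of "b * real m"] by simp linarith
  then have im: "i \<le> m * m" by linarith
  \<comment> \<open>No partition point separates s from b', the grid time that is read off at b. The
    point l p is on the grid, so p \<le> b' means l p \<le> b, that is p \<le> t and l p \<le> u;
    the exclusion of u turns the last condition into p \<le> u.\<close>
  have iff: "p \<le> s \<longleftrightarrow> p \<le> b'" if p: "p \<in> F" "0 < p" for p
  proof -
    have ceil: "of_int \<lceil>p * real m\<rceil> < p * real m + 1" by linarith
    have lp: "p \<le> l p" "l p \<le> p + 1 / real m"
      unfolding l(2)[OF p] using m ceil by (simp_all add: pos_le_divide_eq pos_divide_le_eq distrib_right)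
    have "p \<le> b' \<longleftrightarrow> p * real m \<le> of_int \<lfloor>b * real m\<rfloor>"
      unfolding b'_def i using m by (simp add: pos_le_divide_eq)
    also have "\<dots> \<longleftrightarrow> \<lceil>p * real m\<rceil> \<le> \<lfloor>b * real m\<rfloor>" by (simp add: ceiling_le_iff)
    also have "\<dots> \<longleftrightarrow> of_int \<lceil>p * real m\<rceil> \<le> b * real m" by (simp add: le_floor_iff)
    also have "\<dots> \<longleftrightarrow> l p \<le> b" unfolding l(2)[OF p] using m by (simp add: pos_divide_le_eq)
    also have "\<dots> \<longleftrightarrow> p \<le> t \<and> l p \<le> u"
      unfolding b_def using time_change_less_iff(2)[OF l(1), of p t] p t by simp
    also have "l p \<le> u \<longleftrightarrow> p \<le> u" using lp u(3)[OF p] by auto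
    finally show ?thesis unfolding s_def by auto
  qed
  have "F \<inter> {min s b'<..max s b'} = {}"
  proof -
    have "False" if "p \<in> F" "min s b' < p" "p \<le> max s b'" for p
      using iff[of p] that sb b' by (auto simp: min_def max_def split: if_splits)
    then show ?thesis by fastforce
  qed
  then have "d (x (min s b')) (x (max s b')) < e" if "s \<noteq> b'"
    using F[of "min s b'" "max s b'"] that sb b' by (auto simp: min_def max_def)
  then have near: "d (x s) (x b') < e"
    using \<open>0 < e\<close> cadlag_in[OF x sb(1)] by (cases "s = b'") (auto simp: min_def max_def commute split: if_splits)
  have "grid_path m a b = a i" unfolding grid_path_def using sb im by (simp flip: i_def)
  then have "d (x s) (grid_path m a b) \<le> d (x s) (x b') + d (x b') (a i)"
    using triangle[OF cadlag_in[OF x sb(1)] cadlag_in[OF x b'(1)]] a[OF im] by simp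
  also have "\<dots> < e + e" using near a[OF im] unfolding b'_def by (simp add: commute)
  finally show "min 1 (d (x (min t u)) (grid_path m a (min (l t) u))) \<le> 2 * e"
    unfolding s_def b_def by simp
qed

text \<open>The exceptional times u near the partition points have total length card F / m. Being
  integrated in the Skorohod distance, they do no harm for large m.\<close>

lemma grid_path_converges:
  assumes x: "x \<in> cadlag"
    and a: "\<And>m i. 0 < m \<Longrightarrow> i \<le> m * m \<Longrightarrow> a m i \<in> M \<and> d (a m i) (x (real i / real m)) < 1 / real m"
    and "0 < \<epsilon>"
  obtains N where "0 < N" "\<And>m. N \<le> m \<Longrightarrow> skorohod_dist d x (grid_path m (a m)) < \<epsilon>"
proof -
  \<comment> \<open>The total error will be 4 e, which \<epsilon> / 5 keeps below \<epsilon>; the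
    bound 1/2 is required by \<open>displacing_time_change\<close>.\<close>
  define e where "e = min (\<epsilon> / 5) (1/2)"
  have e: "0 < e" "e \<le> 1/2" "4 * e < \<epsilon>" using \<open>0 < \<epsilon>\<close> unfolding e_def by auto
  define T where "T = - ln e"
  have T: "0 \<le> T" "exp (- T) = e" using e unfolding T_def by (auto simp: ln_le_zero_iff)
  \<comment> \<open>The partition extends beyond T because the times compared may equal T, whereas
    \<open>cadlag_partition\<close> bounds them strictly.\<close>
  obtain F0 where F0: "finite F0" "\<And>s s'. 0 \<le> s \<Longrightarrow> s < s' \<Longrightarrow> s' < T + 1 \<Longrightarrow> F0 \<inter> {s<..s'} = {} \<Longrightarrow> d (x s) (x s') < e"
    using cadlag_partition[OF x e(1), of "T + 1"] T(1) by auto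
  define F where "F = F0 \<inter> {0<..}"
  have F: "finite F" "F \<subseteq> {0<..}" using F0(1) unfolding F_def by auto
  obtain \<delta> where \<delta>: "0 < (\<delta>::real)" "\<And>c. (\<And>p. p \<in> F \<Longrightarrow> 0 \<le> c p \<and> c p < \<delta>) \<Longrightarrow>
      \<exists>l\<in>time_changes. Sup (log_slopes l) \<le> 2 * e \<and> (\<forall>p\<in>F. l p = p + c p)"
    using displacing_time_change[OF F e(1,2)] by blast
  \<comment> \<open>An upper bound for 1/m with three uses: displacements stay below \<delta>, the
    exceptional times have total length at most e, and the values on the grid have error at most
    e.\<close>
  define \<kappa> where "\<kappa> = min \<delta> (e / (real (card F) + 1))"
  have \<kappa>: "0 < \<kappa>" "\<kappa> \<le> \<delta>" "\<kappa> * real (card F) \<le> e" "\<kappa> \<le> e"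
  proof -
    show "0 < \<kappa>" "\<kappa> \<le> \<delta>" unfolding \<kappa>_def using \<delta> e by auto
    have le: "\<kappa> * (real (card F) + 1) \<le> e"
      using mult_right_mono[of \<kappa> "e / (real (card F) + 1)" "real (card F) + 1"] unfolding \<kappa>_def by simp
    moreover have "\<kappa> * real (card F) \<le> \<kappa> * (real (card F) + 1)" "\<kappa> * 1 \<le> \<kappa> * (real (card F) + 1)"
      using \<open>0 < \<kappa>\<close> by (intro mult_left_mono; simp)+
    ultimately show "\<kappa> * real (card F) \<le> e" "\<kappa> \<le> e" by linarith+
  qed
  obtain N1 :: nat where N1: "inverse (real (Suc N1)) < \<kappa>" using reals_Archimedean[OF \<kappa>(1)] by blast
  obtain N2 :: nat where N2: "T < real N2" using reals_Archimedean2 by blast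
  show thesis
  proof (rule that[of "max (Suc N1) N2"])
    show "0 < max (Suc N1) N2" by simp
    fix m assume m: "max (Suc N1) N2 \<le> m"
    have m0: "0 < m" "T < real m" using m N2 by linarith+
    have "1 / real m \<le> inverse (real (Suc N1))" using m m0 by (simp add: field_simps)
    then have m1: "1 / real m < \<kappa>" using N1 by linarith
    define c where "c p = of_int \<lceil>p * real m\<rceil> / real m - p" for p
    have c: "0 \<le> c p \<and> c p < \<delta>" for p
    proof -
      have "of_int \<lceil>p * real m\<rceil> < p * real m + 1" by linarith
      then have "of_int \<lceil>p * real m\<rceil> / real m < p + 1 / real m"
        using m0 by (simp add: pos_divide_less_eq distrib_right)
      moreover have "p \<le> of_int \<lceil>p * real m\<rceil> / real m"
        using m0 by (simp add: pos_le_divide_eq)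
      ultimately show ?thesis unfolding c_def using m1 \<kappa>(2) by linarith
    qed
    obtain l where l: "l \<in> time_changes" "Sup (log_slopes l) \<le> 2 * e" "\<forall>p\<in>F. l p = p + c p"
      using \<delta>(2)[of c, OF c] by blast
    let ?y = "grid_path m (a m)"
    have gap: "path_gap d l x ?y u \<le> 2 * e"
      if u: "0 \<le> u" "u \<le> T" "\<And>p. p \<in> F \<Longrightarrow> u \<notin> {p..p + 1 / real m}" for u
    proof (rule grid_path_gap[OF x m0 F0(2)])
      show "a m i \<in> M \<and> d (a m i) (x (real i / real m)) < e" if "i \<le> m * m" for i
        using a[OF m0(1) that] m1 \<kappa>(4) by linarith
      show "l p = of_int \<lceil>p * real m\<rceil> / real m" if "p \<in> F0" "0 < p" for p
        using l(3) that unfolding F_def c_def by simp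
      show "u \<notin> {p..p + 1 / real m}" if "p \<in> F0" "0 < p" for p
        using u(3) that unfolding F_def by simp
    qed (use l u e in auto)
    \<comment> \<open>A dominating function with one term for each source of error: the gap 2 e at
      ordinary times, the tail beyond T of weight exp (- T) = e, and the exceptional times, where
      the integrand is only bounded by 1.\<close>
    define h where "h u = 2 * e * (indicator {0..} u * exp (- 1 * u)) + indicator {T..} u * exp (- 1 * u)
      + (\<Sum>p\<in>F. indicator {p..p + 1 / real m} u)" for u :: real
    have int_exp: "integrable lborel (\<lambda>u. indicator {b..} u * (exp (- 1 * u) :: real))"
      "(\<integral>u. indicator {b..} u * exp (- 1 * u) \<partial>lborel) = exp (- b)" for b :: real
      using exp_atLeast[OF zero_less_one, of b] unfolding set_integrable_def set_lebesgue_integral_def by simp_all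
    have int_ind: "integrable lborel (indicator {p..p + 1 / real m} :: real \<Rightarrow> real)"
      "(\<integral>u. indicator {p..p + 1 / real m} u \<partial>lborel) = 1 / real m" for p
      using m0 by simp_all
    have "integrable lborel h"
      unfolding h_def using int_exp int_ind
      by (intro Bochner_Integration.integrable_add Bochner_Integration.integrable_sum integrable_mult_right) auto
    have "(\<integral>u. h u \<partial>lborel) = 2 * e + e + real (card F) * (1 / real m)"
      unfolding h_def using int_exp int_ind T(2)
      by (subst Bochner_Integration.integral_add Bochner_Integration.integral_sum
          | simp add: Bochner_Integration.integrable_add Bochner_Integration.integrable_sum)+
    also have "\<dots> \<le> 4 * e"
      using \<kappa>(3) m1 mult_left_mono[of "1 / real m" \<kappa> "real (card F)"] by (simp add: mult.commute)
    finally have h_le: "(\<integral>u. h u \<partial>lborel) \<le> 4 * e" .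
    have "(LINT u:{0..}|lborel. exp (- u) * path_gap d l x ?y u) \<le> (\<integral>u. h u \<partial>lborel)"
      unfolding set_lebesgue_integral_def
    proof (rule integral_mono'[OF \<open>integrable lborel h\<close>])
      fix u :: real
      have nn: "0 \<le> 2 * e * (indicator {0..} u * exp (- 1 * u))" "0 \<le> indicat_real {T..} u * exp (- 1 * u)"
        "0 \<le> (\<Sum>p\<in>F. indicat_real {p..p + 1 / real m} u)"
        using e by (auto intro!: sum_nonneg mult_nonneg_nonneg)
      then show "0 \<le> h u" unfolding h_def by simp
      show "indicator {0..} u *\<^sub>R (exp (- u) * path_gap d l x ?y u) \<le> h u"
      proof (cases "0 \<le> u")
        case True
        note b = path_gap_bounds[of l x ?y u]
        have le_exp: "exp (- u) * path_gap d l x ?y u \<le> exp (- u)"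
          using mult_left_mono[OF b(2), of "exp (- u)"] by simp
        consider "T < u" | p where "p \<in> F" "u \<in> {p..p + 1 / real m}"
          | "u \<le> T" "\<And>p. p \<in> F \<Longrightarrow> u \<notin> {p..p + 1 / real m}" by fastforce
        then have "exp (- u) * path_gap d l x ?y u \<le> h u"
        proof cases
          case 1
          then have "exp (- u) \<le> h u" unfolding h_def using nn by simp
          then show ?thesis using le_exp by linarith
        next
          case 2
          have "exp (- u) \<le> 1" using True by simp
          also have "1 \<le> (\<Sum>p\<in>F. indicat_real {p..p + 1 / real m} u)"
            using 2 F(1) member_le_sum[of p F "\<lambda>p. indicat_real {p..p + 1 / real m} u"] by simp
          also have "\<dots> \<le> h u" unfolding h_def using nn by simp
          finally show ?thesis using le_exp by linarith
        next
          case 3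
          then have "exp (- u) * path_gap d l x ?y u \<le> exp (- u) * (2 * e)"
            using gap[OF True] by (intro mult_left_mono) auto
          also have "\<dots> \<le> h u" unfolding h_def using nn True by simp
          finally show ?thesis .
        qed
        then show ?thesis using True by simp
      qed (use \<open>0 \<le> h u\<close> in simp)
    qed
    then have "path_cost l x ?y \<le> 4 * e"
      unfolding path_cost_def using l(2) h_le e(1) by linarith
    then show "skorohod_dist d x ?y < \<epsilon>" using skorohod_dist_le[OF l(1), of x ?y] e(3) by linarith
  qed
qed

text \<open>With the identity as time change. Beyond T the gap is at most 1, and the remaining
  weight is exp (- T).\<close>

lemma skorohod_dist_const_le:
  assumes "\<And>t. 0 \<le> t \<Longrightarrow> t \<le> T \<Longrightarrow> d c (x t) \<le> e" "0 \<le> e" "0 \<le> T"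
  shows "skorohod_dist d (\<lambda>t\<in>{0..}. c) x \<le> e + exp (- T)"
proof -
  let ?c = "\<lambda>t\<in>{0..}. c"
  define h where "h u = e * (indicator {0..} u * exp (- 1 * u)) + indicator {T..} u * exp (- 1 * u)" for u :: real
  have int_exp: "integrable lborel (\<lambda>u. indicator {b..} u * (exp (- 1 * u) :: real))"
    "(\<integral>u. indicator {b..} u * exp (- 1 * u) \<partial>lborel) = exp (- b)" for b :: real
    using exp_atLeast[OF zero_less_one, of b] unfolding set_integrable_def set_lebesgue_integral_def by simp_all
  have "integrable lborel h"
    unfolding h_def using int_exp
    by (intro Bochner_Integration.integrable_add integrable_mult_right) auto
  have h: "(\<integral>u. h u \<partial>lborel) = e + exp (- T)"
    unfolding h_def using int_exp by (subst Bochner_Integration.integral_add) simp_all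
  have "(LINT u:{0..}|lborel. exp (- u) * path_gap d (\<lambda>t. t) ?c x u) \<le> (\<integral>u. h u \<partial>lborel)"
    unfolding set_lebesgue_integral_def
  proof (rule integral_mono'[OF \<open>integrable lborel h\<close>])
    fix u :: real
    have nn: "0 \<le> e * (indicator {0..} u * exp (- 1 * u))" "0 \<le> indicat_real {T..} u * exp (- 1 * u)"
      using assms by auto
    then show "0 \<le> h u" unfolding h_def by simp
    show "indicator {0..} u *\<^sub>R (exp (- u) * path_gap d (\<lambda>t. t) ?c x u) \<le> h u"
    proof (cases "0 \<le> u")
      case True
      have "exp (- u) * path_gap d (\<lambda>t. t) ?c x u \<le> h u"
      proof (cases "u \<le> T")
        case True
        then have "path_gap d (\<lambda>t. t) ?c x u \<le> e"
          using assms(1)[of "min _ u"] \<open>0 \<le> u\<close> by (intro path_gap_least) (auto intro: min.coboundedI2)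
        then have "exp (- u) * path_gap d (\<lambda>t. t) ?c x u \<le> exp (- u) * e" by (intro mult_left_mono) auto
        also have "\<dots> \<le> h u" unfolding h_def using nn \<open>0 \<le> u\<close> by (simp add: mult.commute)
        finally show ?thesis .
      next
        case False
        have "exp (- u) * path_gap d (\<lambda>t. t) ?c x u \<le> exp (- u)"
          using mult_left_mono[OF path_gap_bounds(2), of "exp (- u)"] by simp
        also have "\<dots> \<le> h u" unfolding h_def using nn False by simp
        finally show ?thesis .
      qed
      then show ?thesis using True by simp
    qed (use \<open>0 \<le> h u\<close> in simp)
  qed
  then have "path_cost (\<lambda>t. t) ?c x \<le> e + exp (- T)"
    unfolding path_cost_def id_time_change(2) using h assms by simp
  then show ?thesis using skorohod_dist_le[OF id_time_change(1), of ?c x] by linarith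
qed

end

subsection \<open>Measurability of the path map\<close>

text \<open>The limit lies in an open set U exactly if, for some k, the approximations eventually
  lie in \<open>V k\<close>, the set of points whose 1/(k+1)-ball lies in U. As \<open>V k\<close>
  is not claimed to be Borel, the preimage of every set under g is required to be measurable, which
  suits maps that factor through a countable type.\<close>

lemma measurable_dist_topology_approx:
  fixes g :: "nat \<Rightarrow> 'w \<Rightarrow> 'e"
  assumes sym: "\<And>x y. x \<in> M \<Longrightarrow> y \<in> M \<Longrightarrow> d x y = d y x"
    and triangle: "\<And>x y z. x \<in> M \<Longrightarrow> y \<in> M \<Longrightarrow> z \<in> M \<Longrightarrow> d x z \<le> d x y + d y z"
    and h: "\<And>\<omega>. \<omega> \<in> space \<Omega> \<Longrightarrow> h \<omega> \<in> M"
    and g: "\<And>m \<omega>. \<omega> \<in> space \<Omega> \<Longrightarrow> g m \<omega> \<in> M" "\<And>m V. {\<omega> \<in> space \<Omega>. g m \<omega> \<in> V} \<in> sets \<Omega>"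
    and conv: "\<And>\<omega> e. \<omega> \<in> space \<Omega> \<Longrightarrow> 0 < e \<Longrightarrow> \<exists>N. \<forall>m\<ge>N. d (h \<omega>) (g m \<omega>) < (e :: real)"
  shows "h \<in> \<Omega> \<rightarrow>\<^sub>M borel_of (dist_topology M d)"
  unfolding borel_of_def
proof (rule measurable_measure_of)
  show "{U. openin (dist_topology M d) U} \<subseteq> Pow (topspace (dist_topology M d))"
    using openin_subset by blast
  show "h \<in> space \<Omega> \<rightarrow> topspace (dist_topology M d)" using h by simp
  fix U assume "U \<in> {U. openin (dist_topology M d) U}"
  then have U: "\<And>x. x \<in> U \<Longrightarrow> \<exists>r>0. \<forall>y\<in>M. d x y < r \<longrightarrow> y \<in> U" by (simp add: openin_dist_topology)
  define V where "V k = {x. \<forall>y\<in>M. d x y < inverse (real (Suc k)) \<longrightarrow> y \<in> U}" for k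
  have "h \<omega> \<in> U \<longleftrightarrow> (\<exists>k N. \<forall>m\<in>{N..}. g m \<omega> \<in> V k)" if \<omega>: "\<omega> \<in> space \<Omega>" for \<omega>
  proof
    assume "h \<omega> \<in> U"
    then obtain r where r: "r > 0" "\<And>y. y \<in> M \<Longrightarrow> d (h \<omega>) y < r \<Longrightarrow> y \<in> U" using U by blast
    obtain k where k: "inverse (real (Suc k)) < r/2" using reals_Archimedean[of "r/2"] r(1) by auto
    obtain N where N: "\<And>m. m \<ge> N \<Longrightarrow> d (h \<omega>) (g m \<omega>) < r/2" using conv[OF \<omega>, of "r/2"] r(1) by auto
    have "g m \<omega> \<in> V k" if "m \<ge> N" for m
      unfolding V_def
    proof (intro CollectI ballI impI)
      fix y assume y: "y \<in> M" "d (g m \<omega>) y < inverse (real (Suc k))"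
      have "d (h \<omega>) y < r"
        using triangle[OF h[OF \<omega>] g(1)[OF \<omega>, of m] y(1)] N[OF that] y(2) k by linarith
      then show "y \<in> U" using r(2) y(1) by blast
    qed
    then show "\<exists>k N. \<forall>m\<in>{N..}. g m \<omega> \<in> V k" by auto
  next
    assume "\<exists>k N. \<forall>m\<in>{N..}. g m \<omega> \<in> V k"
    then obtain k N where kN: "\<And>m. N \<le> m \<Longrightarrow> g m \<omega> \<in> V k" by auto
    obtain N' where N': "\<And>m. N' \<le> m \<Longrightarrow> d (h \<omega>) (g m \<omega>) < inverse (real (Suc k))"
      using conv[OF \<omega>, of "inverse (real (Suc k))"] by auto
    have "d (g (max N N') \<omega>) (h \<omega>) < inverse (real (Suc k))"
      using N'[OF max.cobounded2, of N] sym[OF h[OF \<omega>] g(1)[OF \<omega>, of "max N N'"]] by simp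
    then show "h \<omega> \<in> U" using kN[OF max.cobounded1, of N'] h[OF \<omega>] unfolding V_def by simp
  qed
  then have "h -` U \<inter> space \<Omega> = {\<omega> \<in> space \<Omega>. \<exists>k N. \<forall>m\<in>{N..}. g m \<omega> \<in> V k}" by blast
  also have "\<dots> \<in> sets \<Omega>"
    by (intro sets.sets_Collect_countable_Ex sets.sets_Collect_countable_Ball g(2))
  finally show "h -` U \<inter> space \<Omega> \<in> sets \<Omega>" .
qed

lemma measurable_map_upt:
  fixes f :: "nat \<Rightarrow> 'w \<Rightarrow> nat"
  assumes "\<And>i. i < n \<Longrightarrow> f i \<in> \<Omega> \<rightarrow>\<^sub>M count_space UNIV"
  shows "(\<lambda>\<omega>. map (\<lambda>i. f i \<omega>) [0..<n]) \<in> \<Omega> \<rightarrow>\<^sub>M count_space UNIV"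
proof (subst measurable_count_space_eq2_countable, intro conjI ballI)
  fix v :: "nat list"
  have sets: "{\<omega> \<in> space \<Omega>. \<forall>i\<in>{..<n}. f i \<omega> = v ! i} \<in> sets \<Omega>"
  proof (rule sets.sets_Collect_finite_All)
    fix i assume "i \<in> {..<n}"
    then have "f i -` {v ! i} \<inter> space \<Omega> \<in> sets \<Omega>"
      using measurable_sets[OF assms] by simp
    moreover have "f i -` {v ! i} \<inter> space \<Omega> = {\<omega> \<in> space \<Omega>. f i \<omega> = v ! i}" by blast
    ultimately show "{\<omega> \<in> space \<Omega>. f i \<omega> = v ! i} \<in> sets \<Omega>" by simp
  qed simp
  have "(\<lambda>\<omega>. map (\<lambda>i. f i \<omega>) [0..<n]) -` {v} \<inter> space \<Omega>
      = (if length v = n then {\<omega> \<in> space \<Omega>. \<forall>i\<in>{..<n}. f i \<omega> = v ! i} else {})"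
    unfolding vimage_def by (auto simp: list_eq_iff_nth_eq)
  also have "\<dots> \<in> sets \<Omega>" using sets by simp
  finally show "(\<lambda>\<omega>. map (\<lambda>i. f i \<omega>) [0..<n]) -` {v} \<inter> space \<Omega> \<in> sets \<Omega>" .
qed auto

context Metric_space
begin

lemma borel_of_mball: "mball x r \<in> sets (borel_of mtopology)"
  by (rule borel_of_open) simp

text \<open>A measurable rounding of states to countably many points; taking the first ball of the
  net that contains the state makes it measurable.\<close>

lemma obtain_net:
  assumes "compact_space mtopology" "M \<noteq> {}" "0 < (r :: real)"
  obtains e :: "nat \<Rightarrow> 'a" and c where "\<And>i. e i \<in> M" "c \<in> borel_of mtopology \<rightarrow>\<^sub>M count_space UNIV"
    "\<And>y. y \<in> M \<Longrightarrow> d (e (c y)) y < r"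
proof -
  have tb: "mtotally_bounded M" using assms(1) compact_space_eq_mcomplete_mtotally_bounded by blast
  then obtain K where K: "finite K" "K \<subseteq> M" "M \<subseteq> (\<Union>x\<in>K. mball x r)"
    using tb[unfolded mtotally_bounded_def, rule_format, OF assms(3)] by auto
  have "K \<noteq> {}" using K(3) assms(2) by blast
  then obtain e :: "nat \<Rightarrow> 'a" where e: "range e = K"
    using K(1) by (metis countable_finite range_from_nat_into)
  define c where "c y = (LEAST i. y \<in> mball (e i) r)" for y
  have ex: "\<exists>i. y \<in> mball (e i) r" if "y \<in> M" for y using K(3) e that by blast
  have c: "y \<in> mball (e (c y)) r" if "y \<in> M" for y
    unfolding c_def by (rule LeastI_ex[OF ex[OF that]])
  show thesis
  proof
    show "e i \<in> M" for i using e K(2) by blast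
    show "d (e (c y)) y < r" if "y \<in> M" for y using c[OF that] by simp
    have "c -` {i} \<inter> M \<in> sets (borel_of mtopology)" for i
    proof -
      have "c -` {i} \<inter> M = mball (e i) r - (\<Union>j<i. mball (e j) r)"
      proof (intro equalityI subsetI)
        fix y assume y: "y \<in> c -` {i} \<inter> M"
        then have "y \<notin> mball (e j) r" if "j < i" for j
          using that not_less_Least[of j "\<lambda>i. y \<in> mball (e i) r"] unfolding c_def by blast
        then show "y \<in> mball (e i) r - (\<Union>j<i. mball (e j) r)" using c[of y] y by auto
      next
        fix y assume y: "y \<in> mball (e i) r - (\<Union>j<i. mball (e j) r)"
        have "c y = i" unfolding c_def
        proof (rule Least_equality)
          show "y \<in> mball (e i) r" using y by blast
          show "i \<le> j" if "y \<in> mball (e j) r" for j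
            using y that by (metis DiffD2 UN_I lessThan_iff linorder_le_less_linear)
        qed
        then show "y \<in> c -` {i} \<inter> M" using y by auto
      qed
      then show ?thesis using borel_of_mball by auto
    qed
    then show "c \<in> borel_of mtopology \<rightarrow>\<^sub>M count_space UNIV"
      by (subst measurable_count_space_eq2_countable) auto
  qed
qed

text \<open>The discretized path is determined by the rounded states at finitely many grid times,
  that is by a random \<open>nat list\<close>. As this type is countable, every preimage is
  measurable, and discretized paths converge in the Skorohod distance.\<close>

lemma measurable_path_of:
  assumes "compact_space mtopology" "M \<noteq> {}"
    and X: "\<And>t. 0 \<le> t \<Longrightarrow> X t \<in> \<Omega> \<rightarrow>\<^sub>M borel_of mtopology"
    and cad: "\<And>\<omega>. \<omega> \<in> space \<Omega> \<Longrightarrow> path_of X \<omega> \<in> cadlag"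
  shows "path_of X \<in> \<Omega> \<rightarrow>\<^sub>M borel_of (dist_topology cadlag (skorohod_dist d))"
proof -
  have "\<exists>(e :: nat \<Rightarrow> 'a) c. (\<forall>i. e i \<in> M) \<and> c \<in> borel_of mtopology \<rightarrow>\<^sub>M count_space UNIV \<and>
      (\<forall>y\<in>M. d (e (c y)) y < 1 / real (Suc m))" for m
    by (rule obtain_net[OF assms(1,2), of "1 / real (Suc m)"]) auto
  then obtain e :: "nat \<Rightarrow> nat \<Rightarrow> 'a" and c where e: "\<And>m i. e m i \<in> M"
    "\<And>m. c m \<in> borel_of mtopology \<rightarrow>\<^sub>M count_space UNIV"
    "\<And>m y. y \<in> M \<Longrightarrow> d (e m (c m y)) y < 1 / real (Suc m)" by metis
  \<comment> \<open>The net with index m has mesh 1/(m+1), so a grid with m points per unit of time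
    takes the net with index m - 1 and gets error below 1/m.\<close>
  define a where "a \<omega> m i = e (m - 1) (c (m - 1) (X (real i / real m) \<omega>))" for \<omega> m i
  define g where "g m \<omega> = grid_path (Suc m) (a \<omega> (Suc m))" for m \<omega>
  show ?thesis
  proof (rule measurable_dist_topology_approx[where g = g])
    show "skorohod_dist d x y = skorohod_dist d y x" for x y by (rule skorohod_dist_sym)
    show "skorohod_dist d x z \<le> skorohod_dist d x y + skorohod_dist d y z"
      if "x \<in> cadlag" "y \<in> cadlag" "z \<in> cadlag" for x y z
      using that by (rule skorohod_dist_triangle)
    show "path_of X \<omega> \<in> cadlag" if "\<omega> \<in> space \<Omega>" for \<omega> using that by (rule cad)
    show "g m \<omega> \<in> cadlag" for m \<omega>
      unfolding g_def a_def using e(1) by (intro grid_path_cadlag) auto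
  next
    fix m V
    let ?n = "Suc m * Suc m"
    have "(\<lambda>\<omega>. map (\<lambda>i. c m (X (real i / real (Suc m)) \<omega>)) [0..<Suc ?n]) \<in> \<Omega> \<rightarrow>\<^sub>M count_space UNIV"
      by (rule measurable_map_upt) (rule measurable_compose[OF X e(2)], simp)
    then have "(\<lambda>\<omega>. map (\<lambda>i. c m (X (real i / real (Suc m)) \<omega>)) [0..<Suc ?n])
        -` {v. grid_path (Suc m) (\<lambda>i. e m (v ! i)) \<in> V} \<inter> space \<Omega> \<in> sets \<Omega>"
      by (rule measurable_sets) simp
    moreover have "grid_path (Suc m) (\<lambda>i. e m (map (\<lambda>i. c m (X (real i / real (Suc m)) \<omega>)) [0..<Suc ?n] ! i)) = g m \<omega>" for \<omega>
    proof -
      have "min k ?n < Suc ?n" for k :: nat by simp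
      then show ?thesis unfolding g_def grid_path_def a_def by (simp del: upt_Suc of_nat_Suc mult_Suc mult_Suc_right)
    qed
    ultimately show "{\<omega> \<in> space \<Omega>. g m \<omega> \<in> V} \<in> sets \<Omega>"
      by (simp add: vimage_def Int_def conj_commute del: upt_Suc of_nat_Suc mult_Suc mult_Suc_right)
  next
    fix \<omega> \<epsilon> assume \<omega>: "\<omega> \<in> space \<Omega>" and \<epsilon>: "0 < (\<epsilon> :: real)"
    have X_in: "X t \<omega> \<in> M" if "0 \<le> t" for t using measurable_space[OF X[OF that] \<omega>] by simp
    have "a \<omega> m i \<in> M \<and> d (a \<omega> m i) (path_of X \<omega> (real i / real m)) < 1 / real m" if "0 < m" for m i
      using e(1) e(3)[OF X_in[of "real i / real m"], of "m - 1"] that unfolding a_def path_of_def by simp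
    then obtain N where N: "\<And>m. N \<le> m \<Longrightarrow> skorohod_dist d (path_of X \<omega>) (grid_path m (a \<omega> m)) < \<epsilon>"
      using grid_path_converges[OF cad[OF \<omega>] _ \<epsilon>, of "a \<omega>"] by blast
    then show "\<exists>N. \<forall>m\<ge>N. skorohod_dist d (path_of X \<omega>) (g m \<omega>) < \<epsilon>"
      unfolding g_def by (intro exI[of _ N]) simp
  qed
qed

end

section \<open>A maximal inequality for resolvents\<close>

locale cadlag_markov = Metric_space M d for M :: "'e set" and d +
  fixes S :: "'e set" and p :: "real \<Rightarrow> 'e \<Rightarrow> 'e measure"
    and \<Omega> :: "'w measure" and X :: "real \<Rightarrow> 'w \<Rightarrow> 'e" and P :: "'e \<Rightarrow> 'w measure"
  assumes S: "S \<in> sets (borel_of mtopology)"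
    and transition: "transition_function (borel_of mtopology) p"
    and markov: "cadlag_markov_process mtopology S p \<Omega> X P"
begin

abbreviation "N \<equiv> borel_of mtopology"
abbreviation "N\<^sub>S \<equiv> restrict_space N S"
abbreviation "past s \<equiv> natural_filtration \<Omega> N X s"

lemma S_subset: "S \<subseteq> M"
  using sets.sets_into_space[OF S] by simp

lemma space_N_S: "space N\<^sub>S = S"
  using S_subset by (auto simp: space_restrict_space)

lemma X_measurable_S: "0 \<le> t \<Longrightarrow> X t \<in> \<Omega> \<rightarrow>\<^sub>M N\<^sub>S"
  using markov unfolding cadlag_markov_process_def Let_def by blast

lemma X_measurable: "0 \<le> t \<Longrightarrow> X t \<in> \<Omega> \<rightarrow>\<^sub>M N"
  using X_measurable_S measurable_restrict_space2_iff by blast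

lemma X_in: "0 \<le> t \<Longrightarrow> \<omega> \<in> space \<Omega> \<Longrightarrow> X t \<omega> \<in> S"
  using measurable_space[OF X_measurable_S] space_N_S by blast

lemma path_cadlag: "\<omega> \<in> space \<Omega> \<Longrightarrow> path_of X \<omega> \<in> cadlag"
  using markov unfolding cadlag_markov_process_def Let_def by blast

lemma P_kernel: "P \<in> N\<^sub>S \<rightarrow>\<^sub>M prob_algebra \<Omega>"
  using markov unfolding cadlag_markov_process_def Let_def by blast

lemma P:
  assumes "\<mu> \<in> S"
  shows "sets (P \<mu>) = sets \<Omega>" "space (P \<mu>) = space \<Omega>" "prob_space (P \<mu>)"
  using measurable_space[OF P_kernel, of \<mu>] assms sets_eq_imp_space_eq[of "P \<mu>" \<Omega>]
  unfolding space_N_S space_prob_algebra by auto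

lemma distr_P: "\<mu> \<in> S \<Longrightarrow> 0 \<le> t \<Longrightarrow> distr (P \<mu>) N (X t) = p t \<mu>"
  using markov unfolding cadlag_markov_process_def Let_def by blast

lemma cond_prob:
  assumes "\<mu> \<in> S" "0 \<le> s" "0 \<le> t" "A \<in> sets N"
  shows "AE \<omega> in P \<mu>. real_cond_exp (P \<mu>) (past s) (\<lambda>\<omega>'. indicator A (X (s + t) \<omega>')) \<omega>
             = measure (P (X s \<omega>)) {\<omega>' \<in> space \<Omega>. X t \<omega>' \<in> A}"
  using markov assms unfolding cadlag_markov_process_def Let_def by blast

lemma p_measurable: "0 \<le> t \<Longrightarrow> p t \<in> N \<rightarrow>\<^sub>M prob_algebra N"
  using transition unfolding transition_function_def by blast

lemma p:
  assumes "\<mu> \<in> M" "0 \<le> t"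
  shows "sets (p t \<mu>) = sets N" "space (p t \<mu>) = M" "prob_space (p t \<mu>)"
  using measurable_space[OF p_measurable[OF assms(2)], of \<mu>] assms sets_eq_imp_space_eq[of "p t \<mu>" N]
  by (auto simp: space_prob_algebra)

lemma right_continuous:
  assumes k: "continuous_map mtopology euclideanreal k" and \<omega>: "\<omega> \<in> space \<Omega>" and t: "0 \<le> t"
  shows "((\<lambda>s. k (X s \<omega>)) \<longlongrightarrow> k (X t \<omega>)) (at_right t)"
proof -
  have "limitin mtopology (path_of X \<omega>) (path_of X \<omega> t) (at_right t)"
    using path_cadlag[OF \<omega>] t unfolding cadlag_paths_def by blast
  then have "limitin euclideanreal (k \<circ> path_of X \<omega>) (k (path_of X \<omega> t)) (at_right t)"
    by (rule continuous_map_limit[OF k])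
  then have "((k \<circ> path_of X \<omega>) \<longlongrightarrow> k (path_of X \<omega> t)) (at_right t)"
    by simp
  moreover have "\<forall>\<^sub>F s in at_right t. (k \<circ> path_of X \<omega>) s = k (X s \<omega>)"
    unfolding eventually_at_right_field path_of_def using t by (intro exI[of _ "t + 1"]) simp
  ultimately show ?thesis using t by (simp add: path_of_def tendsto_cong)
qed

lemma past_sets: "sets (past s) = sigma_sets (space \<Omega>) {X u -` A \<inter> space \<Omega> |u A. 0 \<le> u \<and> u \<le> s \<and> A \<in> sets N}"
  unfolding natural_filtration_def by (rule sets_measure_of) auto

lemma past_subalgebra:
  assumes "\<mu> \<in> S" shows "subalgebra (P \<mu>) (past s)"
proof -
  have "sets (past s) \<subseteq> sets \<Omega>"
    unfolding past_sets by (intro sets.sigma_sets_subset) (auto intro: measurable_sets[OF X_measurable])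
  moreover have "space (past s) = space \<Omega>"
    unfolding natural_filtration_def by (simp add: space_measure_of_conv)
  ultimately show ?thesis unfolding subalgebra_def using P[OF assms] by simp
qed

lemma past_vimage: "0 \<le> u \<Longrightarrow> u \<le> s \<Longrightarrow> A \<in> sets N \<Longrightarrow> {\<omega> \<in> space \<Omega>. X u \<omega> \<in> A} \<in> sets (past s)"
  unfolding past_sets by (intro sigma_sets.Basic CollectI exI[of _ u] exI[of _ A]) auto

text \<open>The Markov property is given for indicators, as a conditional expectation, and in terms
  of \<open>P (X s \<omega>)\<close>. The law of X t under that measure is
  \<open>p t (X s \<omega>)\<close>; monotone approximation then extends the identity to nonnegative
  functions.\<close>

lemma nn_markov:
  assumes \<mu>: "\<mu> \<in> S" and s: "0 \<le> s" and t: "0 \<le> t" and A: "A \<in> sets (past s)" and f: "f \<in> borel_measurable N"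
  shows "(\<integral>\<^sup>+\<omega>. indicator A \<omega> * f (X (s + t) \<omega>) \<partial>P \<mu>) = (\<integral>\<^sup>+\<omega>. indicator A \<omega> * (\<integral>\<^sup>+y. f y \<partial>p t (X s \<omega>)) \<partial>P \<mu>)"
proof -
  interpret prob_space "P \<mu>" by (rule P(3)[OF \<mu>])
  interpret F: finite_measure_subalgebra "P \<mu>" "past s" using past_subalgebra[OF \<mu>] by unfold_locales
  have A': "A \<in> sets (P \<mu>)" using A past_subalgebra[OF \<mu>] unfolding subalgebra_def by blast
  have X_P: "X u \<in> P \<mu> \<rightarrow>\<^sub>M N" if "0 \<le> u" for u
    using X_measurable[OF that] P(1)[OF \<mu>] by (simp cong: measurable_cong_sets)
  have st: "0 \<le> s + t" using s t by simp
  have Xs_M: "X s \<omega> \<in> M" if "\<omega> \<in> space (P \<mu>)" for \<omega>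
    using X_in[OF s, of \<omega>] that P(2)[OF \<mu>] S_subset by auto
  have kernel: "(\<lambda>\<omega>. p t (X s \<omega>)) \<in> P \<mu> \<rightarrow>\<^sub>M subprob_algebra N"
    using measurable_compose[OF X_P[OF s] measurable_prob_algebraD[OF p_measurable[OF t]]] .
  have int_meas: "(\<lambda>\<omega>. \<integral>\<^sup>+y. g y \<partial>p t (X s \<omega>)) \<in> borel_measurable (P \<mu>)" if "g \<in> borel_measurable N" for g
    using measurable_compose[OF kernel nn_integral_measurable_subprob_algebra[OF that]] .
  have A_meas: "(indicator A :: _ \<Rightarrow> ennreal) \<in> borel_measurable (P \<mu>)" using A' by simp
  have X_f: "(\<lambda>\<omega>. g (X (s + t) \<omega>)) \<in> borel_measurable (P \<mu>)" if "g \<in> borel_measurable N" for g :: "'e \<Rightarrow> ennreal"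
    using measurable_compose[OF X_P[OF st] that] .
  from f show ?thesis
  proof (induct rule: borel_measurable_induct)
    case (cong f g)
    have "X (s + t) \<omega> \<in> M" if "\<omega> \<in> space (P \<mu>)" for \<omega>
      using X_in[OF st, of \<omega>] that P(2)[OF \<mu>] S_subset by auto
    then have "(\<integral>\<^sup>+\<omega>. indicator A \<omega> * g (X (s + t) \<omega>) \<partial>P \<mu>) = (\<integral>\<^sup>+\<omega>. indicator A \<omega> * f (X (s + t) \<omega>) \<partial>P \<mu>)"
      using cong(3) by (intro nn_integral_cong) simp
    moreover have "(\<integral>\<^sup>+y. g y \<partial>p t (X s \<omega>)) = (\<integral>\<^sup>+y. f y \<partial>p t (X s \<omega>))" if "\<omega> \<in> space (P \<mu>)" for \<omega>
      using cong(3) p(2)[OF Xs_M[OF that] t] by (intro nn_integral_cong) simp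
    ultimately show ?case using cong(4) by (simp cong: nn_integral_cong)
  next
    case (set B)
    have q_meas: "(\<lambda>\<omega>. measure (p t (X s \<omega>)) B) \<in> borel_measurable (P \<mu>)"
      using measurable_compose[OF kernel measurable_measure_subprob_algebra[OF set]] .
    have ind: "integrable (P \<mu>) (\<lambda>\<omega>. indicator B (X (s + t) \<omega>) :: real)"
      using measurable_compose[OF X_P[OF st], of "indicator B" borel] set
      by (intro integrable_const_bound[of _ 1]) auto
    have "AE \<omega> in P \<mu>. real_cond_exp (P \<mu>) (past s) (\<lambda>\<omega>'. indicator B (X (s + t) \<omega>')) \<omega> = measure (p t (X s \<omega>)) B"
      using cond_prob[OF \<mu> s t set] AE_space
    proof eventually_elim
      case (elim \<omega>)
      then have in_S: "X s \<omega> \<in> S" using X_in[OF s] P(2)[OF \<mu>] by simp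
      have "measure (p t (X s \<omega>)) B = measure (distr (P (X s \<omega>)) N (X t)) B"
        using distr_P[OF in_S t] by simp
      also have "\<dots> = measure (P (X s \<omega>)) (X t -` B \<inter> space \<Omega>)"
        using X_measurable[OF t] P[OF in_S] set
        by (subst measure_distr) (simp_all cong: measurable_cong_sets)
      also have "X t -` B \<inter> space \<Omega> = {\<omega>' \<in> space \<Omega>. X t \<omega>' \<in> B}" by auto
      finally show ?case using elim by simp
    qed
    then have "(\<integral>\<omega>. indicator A \<omega> * real_cond_exp (P \<mu>) (past s) (\<lambda>\<omega>'. indicator B (X (s + t) \<omega>')) \<omega> \<partial>P \<mu>)
        = (\<integral>\<omega>. indicator A \<omega> * measure (p t (X s \<omega>)) B \<partial>P \<mu>)"
      by (intro integral_cong_AE borel_measurable_times q_meas) (use A' in auto)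
    then have eq: "(\<integral>\<omega>. indicator A \<omega> * indicator B (X (s + t) \<omega>) \<partial>P \<mu>) = (\<integral>\<omega>. indicator A \<omega> * measure (p t (X s \<omega>)) B \<partial>P \<mu>)"
      using F.real_cond_exp_intA[OF ind A] unfolding set_lebesgue_integral_def by simp
    have "(\<integral>\<^sup>+\<omega>. indicator A \<omega> * indicator B (X (s + t) \<omega>) \<partial>P \<mu>)
        = (\<integral>\<^sup>+\<omega>. ennreal (indicator A \<omega> * indicator B (X (s + t) \<omega>)) \<partial>P \<mu>)"
      by (intro nn_integral_cong) (auto split: split_indicator)
    also have "\<dots> = ennreal (\<integral>\<omega>. indicator A \<omega> * indicator B (X (s + t) \<omega>) \<partial>P \<mu>)"
      using integrable_mult_indicator[OF A' ind] by (intro nn_integral_eq_integral) auto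
    also have "\<dots> = ennreal (\<integral>\<omega>. indicator A \<omega> * measure (p t (X s \<omega>)) B \<partial>P \<mu>)" using eq by simp
    also have "\<dots> = (\<integral>\<^sup>+\<omega>. ennreal (indicator A \<omega> * measure (p t (X s \<omega>)) B) \<partial>P \<mu>)"
    proof (intro nn_integral_eq_integral[symmetric] integrable_const_bound[of _ 1] AE_I2)
      fix \<omega> assume "\<omega> \<in> space (P \<mu>)"
      then interpret q: prob_space "p t (X s \<omega>)" using p(3)[OF Xs_M t] by simp
      show "norm (indicator A \<omega> * measure (p t (X s \<omega>)) B) \<le> 1" by (auto split: split_indicator)
    qed (use q_meas A' in auto)
    also have "\<dots> = (\<integral>\<^sup>+\<omega>. indicator A \<omega> * (\<integral>\<^sup>+y. indicator B y \<partial>p t (X s \<omega>)) \<partial>P \<mu>)"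
    proof (rule nn_integral_cong)
      fix \<omega> assume \<omega>: "\<omega> \<in> space (P \<mu>)"
      interpret q: prob_space "p t (X s \<omega>)" using p(3)[OF Xs_M[OF \<omega>] t] .
      have "B \<in> sets (p t (X s \<omega>))" using set p(1)[OF Xs_M[OF \<omega>] t] by simp
      then show "ennreal (indicator A \<omega> * measure (p t (X s \<omega>)) B) = indicator A \<omega> * (\<integral>\<^sup>+y. indicator B y \<partial>p t (X s \<omega>))"
        by (auto simp: q.emeasure_eq_measure split: split_indicator)
    qed
    finally show ?case .
  next
    case (mult u c)
    have "(\<integral>\<^sup>+\<omega>. indicator A \<omega> * (c * u (X (s + t) \<omega>)) \<partial>P \<mu>) = c * (\<integral>\<^sup>+\<omega>. indicator A \<omega> * u (X (s + t) \<omega>) \<partial>P \<mu>)"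
      using A_meas X_f[OF mult(2)] by (subst nn_integral_cmult[symmetric]) (auto simp: mult_ac)
    also have "\<dots> = (\<integral>\<^sup>+\<omega>. c * (indicator A \<omega> * (\<integral>\<^sup>+y. u y \<partial>p t (X s \<omega>))) \<partial>P \<mu>)"
      unfolding mult(4) using A_meas int_meas[OF mult(2)] by (subst nn_integral_cmult) auto
    also have "\<dots> = (\<integral>\<^sup>+\<omega>. indicator A \<omega> * (\<integral>\<^sup>+y. c * u y \<partial>p t (X s \<omega>)) \<partial>P \<mu>)"
    proof (rule nn_integral_cong)
      fix \<omega> assume \<omega>: "\<omega> \<in> space (P \<mu>)"
      have "u \<in> borel_measurable (p t (X s \<omega>))"
        using mult(2) p(1)[OF Xs_M[OF \<omega>] t] by (simp cong: measurable_cong_sets)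
      then show "c * (indicator A \<omega> * (\<integral>\<^sup>+y. u y \<partial>p t (X s \<omega>))) = indicator A \<omega> * (\<integral>\<^sup>+y. c * u y \<partial>p t (X s \<omega>))"
        by (simp add: nn_integral_cmult mult_ac)
    qed
    finally show ?case .
  next
    case (add u v)
    have "(\<integral>\<^sup>+\<omega>. indicator A \<omega> * (v (X (s + t) \<omega>) + u (X (s + t) \<omega>)) \<partial>P \<mu>)
        = (\<integral>\<^sup>+\<omega>. indicator A \<omega> * v (X (s + t) \<omega>) \<partial>P \<mu>) + (\<integral>\<^sup>+\<omega>. indicator A \<omega> * u (X (s + t) \<omega>) \<partial>P \<mu>)"
      using A_meas X_f[OF add(1)] X_f[OF add(4)] by (subst nn_integral_add[symmetric]) (auto simp: distrib_left)
    also have "\<dots> = (\<integral>\<^sup>+\<omega>. indicator A \<omega> * (\<integral>\<^sup>+y. v y \<partial>p t (X s \<omega>)) + indicator A \<omega> * (\<integral>\<^sup>+y. u y \<partial>p t (X s \<omega>)) \<partial>P \<mu>)"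
      unfolding add(3) add(7) using A_meas int_meas[OF add(1)] int_meas[OF add(4)] by (subst nn_integral_add) auto
    also have "\<dots> = (\<integral>\<^sup>+\<omega>. indicator A \<omega> * (\<integral>\<^sup>+y. v y + u y \<partial>p t (X s \<omega>)) \<partial>P \<mu>)"
    proof (rule nn_integral_cong)
      fix \<omega> assume \<omega>: "\<omega> \<in> space (P \<mu>)"
      have "u \<in> borel_measurable (p t (X s \<omega>))" "v \<in> borel_measurable (p t (X s \<omega>))"
        using add(1,4) p(1)[OF Xs_M[OF \<omega>] t] by (simp_all cong: measurable_cong_sets)
      then show "indicator A \<omega> * (\<integral>\<^sup>+y. v y \<partial>p t (X s \<omega>)) + indicator A \<omega> * (\<integral>\<^sup>+y. u y \<partial>p t (X s \<omega>))
          = indicator A \<omega> * (\<integral>\<^sup>+y. v y + u y \<partial>p t (X s \<omega>))"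
        by (simp add: nn_integral_add distrib_left)
    qed
    finally show ?case .
  next
    case (seq U)
    have mono: "U i y \<le> U j y" if "i \<le> j" for i j y using seq(4) that by (auto simp: incseq_def le_fun_def)
    have "(\<integral>\<^sup>+\<omega>. indicator A \<omega> * (SUP i. U i) (X (s + t) \<omega>) \<partial>P \<mu>) = (\<integral>\<^sup>+\<omega>. (SUP i. indicator A \<omega> * U i (X (s + t) \<omega>)) \<partial>P \<mu>)"
      by (simp add: SUP_mult_left_ennreal image_comp)
    also have "\<dots> = (SUP i. \<integral>\<^sup>+\<omega>. indicator A \<omega> * U i (X (s + t) \<omega>) \<partial>P \<mu>)"
      using A_meas X_f[OF seq(1)] mono
      by (intro nn_integral_monotone_convergence_SUP) (auto simp: incseq_def le_fun_def intro!: mult_left_mono)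
    also have "\<dots> = (SUP i. \<integral>\<^sup>+\<omega>. indicator A \<omega> * (\<integral>\<^sup>+y. U i y \<partial>p t (X s \<omega>)) \<partial>P \<mu>)"
      using seq(3) by simp
    also have "\<dots> = (\<integral>\<^sup>+\<omega>. (SUP i. indicator A \<omega> * (\<integral>\<^sup>+y. U i y \<partial>p t (X s \<omega>))) \<partial>P \<mu>)"
      using A_meas int_meas[OF seq(1)] mono
      by (intro nn_integral_monotone_convergence_SUP[symmetric])
        (auto simp: incseq_def le_fun_def intro!: mult_left_mono nn_integral_mono)
    also have "\<dots> = (\<integral>\<^sup>+\<omega>. indicator A \<omega> * (\<integral>\<^sup>+y. (SUP i. U i) y \<partial>p t (X s \<omega>)) \<partial>P \<mu>)"
    proof (rule nn_integral_cong)
      fix \<omega> assume \<omega>: "\<omega> \<in> space (P \<mu>)"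
      have "U i \<in> borel_measurable (p t (X s \<omega>))" for i
        using seq(1) p(1)[OF Xs_M[OF \<omega>] t] by (simp cong: measurable_cong_sets)
      then have "(\<integral>\<^sup>+y. (SUP i. U i y) \<partial>p t (X s \<omega>)) = (SUP i. \<integral>\<^sup>+y. U i y \<partial>p t (X s \<omega>))"
        using seq(4) by (intro nn_integral_monotone_convergence_SUP) auto
      then show "(SUP i. indicator A \<omega> * (\<integral>\<^sup>+y. U i y \<partial>p t (X s \<omega>))) = indicator A \<omega> * (\<integral>\<^sup>+y. (SUP i. U i) y \<partial>p t (X s \<omega>))"
        by (simp add: SUP_mult_left_ennreal image_comp)
    qed
    finally show ?case .
  qed
qed

end

section \<open>The discounted potential of a nonnegative function and its maximal inequality\<close>

text \<open>\<open>pot\<close> is \<open>\<beta>\<close> times the resolvent applied to \<open>k\<close>, and \<open>total\<close> is the random variable whose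
  expectation it is. The indicators make the integrands jointly measurable on the whole real line.\<close>

locale markov_potential = cadlag_markov M d S p \<Omega> X P
  for M :: "'e set" and d S p and \<Omega> :: "'w measure" and X P +
  fixes k :: "'e \<Rightarrow> real" and \<beta> :: real
  assumes k_cont: "continuous_map mtopology euclideanreal k"
    and k_nonneg: "\<mu> \<in> M \<Longrightarrow> 0 \<le> k \<mu>" and \<beta>: "0 < \<beta>"
begin

text \<open>The density of the exponential distribution with parameter \<beta>; total mass 1 is what
  lets the potential inherit integrals from an invariant measure.\<close>

definition weight :: "real \<Rightarrow> ennreal" where
  "weight t = ennreal (\<beta> * exp (- \<beta> * t)) * indicator {0..} t"

definition val :: "real \<Rightarrow> 'w \<Rightarrow> ennreal" where
  "val t \<omega> = ennreal (indicator {0..} t * k (X t \<omega>))"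

definition pot :: "'e \<Rightarrow> ennreal" where
  "pot \<mu> = (\<integral>\<^sup>+t. weight t * (\<integral>\<^sup>+\<omega>. val t \<omega> \<partial>P \<mu>) \<partial>lborel)"

definition total :: "'w \<Rightarrow> ennreal" where
  "total \<omega> = (\<integral>\<^sup>+t. weight t * val t \<omega> \<partial>lborel)"

lemma weight_measurable [measurable]: "weight \<in> borel_measurable borel"
  unfolding weight_def by measurable

lemma k_measurable: "k \<in> borel_measurable N"
  by (rule continuous_map_borel_of[OF k_cont])

lemma val_measurable: "(\<lambda>(t, \<omega>). val t \<omega>) \<in> borel_measurable (borel \<Otimes>\<^sub>M \<Omega>)"
proof -
  have "(\<lambda>(t, \<omega>). indicator {0..} t * k (X t \<omega>)) \<in> borel_measurable (borel \<Otimes>\<^sub>M \<Omega>)"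
    by (rule measurable_right_continuous_process)
      (auto intro: measurable_compose[OF X_measurable k_measurable] right_continuous[OF k_cont])
  then show ?thesis unfolding val_def case_prod_beta by measurable
qed

lemma expected_val_measurable: "(\<lambda>(t, \<mu>). \<integral>\<^sup>+\<omega>. val t \<omega> \<partial>P \<mu>) \<in> borel_measurable (borel \<Otimes>\<^sub>M N\<^sub>S)"
proof -
  have "(\<lambda>x. \<integral>\<^sup>+\<omega>. val (fst x) \<omega> \<partial>P (snd x)) \<in> borel_measurable (borel \<Otimes>\<^sub>M N\<^sub>S)"
  proof (rule nn_integral_measurable_subprob_algebra2)
    have "(\<lambda>z. (\<lambda>(t, \<omega>). val t \<omega>) (fst (fst z), snd z)) \<in> borel_measurable ((borel \<Otimes>\<^sub>M N\<^sub>S) \<Otimes>\<^sub>M \<Omega>)"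
      by (rule measurable_compose[OF _ val_measurable]) measurable
    then show "(\<lambda>(x, \<omega>). val (fst x) \<omega>) \<in> borel_measurable ((borel \<Otimes>\<^sub>M N\<^sub>S) \<Otimes>\<^sub>M \<Omega>)"
      by (simp add: case_prod_beta)
    show "(\<lambda>x. P (snd x)) \<in> borel \<Otimes>\<^sub>M N\<^sub>S \<rightarrow>\<^sub>M subprob_algebra \<Omega>"
      by (rule measurable_compose[OF measurable_snd measurable_prob_algebraD[OF P_kernel]])
  qed
  then show ?thesis by (simp add: case_prod_beta)
qed

lemma pot_measurable: "pot \<in> borel_measurable N\<^sub>S"
proof -
  have "(\<lambda>(\<mu>, t). weight t * (\<integral>\<^sup>+\<omega>. val t \<omega> \<partial>P \<mu>)) \<in> borel_measurable (N\<^sub>S \<Otimes>\<^sub>M lborel)"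
  proof -
    have "(\<lambda>x. (\<lambda>(t, \<mu>). \<integral>\<^sup>+\<omega>. val t \<omega> \<partial>P \<mu>) (snd x, fst x)) \<in> borel_measurable (N\<^sub>S \<Otimes>\<^sub>M lborel)"
      by (rule measurable_compose[OF _ expected_val_measurable]) measurable
    then have "(\<lambda>x. \<integral>\<^sup>+\<omega>. val (snd x) \<omega> \<partial>P (fst x)) \<in> borel_measurable (N\<^sub>S \<Otimes>\<^sub>M lborel)" by simp
    then show ?thesis unfolding case_prod_beta by measurable
  qed
  then show ?thesis unfolding pot_def by measurable
qed

lemma total_measurable: "total \<in> borel_measurable \<Omega>"
proof -
  have "(\<lambda>x. (\<lambda>(t, \<omega>). val t \<omega>) (snd x, fst x)) \<in> borel_measurable (\<Omega> \<Otimes>\<^sub>M lborel)"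
    by (rule measurable_compose[OF _ val_measurable]) measurable
  then have "(\<lambda>x. val (snd x) (fst x)) \<in> borel_measurable (\<Omega> \<Otimes>\<^sub>M lborel)" by simp
  then have "(\<lambda>(\<omega>, t). weight t * val t \<omega>) \<in> borel_measurable (\<Omega> \<Otimes>\<^sub>M lborel)"
    unfolding case_prod_beta by measurable
  then show ?thesis unfolding total_def by measurable
qed

lemma Fubini_P:
  assumes "\<mu> \<in> S" "(\<lambda>(t, \<omega>). f t \<omega>) \<in> borel_measurable (borel \<Otimes>\<^sub>M \<Omega>)"
  shows "(\<integral>\<^sup>+\<omega>. (\<integral>\<^sup>+t. f t \<omega> \<partial>lborel) \<partial>P \<mu>) = (\<integral>\<^sup>+t. (\<integral>\<^sup>+\<omega>. f t \<omega> \<partial>P \<mu>) \<partial>lborel)"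
proof -
  interpret prob_space "P \<mu>" by (rule P(3)[OF assms(1)])
  interpret pair_sigma_finite lborel "P \<mu>" ..
  have "case_prod f \<in> borel_measurable (lborel \<Otimes>\<^sub>M P \<mu>)"
    using assms(2) P(1)[OF assms(1)] by (simp cong: measurable_cong_sets sets_pair_measure_cong)
  then show ?thesis by (rule Fubini')
qed

lemma val_section: "val t \<in> borel_measurable \<Omega>"
  using measurable_compose[OF measurable_Pair1' val_measurable, of t] by simp

lemma expected_total:
  assumes "\<mu> \<in> S" shows "(\<integral>\<^sup>+\<omega>. total \<omega> \<partial>P \<mu>) = pot \<mu>"
proof -
  have "(\<lambda>(t, \<omega>). weight t * val t \<omega>) \<in> borel_measurable (borel \<Otimes>\<^sub>M \<Omega>)"
    using val_measurable unfolding case_prod_beta by measurable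
  then have "(\<integral>\<^sup>+\<omega>. total \<omega> \<partial>P \<mu>) = (\<integral>\<^sup>+t. (\<integral>\<^sup>+\<omega>. weight t * val t \<omega> \<partial>P \<mu>) \<partial>lborel)"
    unfolding total_def by (rule Fubini_P[OF assms])
  also have "\<dots> = pot \<mu>"
    unfolding pot_def using val_section P(1)[OF assms]
    by (intro nn_integral_cong nn_integral_cmult) (simp cong: measurable_cong_sets)
  finally show ?thesis .
qed

lemma expected_val:
  assumes "\<mu> \<in> S" "0 \<le> t"
  shows "(\<integral>\<^sup>+\<omega>. val t \<omega> \<partial>P \<mu>) = (\<integral>\<^sup>+y. ennreal (k y) \<partial>p t \<mu>)"
proof -
  have "(\<integral>\<^sup>+y. ennreal (k y) \<partial>p t \<mu>) = (\<integral>\<^sup>+\<omega>. ennreal (k (X t \<omega>)) \<partial>P \<mu>)"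
    unfolding distr_P[OF assms, symmetric] using X_measurable[OF assms(2)] P(1)[OF assms(1)] k_measurable
    by (subst nn_integral_distr) (auto cong: measurable_cong_sets)
  then show ?thesis unfolding val_def using assms by simp
qed

text \<open>By the Markov property, \<open>exp (- \<beta> s) pot (X s)\<close> is the conditional expectation, given the past, of the
  part of \<open>total\<close> that accrues after time \<open>s\<close>.\<close>

lemma discounted_pot_le:
  assumes \<mu>: "\<mu> \<in> S" and s: "0 \<le> s" and A: "A \<in> sets (past s)"
  shows "(\<integral>\<^sup>+\<omega>. indicator A \<omega> * (ennreal (exp (- \<beta> * s)) * pot (X s \<omega>)) \<partial>P \<mu>) \<le> (\<integral>\<^sup>+\<omega>. indicator A \<omega> * total \<omega> \<partial>P \<mu>)"
proof -
  have A': "A \<in> sets \<Omega>" using A past_subalgebra[OF \<mu>] P(1)[OF \<mu>] unfolding subalgebra_def by blast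
  have [measurable]: "(indicator A :: _ \<Rightarrow> ennreal) \<in> borel_measurable \<Omega>" using A' by simp
  have P_eq: "f \<in> borel_measurable (P \<mu>) \<longleftrightarrow> f \<in> borel_measurable \<Omega>" for f :: "'w \<Rightarrow> ennreal"
    using P(1)[OF \<mu>] by (simp cong: measurable_cong_sets)
  let ?e = "ennreal (exp (- \<beta> * s))"
  have XS: "X s \<omega> \<in> S" if "\<omega> \<in> space \<Omega>" for \<omega> by (rule X_in[OF s that])
  have "(\<lambda>x. (\<lambda>(t, \<mu>). \<integral>\<^sup>+\<omega>. val t \<omega> \<partial>P \<mu>) (fst x, X s (snd x))) \<in> borel_measurable (borel \<Otimes>\<^sub>M \<Omega>)"
    by (rule measurable_compose[OF _ expected_val_measurable])
      (intro measurable_Pair measurable_fst measurable_compose[OF measurable_snd X_measurable_S[OF s]])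
  then have m1 [measurable]: "(\<lambda>x. \<integral>\<^sup>+\<omega>'. val (fst x) \<omega>' \<partial>P (X s (snd x))) \<in> borel_measurable (borel \<Otimes>\<^sub>M \<Omega>)" by simp
  have m1': "(\<lambda>\<omega>. \<integral>\<^sup>+\<omega>'. val t \<omega>' \<partial>P (X s \<omega>)) \<in> borel_measurable \<Omega>" for t
    using measurable_compose[OF measurable_Pair1' m1, of t] by simp
  have "(\<lambda>x. (\<lambda>(t, \<omega>). val t \<omega>) (s + fst x, snd x)) \<in> borel_measurable (borel \<Otimes>\<^sub>M \<Omega>)"
    by (rule measurable_compose[OF _ val_measurable]) measurable
  then have m2 [measurable]: "(\<lambda>x. val (s + fst x) (snd x)) \<in> borel_measurable (borel \<Otimes>\<^sub>M \<Omega>)" by simp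
  have "(\<integral>\<^sup>+\<omega>. indicator A \<omega> * (?e * pot (X s \<omega>)) \<partial>P \<mu>)
      = (\<integral>\<^sup>+\<omega>. (\<integral>\<^sup>+t. (?e * weight t) * (indicator A \<omega> * (\<integral>\<^sup>+\<omega>'. val t \<omega>' \<partial>P (X s \<omega>))) \<partial>lborel) \<partial>P \<mu>)"
  proof (rule nn_integral_cong)
    fix \<omega> assume "\<omega> \<in> space (P \<mu>)"
    then have \<omega>: "\<omega> \<in> space \<Omega>" using P[OF \<mu>] by simp
    have m: "(\<lambda>t. \<integral>\<^sup>+\<omega>'. val t \<omega>' \<partial>P (X s \<omega>)) \<in> borel_measurable borel"
      using measurable_compose[OF measurable_Pair2'[OF \<omega>] m1] by simp
    have "indicator A \<omega> * (?e * pot (X s \<omega>))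
        = (indicator A \<omega> * ?e) * (\<integral>\<^sup>+t. weight t * (\<integral>\<^sup>+\<omega>'. val t \<omega>' \<partial>P (X s \<omega>)) \<partial>lborel)"
      unfolding pot_def by (simp add: mult_ac)
    also have "\<dots> = (\<integral>\<^sup>+t. (indicator A \<omega> * ?e) * (weight t * (\<integral>\<^sup>+\<omega>'. val t \<omega>' \<partial>P (X s \<omega>))) \<partial>lborel)"
      using m by (intro nn_integral_cmult[symmetric]) measurable
    finally show "indicator A \<omega> * (?e * pot (X s \<omega>))
        = (\<integral>\<^sup>+t. (?e * weight t) * (indicator A \<omega> * (\<integral>\<^sup>+\<omega>'. val t \<omega>' \<partial>P (X s \<omega>))) \<partial>lborel)"
      by (simp add: mult_ac)
  qed
  also have "\<dots> = (\<integral>\<^sup>+t. (\<integral>\<^sup>+\<omega>. (?e * weight t) * (indicator A \<omega> * (\<integral>\<^sup>+\<omega>'. val t \<omega>' \<partial>P (X s \<omega>))) \<partial>P \<mu>) \<partial>lborel)"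
    by (rule Fubini_P[OF \<mu>]) (unfold case_prod_beta, measurable)
  also have "\<dots> = (\<integral>\<^sup>+t. (\<integral>\<^sup>+\<omega>. (?e * weight t) * (indicator A \<omega> * val (s + t) \<omega>) \<partial>P \<mu>) \<partial>lborel)"
  proof (rule nn_integral_cong)
    fix t :: real
    have v: "val (s + t) \<in> borel_measurable (P \<mu>)" "val (s + t) \<in> borel_measurable \<Omega>" for t
      using val_section P_eq by auto
    show "(\<integral>\<^sup>+\<omega>. (?e * weight t) * (indicator A \<omega> * (\<integral>\<^sup>+\<omega>'. val t \<omega>' \<partial>P (X s \<omega>))) \<partial>P \<mu>)
        = (\<integral>\<^sup>+\<omega>. (?e * weight t) * (indicator A \<omega> * val (s + t) \<omega>) \<partial>P \<mu>)"
    proof (cases "0 \<le> t")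
      case True
      have "(\<integral>\<^sup>+\<omega>. indicator A \<omega> * (\<integral>\<^sup>+\<omega>'. val t \<omega>' \<partial>P (X s \<omega>)) \<partial>P \<mu>)
          = (\<integral>\<^sup>+\<omega>. indicator A \<omega> * (\<integral>\<^sup>+y. ennreal (k y) \<partial>p t (X s \<omega>)) \<partial>P \<mu>)"
        using expected_val[OF XS True] P(2)[OF \<mu>] by (intro nn_integral_cong) simp
      also have "\<dots> = (\<integral>\<^sup>+\<omega>. indicator A \<omega> * ennreal (k (X (s + t) \<omega>)) \<partial>P \<mu>)"
        using k_measurable by (intro nn_markov[OF \<mu> s True A, symmetric]) measurable
      also have "\<dots> = (\<integral>\<^sup>+\<omega>. indicator A \<omega> * val (s + t) \<omega> \<partial>P \<mu>)"
        unfolding val_def using s True by simp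
      finally have eq: "(\<integral>\<^sup>+\<omega>. indicator A \<omega> * (\<integral>\<^sup>+\<omega>'. val t \<omega>' \<partial>P (X s \<omega>)) \<partial>P \<mu>)
          = (\<integral>\<^sup>+\<omega>. indicator A \<omega> * val (s + t) \<omega> \<partial>P \<mu>)" .
      show ?thesis
        using eq m1' v by (subst (1 2) nn_integral_cmult) (auto simp: P_eq)
    qed (simp add: weight_def)
  qed
  also have "\<dots> = (\<integral>\<^sup>+\<omega>. (\<integral>\<^sup>+t. (?e * weight t) * (indicator A \<omega> * val (s + t) \<omega>) \<partial>lborel) \<partial>P \<mu>)"
    by (rule Fubini_P[OF \<mu>, symmetric]) (unfold case_prod_beta, measurable)
  also have "\<dots> \<le> (\<integral>\<^sup>+\<omega>. indicator A \<omega> * total \<omega> \<partial>P \<mu>)"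
  proof (rule nn_integral_mono)
    fix \<omega> assume "\<omega> \<in> space (P \<mu>)"
    then have \<omega>: "\<omega> \<in> space \<Omega>" using P[OF \<mu>] by simp
    have m [measurable]: "(\<lambda>t. val t \<omega>) \<in> borel_measurable borel"
      using measurable_compose[OF measurable_Pair2'[OF \<omega>] val_measurable] by simp
    \<comment> \<open>An equality for t \<ge> 0, while the left side vanishes for t < 0. After the
      shift by s this discards what \<open>total\<close> accrues before time s, whence the
      inequality.\<close>
    have e: "?e * weight t \<le> weight (s + t)" for t
    proof (cases "0 \<le> t")
      case True
      then have "?e * weight t = ennreal (exp (- \<beta> * s) * (\<beta> * exp (- \<beta> * t)))"
        unfolding weight_def using \<beta> by (simp add: ennreal_mult)
      also have "exp (- \<beta> * s) * (\<beta> * exp (- \<beta> * t)) = \<beta> * exp (- \<beta> * (s + t))"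
        by (simp add: exp_add[symmetric] algebra_simps)
      finally show ?thesis unfolding weight_def using True s by simp
    qed (simp add: weight_def)
    have "(\<integral>\<^sup>+t. (?e * weight t) * (indicator A \<omega> * val (s + t) \<omega>) \<partial>lborel)
        \<le> (\<integral>\<^sup>+t. weight (s + t) * (indicator A \<omega> * val (s + t) \<omega>) \<partial>lborel)"
      by (intro nn_integral_mono mult_right_mono e) simp
    also have "\<dots> = (\<integral>\<^sup>+t. weight t * (indicator A \<omega> * val t \<omega>) \<partial>lborel)"
      using nn_integral_real_affine[of "\<lambda>t. weight t * (indicator A \<omega> * val t \<omega>)" 1 s] by simp
    also have "\<dots> = indicator A \<omega> * total \<omega>"
      unfolding total_def by (subst nn_integral_cmult[symmetric]) (auto simp: mult_ac)
    finally show "(\<integral>\<^sup>+t. (?e * weight t) * (indicator A \<omega> * val (s + t) \<omega>) \<partial>lborel) \<le> indicator A \<omega> * total \<omega>" .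
  qed
  finally show ?thesis .
qed

lemma pot_level_sets: "{\<mu> \<in> S. a \<le> pot \<mu>} \<in> sets N"
proof -
  have "{\<mu> \<in> space N\<^sub>S. a \<le> pot \<mu>} \<in> sets N\<^sub>S" using pot_measurable by measurable
  moreover have "S \<inter> space N \<in> sets N" using S by (simp add: Int_absorb2 S_subset)
  ultimately show ?thesis unfolding space_N_S by (simp add: sets_restrict_space_iff)
qed

text \<open>Doob's maximal inequality, by decomposing the event according to the first passage.\<close>

lemma maximal_inequality:
  assumes \<mu>: "\<mu> \<in> S" and F: "finite F" "F \<subseteq> {0..T}"
  shows "a * ennreal (exp (- \<beta> * T)) * emeasure (P \<mu>) {\<omega> \<in> space \<Omega>. \<exists>t\<in>F. a \<le> pot (X t \<omega>)} \<le> pot \<mu>"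
proof -
  define H where "H t = {\<omega> \<in> space \<Omega>. X t \<omega> \<in> {\<mu> \<in> S. a \<le> pot \<mu>}}" for t
  define A where "A t = H t - (\<Union>s\<in>F \<inter> {..<t}. H s)" for t
  have H: "H s \<in> sets (past t)" if "0 \<le> s" "s \<le> t" for s t
    unfolding H_def using that pot_level_sets by (intro past_vimage)
  have A: "A t \<in> sets (past t)" if "t \<in> F" for t
    unfolding A_def using that F H by (intro sets.Diff sets.finite_UN) auto
  have A': "A t \<in> sets (P \<mu>)" "A t \<in> sets \<Omega>" if "t \<in> F" for t
    using A[OF that] past_subalgebra[OF \<mu>] P(1)[OF \<mu>] unfolding subalgebra_def by auto
  have disj: "disjoint_family_on A F"
    unfolding disjoint_family_on_def
  proof (intro ballI impI)
    fix s t assume st: "s \<in> F" "t \<in> F" "s \<noteq> t"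
    show "A s \<inter> A t = {}"
    proof (cases "s < t")
      case True then show ?thesis using st unfolding A_def by auto
    next
      case False
      then have "t < s" using st by simp
      then show ?thesis using st unfolding A_def by auto
    qed
  qed
  have "{\<omega> \<in> space \<Omega>. \<exists>t\<in>F. a \<le> pot (X t \<omega>)} = (\<Union>t\<in>F. A t)"
  proof (intro equalityI subsetI)
    fix \<omega> assume "\<omega> \<in> {\<omega> \<in> space \<Omega>. \<exists>t\<in>F. a \<le> pot (X t \<omega>)}"
    then obtain t where t: "t \<in> F" "\<omega> \<in> H t"
      unfolding H_def using X_in F(2) by force
    define G where "G = {t \<in> F. \<omega> \<in> H t}"
    have "finite G" "G \<noteq> {}" using F(1) t unfolding G_def by auto
    then have "Min G \<in> G" "\<And>s. s \<in> G \<Longrightarrow> Min G \<le> s" by simp_all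
    then have "\<omega> \<in> A (Min G)" unfolding A_def G_def by force
    then show "\<omega> \<in> (\<Union>t\<in>F. A t)" using \<open>Min G \<in> G\<close> unfolding G_def by blast
  qed (auto simp: A_def H_def)
  then have "emeasure (P \<mu>) {\<omega> \<in> space \<Omega>. \<exists>t\<in>F. a \<le> pot (X t \<omega>)} = (\<Sum>t\<in>F. emeasure (P \<mu>) (A t))"
    using A' disj F(1) by (subst sum_emeasure) auto
  then have "a * ennreal (exp (- \<beta> * T)) * emeasure (P \<mu>) {\<omega> \<in> space \<Omega>. \<exists>t\<in>F. a \<le> pot (X t \<omega>)}
      = (\<Sum>t\<in>F. a * ennreal (exp (- \<beta> * T)) * emeasure (P \<mu>) (A t))"
    by (simp add: sum_distrib_left)
  also have "\<dots> \<le> (\<Sum>t\<in>F. \<integral>\<^sup>+\<omega>. indicator (A t) \<omega> * total \<omega> \<partial>P \<mu>)"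
  proof (rule sum_mono)
    fix t assume t: "t \<in> F"
    then have t0: "0 \<le> t" "t \<le> T" using F(2) by auto
    have "a * ennreal (exp (- \<beta> * T)) * emeasure (P \<mu>) (A t) = (\<integral>\<^sup>+\<omega>. (a * ennreal (exp (- \<beta> * T))) * indicator (A t) \<omega> \<partial>P \<mu>)"
      using A'[OF t] by (subst nn_integral_cmult_indicator) auto
    also have "\<dots> \<le> (\<integral>\<^sup>+\<omega>. indicator (A t) \<omega> * (ennreal (exp (- \<beta> * t)) * pot (X t \<omega>)) \<partial>P \<mu>)"
    proof (rule nn_integral_mono)
      fix \<omega>
      have "ennreal (exp (- \<beta> * T)) \<le> ennreal (exp (- \<beta> * t))" using t0 \<beta> by (intro ennreal_leI) simp
      then have "a * ennreal (exp (- \<beta> * T)) \<le> ennreal (exp (- \<beta> * t)) * pot (X t \<omega>)" if "\<omega> \<in> A t"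
        using that unfolding A_def H_def by (subst mult.commute) (intro mult_mono, auto)
      then show "(a * ennreal (exp (- \<beta> * T))) * indicator (A t) \<omega> \<le> indicator (A t) \<omega> * (ennreal (exp (- \<beta> * t)) * pot (X t \<omega>))"
        by (auto split: split_indicator)
    qed
    also have "\<dots> \<le> (\<integral>\<^sup>+\<omega>. indicator (A t) \<omega> * total \<omega> \<partial>P \<mu>)"
      by (rule discounted_pot_le[OF \<mu> t0(1) A[OF t]])
    finally show "a * ennreal (exp (- \<beta> * T)) * emeasure (P \<mu>) (A t) \<le> (\<integral>\<^sup>+\<omega>. indicator (A t) \<omega> * total \<omega> \<partial>P \<mu>)" .
  qed
  also have "\<dots> = (\<integral>\<^sup>+\<omega>. (\<Sum>t\<in>F. indicator (A t) \<omega> * total \<omega>) \<partial>P \<mu>)"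
    using A' total_measurable P(1)[OF \<mu>]
    by (intro nn_integral_sum[symmetric] borel_measurable_times_ennreal) (auto cong: measurable_cong_sets)
  also have "\<dots> \<le> (\<integral>\<^sup>+\<omega>. total \<omega> \<partial>P \<mu>)"
  proof (rule nn_integral_mono)
    fix \<omega>
    have "(\<Sum>t\<in>F. indicator (A t) \<omega> * total \<omega>) = indicator (\<Union>t\<in>F. A t) \<omega> * total \<omega>"
      by (simp add: indicator_UN_disjoint[OF F(1) disj] sum_distrib_right)
    also have "\<dots> \<le> total \<omega>" by (auto split: split_indicator)
    finally show "(\<Sum>t\<in>F. indicator (A t) \<omega> * total \<omega>) \<le> total \<omega>" .
  qed
  also have "\<dots> = pot \<mu>" by (rule expected_total[OF \<mu>])
  finally show ?thesis .
qed

text \<open>The bound on k makes the Bochner integrals in \<open>resolvent\<close> genuine rather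
  than the default 0, so that they agree with the nonnegative integrals used so far.\<close>

lemma pot_eq_resolvent:
  assumes \<mu>: "\<mu> \<in> S" and bound: "\<And>\<mu>. \<mu> \<in> M \<Longrightarrow> k \<mu> \<le> c"
  shows "pot \<mu> = ennreal (\<beta> * resolvent S X P \<beta> k \<mu>)"
    and "0 \<le> resolvent S X P \<beta> k \<mu>" "\<beta> * resolvent S X P \<beta> k \<mu> \<le> c"
proof -
  interpret prob_space "P \<mu>" by (rule P(3)[OF \<mu>])
  have kX: "0 \<le> k (X t \<omega>)" "k (X t \<omega>) \<le> c" if "0 \<le> t" "\<omega> \<in> space (P \<mu>)" for t \<omega>
    using X_in[OF that(1), of \<omega>] S_subset k_nonneg bound that(2) P(2)[OF \<mu>] by auto
  define U where "U t = (\<integral>\<omega>. k (X t \<omega>) \<partial>P \<mu>)" for t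
  have U: "(\<integral>\<^sup>+\<omega>. val t \<omega> \<partial>P \<mu>) = ennreal (U t)" "0 \<le> U t" "U t \<le> c" if t: "0 \<le> t" for t
  proof -
    have "(\<lambda>\<omega>. k (X t \<omega>)) \<in> borel_measurable (P \<mu>)"
      using measurable_compose[OF X_measurable[OF t] k_measurable] P(1)[OF \<mu>] by (simp cong: measurable_cong_sets)
    then have int: "integrable (P \<mu>) (\<lambda>\<omega>. k (X t \<omega>))"
      using kX[OF t] by (intro integrable_const_bound[of _ c]) auto
    then show "(\<integral>\<^sup>+\<omega>. val t \<omega> \<partial>P \<mu>) = ennreal (U t)"
      unfolding val_def U_def using t kX[OF t] by (simp add: nn_integral_eq_integral)
    show "0 \<le> U t" unfolding U_def using kX[OF t] by (intro Bochner_Integration.integral_nonneg_AE) auto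
    show "U t \<le> c" unfolding U_def using kX[OF t] int by (intro integral_le_const) auto
  qed
  have "(\<lambda>t. \<integral>\<^sup>+\<omega>. val t \<omega> \<partial>P \<mu>) \<in> borel_measurable borel"
    using measurable_compose[OF measurable_Pair2'[of \<mu> "N\<^sub>S"] expected_val_measurable] \<mu> space_N_S by simp
  then have [measurable]: "(\<lambda>t. enn2real (\<integral>\<^sup>+\<omega>. val t \<omega> \<partial>P \<mu>)) \<in> borel_measurable borel" by measurable
  have U_meas: "(\<lambda>t. indicator {0..} t * (exp (- \<beta> * t) * U t)) \<in> borel_measurable borel"
  proof -
    have "(\<lambda>t. indicator {0..} t * (exp (- \<beta> * t) * enn2real (\<integral>\<^sup>+\<omega>. val t \<omega> \<partial>P \<mu>))) \<in> borel_measurable borel"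
      by measurable
    moreover have "indicator {0..} t * (exp (- \<beta> * t) * enn2real (\<integral>\<^sup>+\<omega>. val t \<omega> \<partial>P \<mu>))
        = indicator {0..} t * (exp (- \<beta> * t) * U t)" for t
      using U[of t] by (cases "0 \<le> t") auto
    ultimately show ?thesis by (simp only:)
  qed
  have c: "0 \<le> c" using U(2,3)[of 0] by simp
  note exp_int = exp_atLeast[OF \<beta>, of 0, unfolded set_integrable_def set_lebesgue_integral_def]
  have dom: "integrable lborel (\<lambda>t. indicator {0..} t * (exp (- \<beta> * t) * c))"
    using integrable_mult_left[OF exp_int(1), of c] by (simp add: mult_ac)
  have int: "integrable lborel (\<lambda>t. indicator {0..} t * (exp (- \<beta> * t) * U t))"
  proof (rule Bochner_Integration.integrable_bound[OF dom])
    show "AE t in lborel. norm (indicator {0..} t * (exp (- \<beta> * t) * U t)) \<le> norm (indicator {0..} t * (exp (- \<beta> * t) * c))"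
      using U(2,3) c by (auto simp: abs_mult split: split_indicator)
  qed (use U_meas in simp)
  have res: "resolvent S X P \<beta> k \<mu> = (\<integral>t. indicator {0..} t * (exp (- \<beta> * t) * U t) \<partial>lborel)"
    unfolding resolvent_def U_def set_lebesgue_integral_def using \<mu> by simp
  show nn: "0 \<le> resolvent S X P \<beta> k \<mu>"
    unfolding res using U(2) by (intro Bochner_Integration.integral_nonneg) (auto split: split_indicator)
  have "resolvent S X P \<beta> k \<mu> \<le> (\<integral>t. indicator {0..} t * (exp (- \<beta> * t) * c) \<partial>lborel)"
    unfolding res using U(3) by (intro integral_mono[OF int dom]) (auto split: split_indicator)
  also have "\<dots> = c / \<beta>"
    using exp_int(2) integral_mult_left_zero[of lborel "\<lambda>t. indicator {0..} t * exp (- \<beta> * t)" c] by (simp add: mult_ac)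
  finally show "\<beta> * resolvent S X P \<beta> k \<mu> \<le> c" using \<beta> by (simp add: pos_le_divide_eq mult.commute)
  have "pot \<mu> = (\<integral>\<^sup>+t. ennreal \<beta> * ennreal (indicator {0..} t * (exp (- \<beta> * t) * U t)) \<partial>lborel)"
    unfolding pot_def
  proof (rule nn_integral_cong)
    fix t :: real
    show "weight t * (\<integral>\<^sup>+\<omega>. val t \<omega> \<partial>P \<mu>) = ennreal \<beta> * ennreal (indicator {0..} t * (exp (- \<beta> * t) * U t))"
      using U[of t] \<beta> by (cases "0 \<le> t") (auto simp: weight_def ennreal_mult mult.assoc)
  qed
  also have "\<dots> = ennreal \<beta> * (\<integral>\<^sup>+t. ennreal (indicator {0..} t * (exp (- \<beta> * t) * U t)) \<partial>lborel)"
    by (rule nn_integral_cmult) (rule measurable_compose[OF borel_measurable_integrable[OF int] measurable_ennreal])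
  also have "(\<integral>\<^sup>+t. ennreal (indicator {0..} t * (exp (- \<beta> * t) * U t)) \<partial>lborel) = ennreal (resolvent S X P \<beta> k \<mu>)"
    unfolding res using int U(2) by (intro nn_integral_eq_integral) (auto split: split_indicator)
  finally show "pot \<mu> = ennreal (\<beta> * resolvent S X P \<beta> k \<mu>)"
    using \<beta> nn by (simp add: ennreal_mult)
qed

end

section \<open>Randomized starting points, exit times, and escape from the region where k is
  small\<close>

context cadlag_markov
begin

lemma start_from:
  assumes m: "sets m = sets N" "prob_space m" "emeasure m S = 1"
  shows "prob_space (start_from S m P)" "sets (start_from S m P) = sets \<Omega>"
    and "B \<in> sets \<Omega> \<Longrightarrow> emeasure (start_from S m P) B = (\<integral>\<^sup>+\<mu>. emeasure (P \<mu>) B * indicator S \<mu> \<partial>m)"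
proof -
  interpret prob_space m by fact
  have S': "S \<in> sets m" using S m by simp
  have r: "restrict_space m S \<in> space (prob_algebra N\<^sub>S)"
    unfolding space_prob_algebra using prob_space_restrict_space[OF S' m(3)] m(1)
    by (simp add: sets_restrict_space_cong[OF m(1)])
  note K = P_kernel
  show "prob_space (start_from S m P)"
    unfolding start_from_def by (rule prob_space_bind'[OF r K])
  show "sets (start_from S m P) = sets \<Omega>"
    unfolding start_from_def by (rule sets_bind'[OF r K])
  show "emeasure (start_from S m P) B = (\<integral>\<^sup>+\<mu>. emeasure (P \<mu>) B * indicator S \<mu> \<partial>m)" if "B \<in> sets \<Omega>"
    unfolding start_from_def emeasure_bind_prob_algebra[OF r K that]
    using S' sets.Int_space_eq2[OF S'] by (intro nn_integral_restrict_space) simp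
qed

lemma sets_leave:
  assumes "finite F" "F \<subseteq> {0..}" "G \<in> sets N"
  shows "{\<omega> \<in> space \<Omega>. \<exists>t\<in>F. X t \<omega> \<notin> G} \<in> sets \<Omega>"
proof (rule sets.sets_Collect_finite_Ex[OF _ assms(1)])
  fix t assume "t \<in> F"
  then have "X t -` G \<inter> space \<Omega> \<in> sets \<Omega>" using measurable_sets[OF X_measurable assms(3)] assms(2) by auto
  moreover have "{\<omega> \<in> space \<Omega>. X t \<omega> \<notin> G} = space \<Omega> - (X t -` G \<inter> space \<Omega>)" by blast
  ultimately show "{\<omega> \<in> space \<Omega>. X t \<omega> \<notin> G} \<in> sets \<Omega>" by auto
qed

text \<open>If the path is outside G at some time in F, the exit time is at most T and the discount
  at least exp (- \<beta> T). F avoids time 0, because \<open>exit_time\<close> looks at strictly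
  positive times only. The comparison goes through although the exit time may be
  non-measurable.\<close>

lemma expected_discount_ge:
  assumes Q: "sets Q = sets \<Omega>" and F: "finite F" "F \<subseteq> {0<..T}" and G: "G \<in> sets N" and "0 < \<beta>"
  shows "ennreal (exp (- \<beta> * T)) * emeasure Q {\<omega> \<in> space \<Omega>. \<exists>t\<in>F. X t \<omega> \<notin> G} \<le> expected_discount Q \<beta> (exit_time X G)"
proof -
  let ?B = "{\<omega> \<in> space \<Omega>. \<exists>t\<in>F. X t \<omega> \<notin> G}"
  have "F \<subseteq> {0..}" using F(2) by auto
  then have B: "?B \<in> sets Q" using sets_leave[OF F(1) _ G] Q by simp
  have "ennreal (exp (- \<beta> * T)) * emeasure Q ?B = (\<integral>\<^sup>+\<omega>. ennreal (exp (- \<beta> * T)) * indicator ?B \<omega> \<partial>Q)"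
    using B by (simp add: nn_integral_cmult_indicator)
  also have "\<dots> \<le> expected_discount Q \<beta> (exit_time X G)"
    unfolding expected_discount_def
  proof (rule nn_integral_mono)
    fix \<omega>
    show "ennreal (exp (- \<beta> * T)) * indicator ?B \<omega>
        \<le> (if exit_time X G \<omega> = \<infinity> then 0 else ennreal (exp (- \<beta> * real_of_ereal (exit_time X G \<omega>))))"
    proof (cases "\<omega> \<in> ?B")
      case True
      then obtain t where t: "t \<in> F" "X t \<omega> \<notin> G" by blast
      have "exit_time X G \<omega> \<le> ereal t"
        unfolding exit_time_def using t F(2) by (intro Inf_lower) auto
      also have "ereal t \<le> ereal T" using t(1) F(2) by auto
      finally have le: "exit_time X G \<omega> \<le> ereal T" .
      have "0 \<le> exit_time X G \<omega>"
        unfolding exit_time_def by (rule Inf_greatest) auto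
      then obtain r where r: "exit_time X G \<omega> = ereal r" "r \<le> T"
        using le by (cases "exit_time X G \<omega>") auto
      then have "exp (- \<beta> * T) \<le> exp (- \<beta> * r)" using \<open>0 < \<beta>\<close> by simp
      then show ?thesis using r(1) by (auto intro!: ennreal_leI split: split_indicator)
    qed simp
  qed
  finally show ?thesis .
qed

end

context markov_potential
begin

lemma nn_integral_weight: "(\<integral>\<^sup>+t. weight t \<partial>lborel) = 1"
proof -
  have "(\<integral>\<^sup>+t. weight t \<partial>lborel) = (\<integral>\<^sup>+t. ennreal \<beta> * (ennreal (exp (- \<beta> * t)) * indicator {0..} t) \<partial>lborel)"
    unfolding weight_def using \<beta> by (intro nn_integral_cong) (simp add: ennreal_mult mult.assoc)
  also have "\<dots> = ennreal \<beta> * ennreal (1 / \<beta>)"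
    using nn_integral_exp_atLeast[OF \<beta>, of 0] by (subst nn_integral_cmult) auto
  also have "\<dots> = 1" using \<beta> by (simp flip: ennreal_mult)
  finally show ?thesis .
qed

text \<open>By Fubini the potential averages over time the integrals I of the single times, against
  a weight of total mass 1.\<close>

lemma nn_integral_pot_invariant:
  assumes \<nu>: "sets \<nu> = sets N" "prob_space \<nu>"
    and inv: "\<And>t. 0 \<le> t \<Longrightarrow> (\<integral>\<^sup>+\<mu>. (\<integral>\<^sup>+y. ennreal (k y) \<partial>p t \<mu>) * indicator S \<mu> \<partial>\<nu>) = I"
  shows "(\<integral>\<^sup>+\<mu>. pot \<mu> * indicator S \<mu> \<partial>\<nu>) = I"
proof -
  interpret prob_space \<nu> by fact
  have S': "S \<in> sets \<nu>" using S \<nu> by simp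
  let ?R = "restrict_space \<nu> S"
  have R: "sets ?R = sets N\<^sub>S" using \<nu>(1) by (rule sets_restrict_space_cong)
  have res: "(\<integral>\<^sup>+\<mu>. f \<mu> * indicator S \<mu> \<partial>\<nu>) = (\<integral>\<^sup>+\<mu>. f \<mu> \<partial>?R)" for f
    using S' sets.Int_space_eq2[OF S'] by (intro nn_integral_restrict_space[symmetric]) simp
  have fin: "finite_measure ?R" by (rule finite_measure_restrict_space[OF _ ]) (use S' finite_measure_axioms in auto)
  interpret R: finite_measure ?R by (rule fin)
  interpret pair_sigma_finite lborel ?R ..
  have meas: "(\<lambda>(t, \<mu>). \<integral>\<^sup>+\<omega>. val t \<omega> \<partial>P \<mu>) \<in> borel_measurable (lborel \<Otimes>\<^sub>M ?R)"
    using expected_val_measurable R by (simp cong: measurable_cong_sets sets_pair_measure_cong)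
  have "(\<integral>\<^sup>+\<mu>. pot \<mu> \<partial>?R) = (\<integral>\<^sup>+t. (\<integral>\<^sup>+\<mu>. weight t * (\<integral>\<^sup>+\<omega>. val t \<omega> \<partial>P \<mu>) \<partial>?R) \<partial>lborel)"
    unfolding pot_def
    by (rule Fubini') (use meas in \<open>unfold case_prod_beta, measurable\<close>)
  also have "\<dots> = (\<integral>\<^sup>+t. weight t * I \<partial>lborel)"
  proof (rule nn_integral_cong)
    fix t :: real
    show "(\<integral>\<^sup>+\<mu>. weight t * (\<integral>\<^sup>+\<omega>. val t \<omega> \<partial>P \<mu>) \<partial>?R) = weight t * I"
    proof (cases "0 \<le> t")
      case True
      have "(\<lambda>\<mu>. \<integral>\<^sup>+\<omega>. val t \<omega> \<partial>P \<mu>) \<in> borel_measurable ?R"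
        using measurable_compose[OF measurable_Pair1' meas, of t] by simp
      then have "(\<integral>\<^sup>+\<mu>. weight t * (\<integral>\<^sup>+\<omega>. val t \<omega> \<partial>P \<mu>) \<partial>?R) = weight t * (\<integral>\<^sup>+\<mu>. (\<integral>\<^sup>+\<omega>. val t \<omega> \<partial>P \<mu>) \<partial>?R)"
        by (rule nn_integral_cmult)
      also have "(\<integral>\<^sup>+\<mu>. (\<integral>\<^sup>+\<omega>. val t \<omega> \<partial>P \<mu>) \<partial>?R) = (\<integral>\<^sup>+\<mu>. (\<integral>\<^sup>+y. ennreal (k y) \<partial>p t \<mu>) \<partial>?R)"
        using expected_val[OF _ True] by (intro nn_integral_cong) (simp add: space_restrict_space)
      also have "\<dots> = I" using inv[OF True] res by simp
      finally show ?thesis .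
    qed (simp add: weight_def)
  qed
  also have "\<dots> = I" using nn_integral_weight by (simp add: nn_integral_multc)
  finally show ?thesis using res by simp
qed

text \<open>The bound C on the density replaces the starting law by the measure \<nu>, against which
  the potential can be integrated by invariance.\<close>

lemma mixture_maximal_inequality:
  assumes \<nu>: "sets \<nu> = sets N" and \<psi>: "\<psi> \<in> borel_measurable \<nu>" "AE \<mu> in \<nu>. \<psi> \<mu> \<le> C"
    and m: "prob_space (density \<nu> (\<lambda>\<mu>. ennreal (\<psi> \<mu>)))" "emeasure (density \<nu> (\<lambda>\<mu>. ennreal (\<psi> \<mu>))) S = 1"
    and F: "finite F" "F \<subseteq> {0..T}"
  shows "a * ennreal (exp (- \<beta> * T)) * emeasure (start_from S (density \<nu> (\<lambda>\<mu>. ennreal (\<psi> \<mu>))) P)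
      {\<omega> \<in> space \<Omega>. \<exists>t\<in>F. a \<le> pot (X t \<omega>)} \<le> ennreal C * (\<integral>\<^sup>+\<mu>. pot \<mu> * indicator S \<mu> \<partial>\<nu>)"
proof -
  let ?m = "density \<nu> (\<lambda>\<mu>. ennreal (\<psi> \<mu>))" and ?B = "{\<omega> \<in> space \<Omega>. \<exists>t\<in>F. a \<le> pot (X t \<omega>)}"
  let ?e = "a * ennreal (exp (- \<beta> * T))"
  have B: "?B \<in> sets \<Omega>"
  proof -
    have "{\<omega> \<in> space \<Omega>. a \<le> pot (X t \<omega>)} \<in> sets \<Omega>" if "t \<in> F" for t
    proof -
      have "0 \<le> t" using that F(2) by auto
      from measurable_compose[OF X_measurable_S[OF this] pot_measurable] show ?thesis by measurable
    qed
    then show ?thesis using F(1) by (intro sets.sets_Collect_finite_Ex)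
  qed
  have meas: "(\<lambda>\<mu>. f \<mu> * indicator S \<mu>) \<in> borel_measurable \<nu>" if "f \<in> borel_measurable N\<^sub>S" for f :: "'e \<Rightarrow> ennreal"
    using that S \<nu> by (subst (asm) borel_measurable_restrict_space_iff_ennreal)
      (auto simp: Int_absorb2 S_subset cong: measurable_cong_sets)
  have emeas: "(\<lambda>\<mu>. emeasure (P \<mu>) ?B * indicator S \<mu>) \<in> borel_measurable \<nu>"
    by (intro meas measurable_compose[OF measurable_prob_algebraD[OF P_kernel] measurable_emeasure_subprob_algebra[OF B]])
  have "?e * emeasure (start_from S ?m P) ?B = ?e * (\<integral>\<^sup>+\<mu>. emeasure (P \<mu>) ?B * indicator S \<mu> \<partial>?m)"
    using start_from(3)[OF _ m B] \<nu> by simp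
  also have "\<dots> = (\<integral>\<^sup>+\<mu>. ?e * (emeasure (P \<mu>) ?B * indicator S \<mu>) \<partial>?m)"
    using emeas by (intro nn_integral_cmult[symmetric]) simp
  also have "\<dots> \<le> (\<integral>\<^sup>+\<mu>. pot \<mu> * indicator S \<mu> \<partial>?m)"
  proof (rule nn_integral_mono)
    fix \<mu>
    show "?e * (emeasure (P \<mu>) ?B * indicator S \<mu>) \<le> pot \<mu> * indicator S \<mu>"
      using maximal_inequality[of \<mu> F T a] F by (auto split: split_indicator simp: mult.assoc)
  qed
  also have "\<dots> = (\<integral>\<^sup>+\<mu>. ennreal (\<psi> \<mu>) * (pot \<mu> * indicator S \<mu>) \<partial>\<nu>)"
    using \<psi>(1) meas[OF pot_measurable] by (intro nn_integral_density) auto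
  also have "\<dots> \<le> (\<integral>\<^sup>+\<mu>. ennreal C * (pot \<mu> * indicator S \<mu>) \<partial>\<nu>)"
    using \<psi>(2) by (intro nn_integral_mono_AE) (auto intro!: mult_right_mono ennreal_leI elim!: eventually_mono)
  also have "\<dots> = ennreal C * (\<integral>\<^sup>+\<mu>. pot \<mu> * indicator S \<mu> \<partial>\<nu>)"
    by (rule nn_integral_cmult[OF meas[OF pot_measurable]])
  finally show ?thesis .
qed

text \<open>Along the path, \<open>k\<close> can be large only after leaving \<open>G\<close> or if the potential is large.\<close>

lemma escape_estimate:
  assumes \<nu>: "sets \<nu> = sets N" and \<psi>: "\<psi> \<in> borel_measurable \<nu>" "AE \<mu> in \<nu>. \<psi> \<mu> \<le> C" "0 \<le> C"
    and m: "prob_space (density \<nu> (\<lambda>\<mu>. ennreal (\<psi> \<mu>)))" "emeasure (density \<nu> (\<lambda>\<mu>. ennreal (\<psi> \<mu>))) S = 1"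
    and Q: "Q = start_from S (density \<nu> (\<lambda>\<mu>. ennreal (\<psi> \<mu>))) P"
    and pot: "(\<integral>\<^sup>+\<mu>. pot \<mu> * indicator S \<mu> \<partial>\<nu>) = ennreal I" "0 \<le> I"
    and G: "G \<in> sets N" "\<And>\<mu>. \<mu> \<in> G \<Longrightarrow> \<mu> \<in> S \<Longrightarrow> ennreal (k \<mu>) \<le> pot \<mu> + ennreal \<eta>"
    and exit: "expected_discount Q \<beta> (exit_time X G) \<le> ennreal \<epsilon>"
    and "0 < a" "0 \<le> \<eta>" "0 \<le> \<epsilon>" "0 \<le> T"
  obtains R where "R \<in> sets \<Omega>" "measure Q R \<le> exp (\<beta> * T) * (\<epsilon> + C * I / a)"
    "\<And>\<omega> t. \<omega> \<in> space \<Omega> - R \<Longrightarrow> 0 \<le> t \<Longrightarrow> t < T \<Longrightarrow> k (X t \<omega>) \<le> a + \<eta>"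
proof -
  have Q': "prob_space Q" "sets Q = sets \<Omega>" unfolding Q using start_from(1,2)[OF _ m] \<nu> by simp_all
  interpret Q: prob_space Q by (rule Q'(1))
  \<comment> \<open>Countably many times suffice by right-continuity. Time 0 is left out because the
    exit time ignores it; it is recovered from the times just after it.\<close>
  define J where "J = \<rat> \<inter> {0<..<T}"
  define R where "R F = {\<omega> \<in> space \<Omega>. \<exists>t\<in>F. a + \<eta> < k (X t \<omega>)}" for F
  have kX: "(\<lambda>\<omega>. k (X t \<omega>)) \<in> borel_measurable \<Omega>" if "0 \<le> t" for t
    by (rule measurable_compose[OF X_measurable[OF that] k_measurable])
  have R1: "{\<omega> \<in> space \<Omega>. a + \<eta> < k (X t \<omega>)} \<in> sets \<Omega>" if "0 \<le> t" for t
    using kX[OF that] by measurable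
  have R_sets: "R F \<in> sets \<Omega>" if "countable F" "F \<subseteq> {0..}" for F
    unfolding R_def by (rule sets.sets_Collect_countable_Ex') (use R1 that in auto)
  have fin: "measure Q (R F) \<le> exp (\<beta> * T) * (\<epsilon> + C * I / a)" if F: "finite F" "F \<subseteq> J" for F
  proof -
    have F': "F \<subseteq> {0<..T}" "F \<subseteq> {0..T}" using F(2) unfolding J_def by auto
    have one: "exp (\<beta> * T) * exp (- \<beta> * T) = 1" by (simp flip: exp_add)
    let ?B1 = "{\<omega> \<in> space \<Omega>. \<exists>t\<in>F. X t \<omega> \<notin> G}" and ?B2 = "{\<omega> \<in> space \<Omega>. \<exists>t\<in>F. ennreal a \<le> pot (X t \<omega>)}"
    have "F \<subseteq> {0..}" using F'(1) by auto
    then have B1: "?B1 \<in> sets \<Omega>" using sets_leave[OF F(1) _ G(1)] by simp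
    have B2: "?B2 \<in> sets \<Omega>"
    proof (rule sets.sets_Collect_finite_Ex[OF _ F(1)])
      fix t assume "t \<in> F"
      then have "0 \<le> t" using F'(2) by auto
      from measurable_compose[OF X_measurable_S[OF this] pot_measurable]
      show "{\<omega> \<in> space \<Omega>. ennreal a \<le> pot (X t \<omega>)} \<in> sets \<Omega>" by measurable
    qed
    have "R F \<subseteq> ?B1 \<union> ?B2"
    proof
      fix \<omega> assume "\<omega> \<in> R F"
      then obtain t where t: "\<omega> \<in> space \<Omega>" "t \<in> F" "a + \<eta> < k (X t \<omega>)" unfolding R_def by blast
      show "\<omega> \<in> ?B1 \<union> ?B2"
      proof (rule ccontr)
        assume "\<omega> \<notin> ?B1 \<union> ?B2"
        then have "X t \<omega> \<in> G" "pot (X t \<omega>) < ennreal a" using t by (auto simp: not_le)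
        have "0 \<le> t" using t(2) F'(2) by auto
        then have "ennreal (k (X t \<omega>)) \<le> pot (X t \<omega>) + ennreal \<eta>" using G(2) X_in t(1) \<open>X t \<omega> \<in> G\<close> by blast
        also have "\<dots> \<le> ennreal a + ennreal \<eta>" using \<open>pot (X t \<omega>) < ennreal a\<close> by (intro add_right_mono) simp
        also have "\<dots> = ennreal (a + \<eta>)" using \<open>0 < a\<close> \<open>0 \<le> \<eta>\<close> by simp
        finally have "k (X t \<omega>) \<le> a + \<eta>" using \<open>0 < a\<close> \<open>0 \<le> \<eta>\<close> by (subst (asm) ennreal_le_iff) auto
        then show False using t(3) by simp
      qed
    qed
    then have "measure Q (R F) \<le> measure Q (?B1 \<union> ?B2)" using B1 B2 Q'(2) by (intro Q.finite_measure_mono) auto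
    also have "\<dots> \<le> measure Q ?B1 + measure Q ?B2"
      using B1 B2 Q'(2) by (intro measure_Un_le) auto
    also have "measure Q ?B1 \<le> exp (\<beta> * T) * \<epsilon>"
    proof -
      have "ennreal (exp (- \<beta> * T)) * emeasure Q ?B1 \<le> ennreal \<epsilon>"
        using expected_discount_ge[OF Q'(2) F(1) F'(1) G(1) \<beta>] exit by (rule order_trans)
      then have "exp (- \<beta> * T) * measure Q ?B1 \<le> \<epsilon>"
        using \<open>0 \<le> \<epsilon>\<close> by (simp add: Q.emeasure_eq_measure flip: ennreal_mult)
      then have "exp (\<beta> * T) * (exp (- \<beta> * T) * measure Q ?B1) \<le> exp (\<beta> * T) * \<epsilon>" by (rule mult_left_mono) simp
      then show ?thesis by (simp only: mult.assoc[symmetric] one mult_1)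
    qed
    also have "measure Q ?B2 \<le> exp (\<beta> * T) * (C * I / a)"
    proof -
      have "ennreal a * ennreal (exp (- \<beta> * T)) * emeasure Q ?B2 \<le> ennreal C * ennreal I"
        unfolding Q pot(1)[symmetric] by (rule mixture_maximal_inequality[OF \<nu> \<psi>(1,2) m F(1) F'(2)])
      then have "a * exp (- \<beta> * T) * measure Q ?B2 \<le> C * I"
        using \<open>0 < a\<close> \<psi>(3) pot(2) by (simp add: Q.emeasure_eq_measure flip: ennreal_mult)
      then have "(exp (\<beta> * T) / a) * (a * exp (- \<beta> * T) * measure Q ?B2) \<le> (exp (\<beta> * T) / a) * (C * I)"
        using \<open>0 < a\<close> by (intro mult_left_mono) auto
      moreover have "(exp (\<beta> * T) / a) * (a * exp (- \<beta> * T) * measure Q ?B2)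
          = (exp (\<beta> * T) * exp (- \<beta> * T)) * measure Q ?B2"
        using \<open>0 < a\<close> by simp
      ultimately show ?thesis by (simp add: exp_minus_inverse)
    qed
    finally show ?thesis by (simp add: distrib_left)
  qed
  have J: "countable J" "J \<subseteq> {0..}" unfolding J_def by (auto simp: countable_rat intro: countable_subset[of _ \<rat>])
  show thesis
  proof (rule that[of "R J"])
    show "R J \<in> sets \<Omega>" by (rule R_sets[OF J])
    show "measure Q (R J) \<le> exp (\<beta> * T) * (\<epsilon> + C * I / a)"
    proof (cases "J = {}")
      case True
      then show ?thesis using fin[of J] by simp
    next
      case False
      define q where "q = from_nat_into J"
      have q: "range q = J" unfolding q_def using False J(1) by (rule range_from_nat_into)
      \<comment> \<open>The bound for finite sets of times does not depend on the set, so continuity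
        from below carries it over to J.\<close>
      have "(\<lambda>n. measure Q (R (q ` {..n}))) \<longlonglongrightarrow> measure Q (\<Union>n. R (q ` {..n}))"
      proof (rule Q.finite_Lim_measure_incseq)
        show "range (\<lambda>n. R (q ` {..n})) \<subseteq> sets Q"
        proof -
          have "R (q ` {..n}) \<in> sets \<Omega>" for n
            using J(2) q by (intro R_sets) auto
          then show ?thesis using Q'(2) by auto
        qed
        show "incseq (\<lambda>n. R (q ` {..n}))" unfolding incseq_def R_def by fastforce
      qed
      moreover have "(\<Union>n. R (q ` {..n})) = R J"
        unfolding q[symmetric] R_def by auto
      moreover have "measure Q (R (q ` {..n})) \<le> exp (\<beta> * T) * (\<epsilon> + C * I / a)" for n
        using q by (intro fin) auto
      ultimately show ?thesis by (auto intro: LIMSEQ_le_const2)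
    qed
  next
    \<comment> \<open>A value above a + \<eta> at t persists at a rational time slightly later,
      still below T; the strict bound t < T leaves room for it.\<close>
    fix \<omega> t assume \<omega>: "\<omega> \<in> space \<Omega> - R J" and t: "0 \<le> t" "t < T"
    show "k (X t \<omega>) \<le> a + \<eta>"
    proof (rule ccontr)
      assume "\<not> k (X t \<omega>) \<le> a + \<eta>"
      then have "\<forall>\<^sub>F s in at_right t. a + \<eta> < k (X s \<omega>)"
        using right_continuous[OF k_cont, of \<omega> t] \<omega> t by (intro order_tendstoD) auto
      then obtain b where b: "t < b" "\<And>s. t < s \<Longrightarrow> s < b \<Longrightarrow> a + \<eta> < k (X s \<omega>)"
        unfolding eventually_at_right_field by blast
      obtain s where s: "s \<in> \<rat>" "t < s" "s < min b T" using Rats_dense_in_real[of t "min b T"] b(1) t by auto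
      then have "\<omega> \<in> R J" unfolding R_def J_def using b(2)[of s] \<omega> t by auto
      then show False using \<omega> by simp
    qed
  qed
qed

end

section \<open>Weak convergence of path laws to a constant path\<close>

context Metric_space
begin

lemma const_cadlag:
  assumes "c \<in> M" shows "(\<lambda>t\<in>{0..}. c) \<in> cadlag"
  unfolding cadlag_paths_def
proof (intro CollectI conjI allI impI)
  fix t :: real
  show "limitin mtopology (\<lambda>t\<in>{0..}. c) ((\<lambda>t\<in>{0..}. c) t) (at_right t)" if "0 \<le> t"
    unfolding limitin_metric eventually_at_right_field using assms that by (auto intro: exI[of _ "t + 1"])
  show "\<exists>l. limitin mtopology (\<lambda>t\<in>{0..}. c) l (at_left t)" if "0 < t"
    unfolding limitin_metric eventually_at_left_field using assms that
    by (intro exI[of _ c]) (auto intro!: exI[of _ 0])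
qed simp

text \<open>Only continuity of f at the constant path enters. A path that stays close to c up to T
  is close to it in the Skorohod distance; the remaining event is rare, and f is bounded on
  it.\<close>

lemma tendsto_integral_const_path:
  fixes Q :: "nat \<Rightarrow> 'w measure"
  assumes f: "continuous_map (dist_topology cadlag (skorohod_dist d)) euclideanreal f"
    and bound: "\<And>x. x \<in> cadlag \<Longrightarrow> \<bar>f x\<bar> \<le> C" and c: "c \<in> M"
    and Q: "\<And>n. 1 \<le> n \<Longrightarrow> prob_space (Q n)"
    and path: "\<And>n. 1 \<le> n \<Longrightarrow> path_of (X n) \<in> Q n \<rightarrow>\<^sub>M borel_of (dist_topology cadlag (skorohod_dist d))"
    and small: "\<And>r T \<delta>. 0 < r \<Longrightarrow> 0 < T \<Longrightarrow> 0 < \<delta> \<Longrightarrow> \<forall>\<^sub>F n in sequentially. \<exists>R\<in>sets (Q n). measure (Q n) R \<le> \<delta> \<and>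
      (\<forall>\<omega>\<in>space (Q n) - R. \<forall>t. 0 \<le> t \<and> t \<le> T \<longrightarrow> d c (X n t \<omega>) \<le> r)"
  shows "(\<lambda>n. \<integral>\<omega>. f (path_of (X n) \<omega>) \<partial>Q n) \<longlonglongrightarrow> f (\<lambda>t\<in>{0..}. c)"
proof (rule tendstoI)
  let ?c = "\<lambda>t\<in>{0..}. c"
  fix e :: real assume e: "0 < e"
  note cc = const_cadlag[OF c]
  have C: "0 \<le> C" using bound[OF cc] by linarith
  have "openin (dist_topology cadlag (skorohod_dist d)) {x \<in> cadlag. f x \<in> ball (f ?c) (e/3)}"
    using f open_ball[of "f ?c" "e/3"] unfolding continuous_map_def open_openin[symmetric] topspace_dist_topology
    by blast
  then obtain \<rho> where \<rho>: "0 < \<rho>" "\<And>y. y \<in> cadlag \<Longrightarrow> skorohod_dist d ?c y < \<rho> \<Longrightarrow> dist (f ?c) (f y) < e/3"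
    unfolding openin_dist_topology using cc e by fastforce
  \<comment> \<open>Chosen so that exp (- T) \<le> \<rho> / 2, which together with the radius \<rho>
    / 3 used below stays under \<rho>; the maximum with 1 keeps T positive.\<close>
  define T where "T = max 1 (- ln (\<rho> / 2))"
  have T: "0 < T" "exp (- T) \<le> \<rho> / 2"
  proof -
    show "0 < T" unfolding T_def by simp
    have "- T \<le> ln (\<rho> / 2)" unfolding T_def by simp
    then have "exp (- T) \<le> exp (ln (\<rho> / 2))" by (simp only: exp_le_cancel_iff)
    then show "exp (- T) \<le> \<rho> / 2" using \<rho>(1) by simp
  qed
  \<comment> \<open>On the exceptional event f deviates by at most 2 C, so its contribution is at
    most e / 3; the summand 1 avoids division by 0.\<close>
  define \<delta> where "\<delta> = e / (3 * (2 * C + 1))"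
  have \<delta>: "0 < \<delta>" "2 * C * \<delta> \<le> e / 3" unfolding \<delta>_def using e C by (simp_all add: field_simps)
  have "\<forall>\<^sub>F n in sequentially. \<exists>R\<in>sets (Q n). measure (Q n) R \<le> \<delta> \<and>
      (\<forall>\<omega>\<in>space (Q n) - R. \<forall>t. 0 \<le> t \<and> t \<le> T \<longrightarrow> d c (X n t \<omega>) \<le> \<rho> / 3)"
    using \<rho>(1) T(1) \<delta>(1) by (intro small) auto
  then show "\<forall>\<^sub>F n in sequentially. dist (\<integral>\<omega>. f (path_of (X n) \<omega>) \<partial>Q n) (f ?c) < e"
    using eventually_ge_at_top[of 1]
  proof eventually_elim
    case (elim n)
    then obtain R where R: "R \<in> sets (Q n)" "measure (Q n) R \<le> \<delta>"
      "\<And>\<omega> t. \<omega> \<in> space (Q n) - R \<Longrightarrow> 0 \<le> t \<Longrightarrow> t \<le> T \<Longrightarrow> d c (X n t \<omega>) \<le> \<rho> / 3" by blast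
    interpret Q: prob_space "Q n" by (rule Q) (use elim in simp)
    have in_cadlag: "path_of (X n) \<omega> \<in> cadlag" if "\<omega> \<in> space (Q n)" for \<omega>
      using measurable_space[OF path that] elim by simp
    let ?f = "\<lambda>\<omega>. f (path_of (X n) \<omega>)"
    have f_meas: "?f \<in> borel_measurable (Q n)"
      using measurable_compose[OF path continuous_map_borel_of[OF f]] elim by simp
    have f_int: "integrable (Q n) ?f"
      using f_meas bound in_cadlag by (intro Q.integrable_const_bound[of _ C]) auto
    have "dist (\<integral>\<omega>. ?f \<omega> \<partial>Q n) (f ?c) = \<bar>\<integral>\<omega>. ?f \<omega> - f ?c \<partial>Q n\<bar>"
      using f_int by (simp add: dist_real_def Q.prob_space)
    also have "\<dots> \<le> (\<integral>\<omega>. \<bar>?f \<omega> - f ?c\<bar> \<partial>Q n)" by (rule integral_abs_bound)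
    also have "\<dots> \<le> (\<integral>\<omega>. e / 3 + 2 * C * indicator R \<omega> \<partial>Q n)"
    proof (rule integral_mono)
      show "integrable (Q n) (\<lambda>\<omega>. \<bar>?f \<omega> - f ?c\<bar>)" using f_int by simp
      show "integrable (Q n) (\<lambda>\<omega>. e / 3 + 2 * C * indicator R \<omega>)"
        using R(1) by (intro Bochner_Integration.integrable_add integrable_mult_right) (auto simp: Q.emeasure_eq_measure)
      fix \<omega> assume \<omega>: "\<omega> \<in> space (Q n)"
      show "\<bar>?f \<omega> - f ?c\<bar> \<le> e / 3 + 2 * C * indicator R \<omega>"
      proof (cases "\<omega> \<in> R")
        case True
        then show ?thesis using bound[OF in_cadlag[OF \<omega>]] bound[OF cc] e by simp
      next
        case False
        have "skorohod_dist d ?c (path_of (X n) \<omega>) \<le> \<rho> / 3 + exp (- T)"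
          using R(3)[of \<omega>] \<omega> False \<rho>(1) T(1) by (intro skorohod_dist_const_le) (auto simp: path_of_def)
        also have "\<dots> < \<rho>" using T(2) \<rho>(1) by simp
        finally have "dist (f ?c) (?f \<omega>) < e / 3" by (rule \<rho>(2)[OF in_cadlag[OF \<omega>]])
        then show ?thesis using False by (simp add: dist_real_def abs_minus_commute)
      qed
    qed
    also have "\<dots> = e / 3 + 2 * C * measure (Q n) R"
      using R(1) by (subst Bochner_Integration.integral_add) (auto simp: Q.prob_space Q.emeasure_eq_measure)
    also have "\<dots> \<le> e / 3 + 2 * C * \<delta>" using R(2) C by (simp add: mult_left_mono)
    also have "\<dots> < e" using \<delta>(2) e by simp
    finally show ?case .
  qed
qed

end

section \<open>The L^2 gap between k and its potential under an invariant measure\<close>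

context markov_potential
begin

lemma resolvent_eq:
  assumes "\<And>\<mu>. \<mu> \<in> M \<Longrightarrow> k \<mu> \<le> c"
  shows "\<beta> * resolvent S X P \<beta> k \<mu> = enn2real (pot \<mu> * indicator S \<mu>)"
proof (cases "\<mu> \<in> S")
  case True
  then show ?thesis
    using pot_eq_resolvent(1)[OF True assms] pot_eq_resolvent(2)[OF True assms] \<beta> by simp
qed (simp add: resolvent_def)

lemma pot_indicator_measurable: "(\<lambda>\<mu>. pot \<mu> * indicator S \<mu>) \<in> borel_measurable N"
  using pot_measurable S
  by (subst (asm) borel_measurable_restrict_space_iff_ennreal) (auto simp: Int_absorb2 S_subset)

lemma resolvent_measurable:
  assumes "\<And>\<mu>. \<mu> \<in> M \<Longrightarrow> k \<mu> \<le> c"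
  shows "(\<lambda>\<mu>. \<beta> * resolvent S X P \<beta> k \<mu>) \<in> borel_measurable N"
proof -
  have "(\<lambda>\<mu>. enn2real (pot \<mu> * indicator S \<mu>)) \<in> borel_measurable N"
    using pot_indicator_measurable by measurable
  then show ?thesis by (simp only: resolvent_eq[OF assms])
qed

text \<open>Both functions take values in [0, c], so the square of their difference is at most c
  times their sum, and both have the same integral.\<close>

lemma L2_inner_gap_le:
  assumes \<nu>: "sets \<nu> = sets N" "prob_space \<nu>" and c: "\<And>\<mu>. \<mu> \<in> M \<Longrightarrow> k \<mu> \<le> c"
    and pot: "(\<integral>\<^sup>+\<mu>. pot \<mu> * indicator S \<mu> \<partial>\<nu>) = ennreal (\<integral>\<mu>. k \<mu> \<partial>\<nu>)" and S_ne: "S \<noteq> {}"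
  shows "L2_inner \<nu> (\<lambda>\<mu>. k \<mu> - \<beta> * resolvent S X P \<beta> k \<mu>) (\<lambda>\<mu>. k \<mu> - \<beta> * resolvent S X P \<beta> k \<mu>)
    \<le> 2 * c * (\<integral>\<mu>. k \<mu> \<partial>\<nu>)"
proof -
  interpret prob_space \<nu> by fact
  let ?v = "\<lambda>\<mu>. \<beta> * resolvent S X P \<beta> k \<mu>"
  have sp: "space \<nu> = M" using sets_eq_imp_space_eq[OF \<nu>(1)] by simp
  have c0: "0 \<le> c" using S_ne S_subset k_nonneg c by (meson all_not_in_conv order_trans subsetD)
  have v: "0 \<le> ?v \<mu>" "?v \<mu> \<le> c" for \<mu>
    using pot_eq_resolvent(2,3)[of \<mu> c] c \<beta> c0 by (cases "\<mu> \<in> S"; simp add: resolvent_def)+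
  have k_int: "integrable \<nu> k"
    using k_measurable \<nu>(1) k_nonneg c sp
    by (intro integrable_const_bound[of _ c]) (auto cong: measurable_cong_sets)
  have v_int: "integrable \<nu> ?v"
    using resolvent_measurable[OF c] \<nu>(1) v
    by (intro integrable_const_bound[of _ c]) (auto cong: measurable_cong_sets)
  have "ennreal (\<integral>\<mu>. ?v \<mu> \<partial>\<nu>) = (\<integral>\<^sup>+\<mu>. ennreal (?v \<mu>) \<partial>\<nu>)"
    using v by (intro nn_integral_eq_integral[OF v_int, symmetric]) simp
  also have "\<dots> = (\<integral>\<^sup>+\<mu>. pot \<mu> * indicator S \<mu> \<partial>\<nu>)"
  proof (rule nn_integral_cong)
    fix \<mu> show "ennreal (?v \<mu>) = pot \<mu> * indicator S \<mu>"
      using pot_eq_resolvent(1)[of \<mu> c] c by (cases "\<mu> \<in> S") (auto simp: resolvent_def)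
  qed
  finally have "ennreal (\<integral>\<mu>. ?v \<mu> \<partial>\<nu>) = ennreal (\<integral>\<mu>. k \<mu> \<partial>\<nu>)" using pot by simp
  moreover have "0 \<le> (\<integral>\<mu>. ?v \<mu> \<partial>\<nu>)" using v(1) by (rule Bochner_Integration.integral_nonneg)
  moreover have "0 \<le> (\<integral>\<mu>. k \<mu> \<partial>\<nu>)" using k_nonneg sp by (intro Bochner_Integration.integral_nonneg_AE) auto
  ultimately have eq: "(\<integral>\<mu>. ?v \<mu> \<partial>\<nu>) = (\<integral>\<mu>. k \<mu> \<partial>\<nu>)" by simp
  have "L2_inner \<nu> (\<lambda>\<mu>. k \<mu> - ?v \<mu>) (\<lambda>\<mu>. k \<mu> - ?v \<mu>) \<le> (\<integral>\<mu>. c * (k \<mu> + ?v \<mu>) \<partial>\<nu>)"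
    unfolding L2_inner_def
  proof (rule integral_mono')
    show "integrable \<nu> (\<lambda>\<mu>. c * (k \<mu> + ?v \<mu>))" using k_int v_int by simp
    fix \<mu> assume \<mu>: "\<mu> \<in> space \<nu>"
    then have k: "0 \<le> k \<mu>" "k \<mu> \<le> c" using k_nonneg c sp by auto
    then show "0 \<le> c * (k \<mu> + ?v \<mu>)" using v(1)[of \<mu>] c0 by simp
    have "(k \<mu> - ?v \<mu>) * (k \<mu> - ?v \<mu>) = \<bar>k \<mu> - ?v \<mu>\<bar> * \<bar>k \<mu> - ?v \<mu>\<bar>" by simp
    also have "\<dots> \<le> c * (k \<mu> + ?v \<mu>)"
      using k v(1)[of \<mu>] v(2)[of \<mu>] c0 by (intro mult_mono; linarith)
    finally show "(k \<mu> - ?v \<mu>) * (k \<mu> - ?v \<mu>) \<le> c * (k \<mu> + ?v \<mu>)" .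
  qed
  also have "\<dots> = 2 * c * (\<integral>\<mu>. k \<mu> \<partial>\<nu>)"
    using k_int v_int eq by simp
  finally show ?thesis .
qed

text \<open>Supplies the hypothesis of \<open>nn_integral_pot_invariant\<close>. Invariance is
  stated for the operators on L^2, which agree with the transition function only almost everywhere;
  an integral does not see the difference.\<close>

lemma nn_integral_invariant:
  assumes \<nu>: "sets \<nu> = sets N" "prob_space \<nu>" and c: "\<And>\<mu>. \<mu> \<in> M \<Longrightarrow> k \<mu> \<le> c"
    and T: "strongly_continuous_semigroup_L2 \<nu> T" "given_by_L2 \<nu> T p" "invariant_measure \<nu> T"
    and \<nu>_S: "AE \<mu> in \<nu>. \<mu> \<in> S" and t: "0 \<le> t"
  shows "(\<integral>\<^sup>+\<mu>. (\<integral>\<^sup>+y. ennreal (k y) \<partial>p t \<mu>) * indicator S \<mu> \<partial>\<nu>) = ennreal (\<integral>\<mu>. k \<mu> \<partial>\<nu>)"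
proof -
  interpret prob_space \<nu> by fact
  have sp: "space \<nu> = M" using sets_eq_imp_space_eq[OF \<nu>(1)] by simp
  have k_meas: "k \<in> borel_measurable \<nu>" using k_measurable \<nu>(1) by (simp cong: measurable_cong_sets)
  have kc: "\<bar>k \<mu>\<bar> \<le> c" if "\<mu> \<in> M" for \<mu> using k_nonneg[OF that] c[OF that] by simp
  have kernel: "p t \<in> \<nu> \<rightarrow>\<^sub>M subprob_algebra N"
    using measurable_prob_algebraD[OF p_measurable[OF t]] \<nu>(1) by (simp cong: measurable_cong_sets)
  define u where "u \<mu> = (\<integral>y. k y \<partial>p t \<mu>)" for \<mu>
  have u: "(\<integral>\<^sup>+y. ennreal (k y) \<partial>p t \<mu>) = ennreal (u \<mu>)" "0 \<le> u \<mu>" "u \<mu> \<le> c" if "\<mu> \<in> M" for \<mu>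
  proof -
    interpret q: prob_space "p t \<mu>" by (rule p(3)[OF that t])
    have "k \<in> borel_measurable (p t \<mu>)" using k_measurable p(1)[OF that t] by (simp cong: measurable_cong_sets)
    then have int: "integrable (p t \<mu>) k"
      using kc p(2)[OF that t] by (intro q.integrable_const_bound[of _ c]) auto
    have nn: "AE y in p t \<mu>. 0 \<le> k y" using k_nonneg p(2)[OF that t] by auto
    show "(\<integral>\<^sup>+y. ennreal (k y) \<partial>p t \<mu>) = ennreal (u \<mu>)"
      unfolding u_def by (rule nn_integral_eq_integral[OF int nn])
    show "0 \<le> u \<mu>" unfolding u_def using nn by (rule Bochner_Integration.integral_nonneg_AE)
    show "u \<mu> \<le> c" unfolding u_def using int c p(2)[OF that t] by (intro q.integral_le_const) auto
  qed
  have u_meas: "u \<in> borel_measurable \<nu>"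
  proof -
    have "(\<lambda>\<mu>. enn2real (\<integral>\<^sup>+y. ennreal (k y) \<partial>p t \<mu>)) \<in> borel_measurable \<nu>"
      using measurable_compose[OF kernel nn_integral_measurable_subprob_algebra, of "\<lambda>y. ennreal (k y)"] k_measurable
      by measurable
    moreover have "enn2real (\<integral>\<^sup>+y. ennreal (k y) \<partial>p t \<mu>) = u \<mu>" if "\<mu> \<in> space \<nu>" for \<mu>
      using u[of \<mu>] that sp by simp
    ultimately show ?thesis by (simp cong: measurable_cong)
  qed
  have u_int: "integrable \<nu> u"
    using u_meas u(2,3) sp by (intro integrable_const_bound[of _ c]) auto
  have "k \<in> L2 \<nu>"
  proof -
    have "integrable \<nu> (\<lambda>x. (k x)\<^sup>2)"
      using k_meas kc sp power_mono[of "\<bar>k _\<bar>" c 2]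
      by (intro integrable_const_bound[of _ "c\<^sup>2"]) auto
    then show ?thesis unfolding L2_def using k_meas by simp
  qed
  then have T_meas: "T t k \<in> borel_measurable \<nu>"
    using T(1) t unfolding strongly_continuous_semigroup_L2_def bounded_operator_L2_def L2_def by blast
  have "k \<in> bounded_measurable \<nu>"
    unfolding bounded_measurable_def using k_meas kc sp by auto
  then have T_u: "AE \<mu> in \<nu>. T t k \<mu> = u \<mu>"
    using T(2) t unfolding given_by_L2_def u_def by blast
  have "(\<integral>\<^sup>+\<mu>. (\<integral>\<^sup>+y. ennreal (k y) \<partial>p t \<mu>) * indicator S \<mu> \<partial>\<nu>) = (\<integral>\<^sup>+\<mu>. ennreal (u \<mu>) \<partial>\<nu>)"
    using \<nu>_S S_subset u(1) by (intro nn_integral_cong_AE) (auto elim!: eventually_mono)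
  also have "\<dots> = ennreal (\<integral>\<mu>. u \<mu> \<partial>\<nu>)"
    using u(2) sp by (intro nn_integral_eq_integral[OF u_int]) auto
  also have "(\<integral>\<mu>. u \<mu> \<partial>\<nu>) = (\<integral>\<mu>. T t k \<mu> \<partial>\<nu>)"
    using T_u T_meas u_meas by (intro integral_cong_AE) auto
  also have "\<dots> = (\<integral>\<mu>. k \<mu> \<partial>\<nu>)"
  proof -
    have "\<exists>C. AE x in \<nu>. \<bar>k x\<bar> \<le> C" using kc sp by (intro exI[of _ c] AE_I2) simp
    then show ?thesis using T(3) t k_meas unfolding invariant_measure_def by blast
  qed
  finally show ?thesis .
qed

end

section \<open>Semigroups over a point mass\<close>

lemma AE_returnD:
  assumes "AE y in return N x. Q y" "x \<in> space N"
  shows "Q x"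
proof -
  obtain B where B: "{y \<in> space (return N x). \<not> Q y} \<subseteq> B" "emeasure (return N x) B = 0" "B \<in> sets (return N x)"
    using assms(1) by (rule AE_E)
  have "x \<notin> B" using B(2,3) by (auto simp: emeasure_return split: split_indicator_asm)
  then show ?thesis using B(1) assms(2) by auto
qed

context cadlag_markov
begin

text \<open>In \<open>L\<^sup>2\<close> of a point mass, the indicator of the point equals the constant \<open>1\<close>, so the semigroup
  cannot move the point.\<close>

lemma point_mass_fixed:
  assumes c: "c \<in> M" and T: "contraction_semigroup_L2 (return N c) T" "given_by_L2 (return N c) T p"
    and t: "0 \<le> t"
  shows "measure (p t c) {c} = 1"
proof -
  let ?R = "return N c"
  have sc: "{c} \<in> sets N"
    using c by (intro borel_of_closed) (simp add: Hausdorff_imp_t1_space Hausdorff_space_mtopology closedin_t1_singleton)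
  interpret R: prob_space ?R using c by (intro prob_space_return) simp
  interpret q: prob_space "p t c" by (rule p(3)[OF c t])
  let ?f = "indicator {c} :: 'e \<Rightarrow> real" and ?g = "\<lambda>_ :: 'e. 1 :: real"
  have f_meas: "?f \<in> borel_measurable ?R" using sc by simp
  have bm: "?f \<in> bounded_measurable ?R" "?g \<in> bounded_measurable ?R"
    unfolding bounded_measurable_def using f_meas by (auto intro!: exI[of _ 1] split: split_indicator)
  have sq: "(\<lambda>x. (?f x)\<^sup>2) = ?f" by (auto split: split_indicator)
  have f_int: "integrable ?R ?f"
    using f_meas by (intro R.integrable_const_bound[of _ 1]) (auto split: split_indicator)
  have f_L2: "?f \<in> L2 ?R"
    unfolding L2_def mem_Collect_eq sq using f_meas f_int by blast
  have g_L2: "?g \<in> L2 ?R" unfolding L2_def by simp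
  have fg: "AE x in ?R. ?f x = ?g x"
  proof (rule AE_I')
    show "space N - {c} \<in> null_sets ?R" using sets.compl_sets[OF sc] by (auto simp: null_sets_def emeasure_return)
  qed (auto split: split_indicator)
  have op: "bounded_operator_L2 ?R (T t)"
    using T(1) t unfolding contraction_semigroup_L2_def strongly_continuous_semigroup_L2_def by simp
  have ae: "AE x in ?R. T t ?f x = T t ?g x"
    by (rule op[unfolded bounded_operator_L2_def, THEN conjunct2, THEN conjunct1, rule_format, OF f_L2 g_L2 fg])
  have "T t ?f c = T t ?g c" using AE_returnD[OF ae] c by simp
  moreover have "T t h c = (\<integral>y. h y \<partial>p t c)" if h: "h \<in> bounded_measurable ?R" for h
  proof -
    have "AE x in ?R. T t h x = (\<integral>y. h y \<partial>p t x)" using T(2) t h unfolding given_by_L2_def by simp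
    from AE_returnD[OF this] c show ?thesis by simp
  qed
  ultimately have "(\<integral>y. ?f y \<partial>p t c) = (\<integral>y. ?g y \<partial>p t c)" using bm by simp
  then show ?thesis using sc p(1)[OF c t] by (simp add: q.prob_space)
qed

text \<open>Almost surely the path is at c at all rational times. If it were elsewhere at some t,
  right-continuity would keep it away from c at rational times just after t.\<close>

lemma AE_path_const:
  assumes c: "c \<in> S" and fixed: "\<And>t. 0 \<le> t \<Longrightarrow> measure (p t c) {c} = 1"
  shows "AE \<omega> in P c. path_of X \<omega> = (\<lambda>t\<in>{0..}. c)"
proof -
  have cM: "c \<in> M" using c S_subset by auto
  have sc: "{c} \<in> sets N"
    using cM by (intro borel_of_closed) (simp add: Hausdorff_imp_t1_space Hausdorff_space_mtopology closedin_t1_singleton)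
  interpret P: prob_space "P c" by (rule P(3)[OF c])
  have one: "AE \<omega> in P c. X t \<omega> = c" if t: "0 \<le> t" for t
  proof -
    have X_P: "X t \<in> P c \<rightarrow>\<^sub>M N" using X_measurable[OF t] P(1)[OF c] by (simp cong: measurable_cong_sets)
    have "measure (P c) (X t -` {c} \<inter> space (P c)) = 1"
      using fixed[OF t] unfolding distr_P[OF c t, symmetric] measure_distr[OF X_P sc] .
    then have "AE \<omega> in P c. \<omega> \<in> X t -` {c} \<inter> space (P c)"
      by (subst P.AE_in_set_eq_1[OF measurable_sets[OF X_P sc]])
    then show ?thesis by (auto elim: eventually_mono)
  qed
  have "AE \<omega> in P c. \<forall>t\<in>\<rat> \<inter> {0..}. X t \<omega> = c"
    using one by (subst AE_ball_countable) (auto simp: countable_rat)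
  then show ?thesis
    using AE_space
  proof eventually_elim
    case (elim \<omega>)
    then have \<omega>: "\<omega> \<in> space \<Omega>" using P(2)[OF c] by simp
    have "X t \<omega> = c" if t: "0 \<le> t" for t
    proof (rule ccontr)
      assume ne: "X t \<omega> \<noteq> c"
      have XM: "X t \<omega> \<in> M" using X_in[OF t \<omega>] S_subset by blast
      then have pos: "0 < d c (X t \<omega>)" using ne cM by simp
      obtain b where b: "t < b" "\<And>s. t \<le> s \<Longrightarrow> s < b \<Longrightarrow> d (path_of X \<omega> s) (path_of X \<omega> t) < d c (X t \<omega>)"
        using cadlag_right[OF path_cadlag[OF \<omega>] t pos] by blast
      obtain s where s: "s \<in> \<rat>" "t < s" "s < b" using Rats_dense_in_real[OF b(1)] by blast
      then show False using b(2)[of s] elim(1) t by (auto simp: path_of_def)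
    qed
    then show ?case unfolding path_of_def by auto
  qed
qed

lemma start_from_return:
  assumes "c \<in> S" shows "start_from S (return N c) P = P c"
proof -
  have cM: "c \<in> M" using assms S_subset by auto
  have se: "sets (restrict_space (return N c) S) = sets N\<^sub>S"
    by (rule sets_restrict_space_cong[OF sets_return])
  have "restrict_space (return N c) S = return N\<^sub>S c"
  proof (rule measure_eqI)
    show "sets (restrict_space (return N c) S) = sets (return N\<^sub>S c)"
      using se by simp
    fix A assume "A \<in> sets (restrict_space (return N c) S)"
    then have A: "A \<in> sets N\<^sub>S" using se by simp
    have S': "S \<inter> space N \<in> sets N" using S by (simp add: Int_absorb2 S_subset)
    then have A': "A \<subseteq> S" "A \<in> sets N" using A by (auto simp: sets_restrict_space_iff)
    have "emeasure (restrict_space (return N c) S) A = emeasure (return N c) A"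
      using S' A' by (intro emeasure_restrict_space) auto
    then show "emeasure (restrict_space (return N c) S) A = emeasure (return N\<^sub>S c) A"
      using A A' by (simp add: emeasure_return)
  qed
  then show ?thesis
    unfolding start_from_def
    using bind_return[OF measurable_prob_algebraD[OF P_kernel]] assms space_N_S by simp
qed

end

section \<open>Detecting neighbourhoods with a separating algebra\<close>

context Metric_space
begin

lemma continuous_map_bounded:
  assumes "compact_space mtopology" "continuous_map mtopology euclideanreal k"
  obtains c where "\<And>x. x \<in> M \<Longrightarrow> \<bar>k x\<bar> \<le> c"
proof -
  have "compactin mtopology M" using assms(1) by (simp add: compact_space_def)
  then have "compact (k ` M)" using image_compactin[OF _ assms(2)] by simp
  then have "bounded (k ` M)" by (rule compact_imp_bounded)
  then obtain c where "\<forall>y\<in>k ` M. norm y \<le> c" unfolding bounded_iff by (rule exE)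
  then show thesis by (intro that[of c]) simp
qed

text \<open>Compactness of the complement of the ball makes separation uniform: near each y outside,
  some (g - g c)^2 is bounded below, and finitely many such neighbourhoods suffice.\<close>

lemma separating_algebra_detects:
  assumes A: "separating_algebra mtopology A" and "compact_space mtopology" and c: "c \<in> M" and "0 < r"
  obtains k \<eta> where "k \<in> A" "\<And>x. 0 \<le> k x" "k c = 0" "0 < (\<eta>::real)" "\<And>x. x \<in> M \<Longrightarrow> k x < \<eta> \<Longrightarrow> d c x < r"
proof -
  note alg = A[unfolded separating_algebra_def topspace_mtopology]
  note cont = alg[THEN conjunct1, rule_format]
    and const = alg[THEN conjunct2, THEN conjunct1, rule_format]
    and add = alg[THEN conjunct2, THEN conjunct2, THEN conjunct1, rule_format, THEN conjunct1]
    and mult = alg[THEN conjunct2, THEN conjunct2, THEN conjunct1, rule_format, THEN conjunct2]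
    and sep = alg[THEN conjunct2, THEN conjunct2, THEN conjunct2, rule_format]
  define F where "F = M - mball c r"
  have "closedin mtopology F"
    unfolding F_def using openin_mball[of c r] closedin_diff[OF closedin_topspace] by fastforce
  then have F: "compactin mtopology F" using assms(2) closedin_compact_space by blast
  have "\<exists>g\<in>A. g c \<noteq> g y" if "y \<in> F" for y
  proof -
    have y: "y \<in> M" "r \<le> d c y" using that c unfolding F_def by auto
    then have "c \<noteq> y" using c \<open>0 < r\<close> mdist_zero[OF c] by auto
    then show ?thesis using sep[OF c y(1)] by blast
  qed
  then obtain g where g: "\<And>y. y \<in> F \<Longrightarrow> g y \<in> A \<and> g y c \<noteq> g y y" by metis
  \<comment> \<open>Written with addition of a constant, because the algebra is closed under sums
    and contains the constants.\<close>
  define h where "h y x = (g y x + - g y c) * (g y x + - g y c)" for y x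
  \<comment> \<open>Half of the value at y is a lower bound that holds on an open set around
    y.\<close>
  define V where "V y = {x \<in> M. h y y / 2 < h y x}" for y
  have hA: "h y \<in> A" if "y \<in> F" for y
    unfolding h_def using g[OF that] by (intro mult add const) auto
  have pos: "0 < h y y" if "y \<in> F" for y
    using g[OF that] unfolding h_def by (auto simp: zero_less_mult_iff)
  have V: "openin mtopology (V y)" if "y \<in> F" for y
  proof -
    have "V y = {x \<in> topspace mtopology. h y x \<in> {h y y / 2<..}}" unfolding V_def by simp
    then show ?thesis
      using openin_continuous_map_preimage[OF cont[OF hA[OF that]], of "{h y y / 2<..}"]
      by (simp only: open_openin[symmetric] open_greaterThan)
  qed
  have cover: "F \<subseteq> \<Union>(V ` F)" unfolding V_def using pos by (auto simp: F_def)
  have "openin mtopology U" if "U \<in> V ` F" for U using that V by auto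
  then obtain \<V> where \<V>: "finite \<V>" "\<V> \<subseteq> V ` F" "F \<subseteq> \<Union>\<V>"
    using compactinD[OF F _ cover] by metis
  then obtain I where I: "I \<subseteq> F" "finite I" "\<V> = V ` I" using finite_subset_image by metis
  define k where "k x = (\<Sum>y\<in>I. h y x)" for x
  \<comment> \<open>The element 1 covers the case that the ball is the whole space and the index set
    is empty.\<close>
  define \<eta> where "\<eta> = Min (insert 1 ((\<lambda>y. h y y / 2) ` I))"
  have h0: "0 \<le> h y x" for x y unfolding h_def by simp
  show thesis
  proof (rule that)
    show "k \<in> A"
      unfolding k_def using I(2,1)
    proof (induction I rule: finite_induct)
      case (insert y I)
      then show ?case using add[of "h y" "\<lambda>x. \<Sum>y\<in>I. h y x"] hA by simp
    qed (simp add: const)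
    show "0 \<le> k x" for x unfolding k_def using h0 by (intro sum_nonneg)
    show "k c = 0" unfolding k_def h_def by simp
    show "0 < \<eta>" unfolding \<eta>_def using I pos by auto
    fix x assume x: "x \<in> M" "k x < \<eta>"
    show "d c x < r"
    proof (rule ccontr)
      assume "\<not> d c x < r"
      then have "x \<in> F" unfolding F_def using x(1) c by simp
      then obtain y where y: "y \<in> I" "h y y / 2 < h y x" using \<V>(3) I(3) unfolding V_def by auto
      have "\<eta> \<le> h y y / 2" unfolding \<eta>_def using I(2) y(1) by (intro Min_le) auto
      also have "\<dots> < h y x" by (rule y(2))
      also have "\<dots> \<le> k x" unfolding k_def using I(2) y(1) h0 by (intro member_le_sum) auto
      finally show False using x(2) by simp
    qed
  qed
qed

end

section \<open>The state space of the particle systems\<close>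

text \<open>\<open>state_dist\<close> is arbitrary outside E and so need not be a metric in the
  sense of \<open>Metric_space\<close>. Cadlag paths stay in E at nonnegative times, and the
  Skorohod distance evaluates them only there, so a genuine metric with the same values on E may
  replace it.\<close>

lemma skorohod_topology_cong:
  assumes q: "\<And>\<mu> \<mu>'. \<mu> \<in> E \<Longrightarrow> \<mu>' \<in> E \<Longrightarrow> q \<mu> \<mu>' = q' \<mu> \<mu>'"
  shows "skorohod_topology E q = skorohod_topology E q'"
proof -
  have Y: "dist_topology E q = dist_topology E q'" using q by (rule dist_topology_cong)
  have in_E: "x t \<in> E" if "x \<in> cadlag_paths (dist_topology E q')" "0 \<le> t" for x t
    using that limitin_topspace[of "dist_topology E q'" x "x t"] unfolding cadlag_paths_def by auto
  have "skorohod_dist q x y = skorohod_dist q' x y"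
    if x: "x \<in> cadlag_paths (dist_topology E q')" and y: "y \<in> cadlag_paths (dist_topology E q')" for x y
    unfolding skorohod_dist_def
  proof (rule INF_cong[OF refl])
    fix l assume l: "l \<in> time_changes"
    have "(SUP t\<in>{0..}. min 1 (q (x (min t u)) (y (min (l t) u)))) = (SUP t\<in>{0..}. min 1 (q' (x (min t u)) (y (min (l t) u))))"
      if "u \<in> {0..}" for u
    proof (rule SUP_cong[OF refl])
      fix t :: real assume t: "t \<in> {0..}"
      then show "min 1 (q (x (min t u)) (y (min (l t) u))) = min 1 (q' (x (min t u)) (y (min (l t) u)))"
        using q in_E[OF x, of "min t u"] in_E[OF y, of "min (l t) u"] time_changesD(4)[OF l, of t] that by simp
    qed
    then have "(LINT u:{0..}|lborel. exp (- u) * (SUP t\<in>{0..}. min 1 (q (x (min t u)) (y (min (l t) u)))))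
        = (LINT u:{0..}|lborel. exp (- u) * (SUP t\<in>{0..}. min 1 (q' (x (min t u)) (y (min (l t) u)))))"
      by (intro set_lebesgue_integral_cong) auto
    then show "max (Sup (log_slopes l)) (LINT u:{0..}|lborel. exp (- u) * (SUP t\<in>{0..}. min 1 (q (x (min t u)) (y (min (l t) u)))))
        = max (Sup (log_slopes l)) (LINT u:{0..}|lborel. exp (- u) * (SUP t\<in>{0..}. min 1 (q' (x (min t u)) (y (min (l t) u)))))"
      by simp
  qed
  then show ?thesis unfolding skorohod_topology_def Y by (rule dist_topology_cong)
qed

definition visible :: "boundary \<Rightarrow> 'a::metric_space set \<Rightarrow> 'a set" where
  "visible b D = (case b of Distinguished \<Rightarrow> UNIV | Identified \<Rightarrow> D)"

text \<open>In the identified case the triangle inequality rests on \<open>infdist\<close> being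
  1-Lipschitz. A point y of D has positive distance to the frontier, and the shortcut through the
  frontier costs at least that much; so a small quotient distance to y is an ordinary
  distance.\<close>

lemma prohorov_space_point_dist:
  fixes D :: "'a::metric_space set"
  assumes "bounded_domain n D"
  shows "prohorov_space (closure D) (visible b D) (point_dist b D)"
proof -
  have D: "open D" "D \<noteq> {}" "compact (closure D)" using assms unfolding bounded_domain_def by auto
  show ?thesis
  proof (cases b)
    case Distinguished
    show ?thesis
    proof
      fix G and y :: 'a assume "open G" "y \<in> G \<inter> closure D"
      then obtain r where "r > 0" "ball y r \<subseteq> G" using open_contains_ball by blast
      then show "\<exists>r>0. \<forall>x\<in>closure D. point_dist b D x y < r \<longrightarrow> x \<in> G"
        using Distinguished by (auto simp: dist_commute subset_eq intro!: exI[of _ r])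
    qed (use D Distinguished in \<open>auto simp: visible_def dist_commute intro: dist_triangle2\<close>)
  next
    case Identified
    have fr: "closure D - D = frontier D" using D(1) by (simp add: frontier_def interior_open)
    show ?thesis
    proof
      fix x y z :: 'a
      show "0 \<le> point_dist b D x y" using Identified infdist_nonneg[of x "frontier D"] infdist_nonneg[of y "frontier D"] by simp
      show "point_dist b D x y = point_dist b D y x" using Identified by (simp add: dist_commute add.commute)
      show "point_dist b D x y \<le> dist x y" using Identified by simp
      show "point_dist b D x z \<le> point_dist b D x y + point_dist b D y z"
        using Identified infdist_triangle[of x "frontier D" y] infdist_triangle[of z "frontier D" y]
          dist_triangle[of x z y] infdist_nonneg[of y "frontier D"] dist_commute[of z y]
          infdist_nonneg[of x "frontier D"] infdist_nonneg[of z "frontier D"]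
        by (auto simp: min_def)
    next
      fix x y assume "x \<in> closure D - visible b D" "y \<in> closure D - visible b D"
      then have "x \<in> frontier D" "y \<in> frontier D" using Identified fr by (auto simp: visible_def)
      then show "point_dist b D x y = 0" using Identified by auto
    next
      fix G y assume G: "open G" "G \<subseteq> visible b D" "y \<in> G \<inter> closure D"
      then obtain r where r: "r > 0" "ball y r \<subseteq> G" using open_contains_ball by blast
      show "\<exists>r>0. \<forall>x\<in>closure D. point_dist b D x y < r \<longrightarrow> x \<in> G"
      proof (cases "frontier D = {}")
        case True
        then show ?thesis using r Identified by (auto simp: dist_commute subset_eq intro!: exI[of _ r])
      next
        case False
        have "y \<notin> frontier D" using G(2,3) fr Identified by (auto simp: visible_def)
        then have pos: "0 < infdist y (frontier D)" using False by (intro infdist_pos_not_in_closed) auto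
        show ?thesis
        proof (intro exI[of _ "min r (infdist y (frontier D))"] conjI ballI impI)
          show "0 < min r (infdist y (frontier D))" using r(1) pos by simp
          fix x assume "point_dist b D x y < min r (infdist y (frontier D))"
          then have "dist x y < r"
            using False Identified infdist_nonneg[of x "frontier D"] by (auto simp: min_def split: if_splits)
          then show "x \<in> G" using r(2) by (auto simp: dist_commute)
        qed
      qed
    qed (use D Identified in \<open>auto simp: visible_def\<close>)
  qed
qed

lemma proj_eq_restrict_space:
  assumes "\<nu> \<in> prob_measures D"
  shows "proj b D \<nu> = restrict_space \<nu> (closure D \<inter> visible b D)"
proof (cases b)
  case Distinguished
  have sp: "space \<nu> = closure D"
    using assms sets_eq_imp_space_eq[of \<nu> "restrict_space borel (closure D)"]
    by (auto simp: prob_measures_def space_prob_algebra space_restrict_space)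
  have "restrict_space \<nu> (space \<nu>) = \<nu>"
    by (rule measure_eqI) (auto simp: sets_restrict_space emeasure_restrict_space sets.Int_space_eq1 image_def dest: sets.sets_into_space)
  then show ?thesis using Distinguished sp by (simp add: visible_def)
next
  case Identified
  moreover have "closure D \<inter> D = D" using closure_subset by blast
  ultimately show ?thesis by (simp add: visible_def)
qed

lemma state_space:
  fixes D :: "'a::metric_space set"
  assumes "bounded_domain n D"
  obtains q where "Metric_space (states b D) q"
    "\<And>\<mu> \<mu>'. \<mu> \<in> states b D \<Longrightarrow> \<mu>' \<in> states b D \<Longrightarrow> state_dist b D \<mu> \<mu>' = q \<mu> \<mu>'"
    "compact_space (Metric_space.mtopology (states b D) q)"
    "\<And>n. 1 \<le> n \<Longrightarrow> closedin (Metric_space.mtopology (states b D) q) (particle_states b D n)"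
proof -
  interpret prohorov_space "closure D" "visible b D" "point_dist b D"
    by (rule prohorov_space_point_dist[OF assms])
  have pm: "prob_measures D = probs" unfolding prob_measures_def ..
  have proj: "proj b D \<nu> = restrict_space \<nu> (closure D \<inter> visible b D)" if "\<nu> \<in> probs" for \<nu>
    using proj_eq_restrict_space that pm by blast
  have st: "states b D = visible_states"
    unfolding states_def visible_states_def pm using proj by (rule image_cong[OF refl])
  have "inv_into (prob_measures D) (proj b D) \<mu> = rep \<mu>" for \<mu>
    unfolding rep_def inv_into_def pm using proj by (metis (no_types, lifting))
  then have dist: "state_dist b D \<mu> \<mu>' = state_metric \<mu> \<mu>'" if "\<mu> \<in> visible_states" "\<mu>' \<in> visible_states" for \<mu> \<mu>'
    unfolding state_dist_def state_metric_def sdist_def using that by simp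
  have part: "particle_states b D n = (\<lambda>\<nu>. restrict_space \<nu> (closure D \<inter> visible b D)) `
    {\<nu> \<in> probs. \<exists>z. (\<forall>i\<in>{1..n}. z i \<in> closure D) \<and>
        (\<forall>A\<in>sets \<nu>. measure \<nu> A = (\<Sum>i=1..n. indicator A (z i)) / real n)}" for n
    unfolding particle_states_def pm using proj by (intro image_cong[OF refl]) blast
  show thesis
  proof (rule that[of state_metric])
    show "Metric_space (states b D) state_metric" unfolding st by (rule Metric_space_states)
    show "state_dist b D \<mu> \<mu>' = state_metric \<mu> \<mu>'" if "\<mu> \<in> states b D" "\<mu>' \<in> states b D" for \<mu> \<mu>'
      using dist that unfolding st by blast
    show "compact_space (Metric_space.mtopology (states b D) state_metric)"
      unfolding st by (rule compact_space_states)
    show "closedin (Metric_space.mtopology (states b D) state_metric) (particle_states b D n)" if "1 \<le> n" for n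
      unfolding st part by (rule closedin_empirical_states[OF that])
  qed
qed

section \<open>Convergence of the particle processes to the process resting at the limit
  state\<close>

theorem corollary3p6:
  fixes D :: "'a::metric_space set" and d :: nat and b :: boundary
    and E E\<^sub>0 :: "'a measure set" and q :: "'a measure \<Rightarrow> 'a measure \<Rightarrow> real"
    and Y :: "'a measure topology" and N :: "'a measure measure"
    and M En :: "nat \<Rightarrow> 'a measure set" and \<mu>\<^sub>0 :: "'a measure"
    and \<nu> :: "nat \<Rightarrow> 'a measure measure" and \<nu>_lim :: "'a measure measure"
    and Tn :: "nat \<Rightarrow> real \<Rightarrow> ('a measure \<Rightarrow> real) \<Rightarrow> 'a measure \<Rightarrow> real"
    and pn :: "nat \<Rightarrow> real \<Rightarrow> 'a measure \<Rightarrow> 'a measure measure"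
    and \<Omega>n :: "nat \<Rightarrow> 'w measure" and Xn :: "nat \<Rightarrow> real \<Rightarrow> 'w \<Rightarrow> 'a measure"
    and Pn :: "nat \<Rightarrow> 'a measure \<Rightarrow> 'w measure"
    and T T_L2 :: "real \<Rightarrow> ('a measure \<Rightarrow> real) \<Rightarrow> 'a measure \<Rightarrow> real"
    and p :: "real \<Rightarrow> 'a measure \<Rightarrow> 'a measure measure"
    and S :: "'a measure set" and \<Omega> :: "'v measure" and X :: "real \<Rightarrow> 'v \<Rightarrow> 'a measure"
    and P :: "'a measure \<Rightarrow> 'v measure"
    and \<psi> :: "nat \<Rightarrow> 'a measure \<Rightarrow> real" and C \<beta> :: real
    and P\<psi> :: "nat \<Rightarrow> 'w measure"
    and A :: "('a measure \<Rightarrow> real) set" and \<xi> :: "real \<Rightarrow> ('a measure \<Rightarrow> real) \<Rightarrow> nat \<Rightarrow> real"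
    and Gn :: "nat \<Rightarrow> ('a measure \<Rightarrow> real) \<Rightarrow> 'a measure \<Rightarrow> real"
    and \<epsilon> :: "('a measure \<Rightarrow> real) \<Rightarrow> nat \<Rightarrow> real" and B :: "('a measure \<Rightarrow> real) \<Rightarrow> 'a measure set"
  assumes D: "bounded_domain d D"
    and E: "E = states b D" and q: "q = state_dist b D"
    and Y: "Y = dist_topology E q" and N: "N = borel_of Y"
    and M: "M = particle_states b D" and En: "En = exact_states b D"
    and E0: "E\<^sub>0 = limit_states b D" and \<mu>0: "\<mu>\<^sub>0 \<in> E\<^sub>0"
    \<comment> \<open>the particle systems\<close>
    and \<nu>: "\<And>n. n \<ge> 1 \<Longrightarrow> \<nu> n \<in> space (prob_algebra N)"
    and \<nu>_En: "\<And>n. n \<ge> 1 \<Longrightarrow> E - En n \<in> null_sets (\<nu> n)"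
    and Tn: "\<And>n. n \<ge> 1 \<Longrightarrow> strongly_continuous_semigroup_L2 (\<nu> n) (Tn n)"
    and pn: "\<And>n. n \<ge> 1 \<Longrightarrow> transition_function N (pn n)"
    and Tn_pn: "\<And>n. n \<ge> 1 \<Longrightarrow> given_by_L2 (\<nu> n) (Tn n) (pn n)"
    and Tn_inv: "\<And>n. n \<ge> 1 \<Longrightarrow> invariant_measure (\<nu> n) (Tn n)"
    and Xn: "\<And>n. n \<ge> 1 \<Longrightarrow> cadlag_markov_process Y (M n) (pn n) (\<Omega>n n) (Xn n) (Pn n)"
    and Xn_En: "\<And>n \<mu> t. n \<ge> 1 \<Longrightarrow> \<mu> \<in> M n \<Longrightarrow> t > 0 \<Longrightarrow> AE \<omega> in Pn n \<mu>. Xn n t \<omega> \<in> En n"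
    and Gn: "\<And>n g \<mu>. Gn n g \<mu> = resolvent (M n) (Xn n) (Pn n) \<beta> g \<mu>"
    \<comment> \<open>the limiting process\<close>
    and \<nu>_lim: "\<nu>_lim = return N \<mu>\<^sub>0"
    and p: "transition_function N p"
    and T: "\<And>t f \<mu>. t \<ge> 0 \<Longrightarrow> f \<in> bounded_measurable N \<Longrightarrow> \<mu> \<in> E \<Longrightarrow> T t f \<mu> = (\<integral>y. f y \<partial>p t \<mu>)"
    and T_L2: "contraction_semigroup_L2 \<nu>_lim T_L2" "given_by_L2 \<nu>_lim T_L2 p"
    and S: "S \<in> sets N" "\<mu>\<^sub>0 \<in> S"
    and X: "cadlag_markov_process Y S p \<Omega> X P"
    \<comment> \<open>the hypotheses of the corollary\<close>
    and conv: "weakly_converges Y \<nu> \<nu>_lim"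
    and \<psi>_meas: "\<And>n. n \<ge> 1 \<Longrightarrow> \<psi> n \<in> borel_measurable (\<nu> n)"
    and \<psi>_bounds: "C > 0" "\<And>n. n \<ge> 1 \<Longrightarrow> AE \<mu> in \<nu> n. 0 \<le> \<psi> n \<mu> \<and> \<psi> n \<mu> \<le> C"
    and \<psi>_int: "\<And>n. n \<ge> 1 \<Longrightarrow> (\<integral>\<mu>. \<psi> n \<mu> \<partial>\<nu> n) = 1"
    and P\<psi>: "\<And>n. P\<psi> n = start_from (M n) (density (\<nu> n) (\<lambda>\<mu>. ennreal (\<psi> n \<mu>))) (Pn n)"
    and \<beta>: "\<beta> > 0"
    and A: "separating_algebra Y A"
    and \<xi>_pos: "\<And>a g n. a \<ge> 0 \<Longrightarrow> g \<in> A \<Longrightarrow> n \<ge> 1 \<Longrightarrow> \<xi> a g n > 0"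
    and \<xi>_lim: "\<And>a g. (\<And>n. a n \<ge> 0) \<Longrightarrow> a \<longlonglongrightarrow> 0 \<Longrightarrow> g \<in> A \<Longrightarrow> (\<lambda>n. \<xi> (a n) g n) \<longlonglongrightarrow> 0"
    and \<epsilon>: "\<And>g n. \<epsilon> g n = \<xi> (sqrt (L2_inner (\<nu> n) (\<lambda>\<mu>. g \<mu> - \<beta> * Gn n g \<mu>) (\<lambda>\<mu>. g \<mu> - \<beta> * Gn n g \<mu>))) g n"
    and B: "\<And>g. B g = (\<Union>n\<in>{1..}. {\<mu> \<in> En n. \<bar>g \<mu> - \<beta> * Gn n g \<mu>\<bar> \<ge> \<epsilon> g n * sup_norm E g})"
    and exit: "\<And>g n. g \<in> A \<Longrightarrow> (\<exists>\<mu>\<in>E. g \<mu> \<noteq> 0) \<Longrightarrow> n \<ge> 1 \<Longrightarrow>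
       expected_discount (P\<psi> n) \<beta> (exit_time (Xn n) ((E - B g) \<inter> En n)) \<le> ennreal (\<epsilon> g n)"
  shows "weakly_converges (skorohod_topology E q)
           (\<lambda>n. path_law E q (P\<psi> n) (Xn n)) (path_law E q (start_from S \<nu>_lim P) X)"
proof -
  obtain dE where dE: "Metric_space (states b D) dE"
    "\<And>\<mu> \<mu>'. \<mu> \<in> states b D \<Longrightarrow> \<mu>' \<in> states b D \<Longrightarrow> state_dist b D \<mu> \<mu>' = dE \<mu> \<mu>'"
    "compact_space (Metric_space.mtopology (states b D) dE)"
    "\<And>n. 1 \<le> n \<Longrightarrow> closedin (Metric_space.mtopology (states b D) dE) (particle_states b D n)"
    by (rule state_space[OF D, of b]) (rule that)
  interpret S: Metric_space E dE using dE(1) E by simp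
  have q_eq: "q \<mu> \<mu>' = dE \<mu> \<mu>'" if "\<mu> \<in> E" "\<mu>' \<in> E" for \<mu> \<mu>'
    using dE(2) that unfolding q E by blast
  have Y_eq: "Y = S.mtopology"
    unfolding Y dist_topology_eq_mtopology[OF S.Metric_space_axioms, symmetric] using q_eq by (rule dist_topology_cong)
  have N_eq: "N = borel_of S.mtopology" using N Y_eq by simp
  have space_N: "space N = E" by (simp add: N_eq)
  have compact: "compact_space S.mtopology" using dE(3) E by simp
  have M_closed: "closedin S.mtopology (M n)" if "n \<ge> 1" for n using dE(4)[OF that] E M by simp
  have M_sets: "M n \<in> sets N" if "n \<ge> 1" for n
    unfolding N_eq by (rule borel_of_closed[OF M_closed[OF that]])
  have En_sets: "En n \<in> sets N" if "n \<ge> 1" for n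
    unfolding En exact_states_def M[symmetric]
    using M_sets that by (intro sets.Diff sets.finite_UN) (auto simp: M)
  have En_M: "En n \<subseteq> M n" for n unfolding En exact_states_def M by blast
  have \<mu>0_E: "\<mu>\<^sub>0 \<in> E" using \<mu>0 unfolding E0 limit_states_def E by blast
  have sk: "skorohod_topology E q = dist_topology S.cadlag (skorohod_dist dE)"
  proof -
    have "skorohod_topology E q = skorohod_topology E dE"
      by (rule skorohod_topology_cong) (rule q_eq)
    then show ?thesis
      by (simp add: skorohod_topology_def dist_topology_eq_mtopology[OF S.Metric_space_axioms])
  qed
  interpret L: cadlag_markov E dE S p \<Omega> X P
    using S(1) p X unfolding N_eq Y_eq by unfold_locales
  have proc: "cadlag_markov E dE (M n) (pn n) (\<Omega>n n) (Xn n) (Pn n)" if "n \<ge> 1" for n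
    using M_sets[OF that] pn[OF that] Xn[OF that] unfolding N_eq Y_eq by unfold_locales

  have \<nu>': "sets (\<nu> n) = sets N" "prob_space (\<nu> n)" "space (\<nu> n) = E" if "n \<ge> 1" for n
    using \<nu>[OF that] sets_eq_imp_space_eq[of "\<nu> n" N] space_N by (auto simp: space_prob_algebra)
  have \<nu>_M: "AE \<mu> in \<nu> n. \<mu> \<in> M n" if "n \<ge> 1" for n
    using En_M[of n] by (intro AE_I'[OF \<nu>_En[OF that]]) (auto simp: \<nu>'(3)[OF that])
  define m where "m n = density (\<nu> n) (\<lambda>\<mu>. ennreal (\<psi> n \<mu>))" for n
  have m: "prob_space (m n)" "emeasure (m n) (M n) = 1" "sets (m n) = sets N" if n: "n \<ge> 1" for n
  proof -
    interpret prob_space "\<nu> n" by (rule \<nu>'(2)[OF n])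
    have "integrable (\<nu> n) (\<psi> n)"
      using \<psi>_meas[OF n] \<psi>_bounds(2)[OF n] by (intro integrable_const_bound[of _ C]) (auto elim: eventually_mono)
    then have one: "(\<integral>\<^sup>+\<mu>. ennreal (\<psi> n \<mu>) \<partial>\<nu> n) = 1"
      using \<psi>_bounds(2)[OF n] \<psi>_int[OF n] by (subst nn_integral_eq_integral) (auto elim: eventually_mono)
    have \<psi>e: "(\<lambda>\<mu>. ennreal (\<psi> n \<mu>)) \<in> borel_measurable (\<nu> n)" using \<psi>_meas[OF n] by measurable
    have "emeasure (m n) (space (\<nu> n)) = (\<integral>\<^sup>+\<mu>. ennreal (\<psi> n \<mu>) \<partial>\<nu> n)"
      unfolding m_def using \<psi>e by (subst emeasure_density) (auto intro!: nn_integral_cong)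
    then show "prob_space (m n)" using one by (intro prob_spaceI) (simp add: m_def)
    have "emeasure (m n) (M n) = (\<integral>\<^sup>+\<mu>. ennreal (\<psi> n \<mu>) * indicator (M n) \<mu> \<partial>\<nu> n)"
      unfolding m_def using \<psi>e M_sets[OF n] \<nu>'(1)[OF n] by (intro emeasure_density) auto
    also have "\<dots> = (\<integral>\<^sup>+\<mu>. ennreal (\<psi> n \<mu>) \<partial>\<nu> n)"
      using \<nu>_M[OF n] by (intro nn_integral_cong_AE) (auto elim: eventually_mono)
    finally show "emeasure (m n) (M n) = 1" using one by simp
    show "sets (m n) = sets N" unfolding m_def using \<nu>'(1)[OF n] by simp
  qed
  have P\<psi>_eq: "P\<psi> n = start_from (M n) (m n) (Pn n)" for n unfolding P\<psi> m_def ..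
  have P\<psi>': "prob_space (P\<psi> n)" "sets (P\<psi> n) = sets (\<Omega>n n)" "space (P\<psi> n) = space (\<Omega>n n)" if n: "n \<ge> 1" for n
  proof -
    interpret cadlag_markov E dE "M n" "pn n" "\<Omega>n n" "Xn n" "Pn n" by (rule proc[OF n])
    show "prob_space (P\<psi> n)" "sets (P\<psi> n) = sets (\<Omega>n n)"
      unfolding P\<psi>_eq using start_from(1,2)[OF _ m(1,2)[OF n]] m(3)[OF n] N_eq by simp_all
    then show "space (P\<psi> n) = space (\<Omega>n n)" by (intro sets_eq_imp_space_eq)
  qed
  have path_n: "path_of (Xn n) \<in> P\<psi> n \<rightarrow>\<^sub>M borel_of (skorohod_topology E q)" if n: "n \<ge> 1" for n
  proof -
    interpret cadlag_markov E dE "M n" "pn n" "\<Omega>n n" "Xn n" "Pn n" by (rule proc[OF n])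
    have "path_of (Xn n) \<in> \<Omega>n n \<rightarrow>\<^sub>M borel_of (skorohod_topology E q)"
      unfolding sk using compact \<mu>0_E X_measurable path_cadlag by (intro S.measurable_path_of) auto
    then show ?thesis using P\<psi>'(2)[OF n] by (simp cong: measurable_cong_sets)
  qed
  have path: "path_of X \<in> P \<mu>\<^sub>0 \<rightarrow>\<^sub>M borel_of (skorohod_topology E q)"
  proof -
    have "path_of X \<in> \<Omega> \<rightarrow>\<^sub>M borel_of (skorohod_topology E q)"
      unfolding sk using compact \<mu>0_E L.X_measurable L.path_cadlag by (intro S.measurable_path_of) auto
    then show ?thesis using L.P(1)[OF S(2)] by (simp cong: measurable_cong_sets)
  qed

  have small: "\<forall>\<^sub>F n in sequentially. \<exists>R\<in>sets (P\<psi> n). measure (P\<psi> n) R \<le> \<delta> \<and>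
      (\<forall>\<omega>\<in>space (P\<psi> n) - R. \<forall>t. 0 \<le> t \<and> t \<le> T0 \<longrightarrow> dE \<mu>\<^sub>0 (Xn n t \<omega>) \<le> r)"
    if pos: "0 < r" "0 < T0" "0 < \<delta>" for r T0 \<delta>
  proof -
    obtain k \<eta> where k: "k \<in> A" "\<And>\<mu>. 0 \<le> k \<mu>" "k \<mu>\<^sub>0 = 0" and \<eta>: "0 < (\<eta>::real)"
      and detect: "\<And>\<mu>. \<mu> \<in> E \<Longrightarrow> k \<mu> < \<eta> \<Longrightarrow> dE \<mu>\<^sub>0 \<mu> < r"
      by (rule S.separating_algebra_detects[OF A[unfolded Y_eq] compact \<mu>0_E pos(1)]) (rule that)
    show ?thesis
    proof (cases "\<exists>\<mu>\<in>E. k \<mu> \<noteq> 0")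
      case False
      show ?thesis
        using eventually_ge_at_top[of 1]
      proof eventually_elim
        case (elim n)
        interpret cadlag_markov E dE "M n" "pn n" "\<Omega>n n" "Xn n" "Pn n" by (rule proc[OF elim])
        have "dE \<mu>\<^sub>0 (Xn n t \<omega>) \<le> r" if "\<omega> \<in> space (P\<psi> n)" "0 \<le> t" for \<omega> t
        proof -
          have "Xn n t \<omega> \<in> E" using X_in[OF that(2), of \<omega>] that(1) P\<psi>'(3)[OF elim] S_subset by auto
          then show ?thesis using detect[of "Xn n t \<omega>"] False \<eta> by (intro less_imp_le) auto
        qed
        then show ?case using pos(3) by (intro bexI[of _ "{}"]) auto
      qed
    next
      case True
      have k_cont: "continuous_map S.mtopology euclideanreal k"
        by (rule A[unfolded separating_algebra_def Y_eq, THEN conjunct1, rule_format, OF k(1)])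
      obtain c where c: "\<And>\<mu>. \<mu> \<in> E \<Longrightarrow> \<bar>k \<mu>\<bar> \<le> c"
        by (rule S.continuous_map_bounded[OF compact k_cont]) blast
      then have kc: "k \<mu> \<le> c" if "\<mu> \<in> E" for \<mu> using that by fastforce
      have potential: "markov_potential E dE (M n) (pn n) (\<Omega>n n) (Xn n) (Pn n) k \<beta>" if n: "n \<ge> 1" for n
      proof -
        interpret cadlag_markov E dE "M n" "pn n" "\<Omega>n n" "Xn n" "Pn n" by (rule proc[OF n])
        show ?thesis using k_cont k(2) \<beta> by unfold_locales
      qed
      define I where "I n = (\<integral>\<mu>. k \<mu> \<partial>\<nu> n)" for n
      have I_nonneg: "0 \<le> I n" for n unfolding I_def using k(2) by (intro Bochner_Integration.integral_nonneg)
      have I_lim: "I \<longlonglongrightarrow> 0"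
      proof -
        have "I \<longlonglongrightarrow> (\<integral>\<mu>. k \<mu> \<partial>\<nu>_lim)"
          using conv c k_cont unfolding weakly_converges_def Y_eq I_def by auto
        also have "(\<integral>\<mu>. k \<mu> \<partial>\<nu>_lim) = k \<mu>\<^sub>0"
          unfolding \<nu>_lim N_eq using \<mu>0_E continuous_map_borel_of[OF k_cont] by (intro integral_return) auto
        finally show ?thesis using k(3) by simp
      qed
      define \<alpha> where "\<alpha> n = L2_inner (\<nu> n) (\<lambda>\<mu>. k \<mu> - \<beta> * Gn n k \<mu>) (\<lambda>\<mu>. k \<mu> - \<beta> * Gn n k \<mu>)" for n
      have \<alpha>_nonneg: "0 \<le> \<alpha> n" for n unfolding \<alpha>_def L2_inner_def by simp
      have M_ne: "M n \<noteq> {}" if "n \<ge> 1" for n using m(2)[OF that] by auto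
      have pot_int: "(\<integral>\<^sup>+\<mu>. markov_potential.pot (Xn n) (Pn n) k \<beta> \<mu> * indicator (M n) \<mu> \<partial>\<nu> n) = ennreal (I n)"
        if n: "n \<ge> 1" for n
      proof -
        interpret markov_potential E dE "M n" "pn n" "\<Omega>n n" "Xn n" "Pn n" k \<beta> by (rule potential[OF n])
        show ?thesis
          unfolding I_def using \<nu>'[OF n] N_eq kc Tn[OF n] Tn_pn[OF n] Tn_inv[OF n] \<nu>_M[OF n]
          by (intro nn_integral_pot_invariant nn_integral_invariant) auto
      qed
      have \<alpha>_le: "\<alpha> n \<le> 2 * c * I n" if n: "n \<ge> 1" for n
      proof -
        interpret markov_potential E dE "M n" "pn n" "\<Omega>n n" "Xn n" "Pn n" k \<beta> by (rule potential[OF n])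
        show ?thesis
          unfolding \<alpha>_def Gn I_def
          using \<nu>'[OF n] N_eq kc pot_int[OF n] M_ne[OF n] by (intro L2_inner_gap_le) (auto simp: I_def)
      qed
      have "\<alpha> \<longlonglongrightarrow> 0"
      proof (rule tendsto_sandwich)
        show "\<forall>\<^sub>F n in sequentially. 0 \<le> \<alpha> n" using \<alpha>_nonneg by simp
        show "\<forall>\<^sub>F n in sequentially. \<alpha> n \<le> 2 * c * I n"
          using eventually_ge_at_top[of 1] by eventually_elim (rule \<alpha>_le)
        show "(\<lambda>n. 2 * c * I n) \<longlonglongrightarrow> 0" using tendsto_mult_left[OF I_lim, of "2 * c"] by simp
      qed simp
      \<comment> \<open>This square root is the first argument of \<xi>, so the exit hypothesis for
        k has an error tending to 0.\<close>
      then have "(\<lambda>n. sqrt (\<alpha> n)) \<longlonglongrightarrow> 0" using tendsto_real_sqrt by fastforce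
      then have "(\<lambda>n. \<xi> (sqrt (\<alpha> n)) k n) \<longlonglongrightarrow> 0" using \<alpha>_nonneg k(1) by (intro \<xi>_lim) auto
      then have \<epsilon>_lim: "(\<lambda>n. \<epsilon> k n) \<longlonglongrightarrow> 0" unfolding \<epsilon> \<alpha>_def .
      have \<epsilon>_nonneg: "0 \<le> \<epsilon> k n" if "n \<ge> 1" for n
        unfolding \<epsilon> using \<xi>_pos[of _ k n] k(1) that \<alpha>_nonneg[of n] unfolding \<alpha>_def by (intro less_imp_le) auto
      have sup: "0 \<le> sup_norm E k"
      proof -
        have "\<bar>k \<mu>\<^sub>0\<bar> \<le> sup_norm E k"
          unfolding sup_norm_def using c \<mu>0_E by (intro cSUP_upper bdd_aboveI[of _ c]) auto
        then show ?thesis by simp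
      qed
      have G_meas: "(\<lambda>\<mu>. \<beta> * Gn n k \<mu>) \<in> borel_measurable N" if n: "n \<ge> 1" for n
      proof -
        interpret markov_potential E dE "M n" "pn n" "\<Omega>n n" "Xn n" "Pn n" k \<beta> by (rule potential[OF n])
        show ?thesis unfolding Gn N_eq by (rule resolvent_measurable[OF kc])
      qed
      have B_sets: "B k \<in> sets N"
        unfolding B
      proof (rule sets.countable_UN'')
        fix n :: nat assume "n \<in> {1..}"
        then have n: "n \<ge> 1" by simp
        have [measurable]: "k \<in> borel_measurable N" unfolding N_eq by (rule continuous_map_borel_of[OF k_cont])
        note [measurable] = G_meas[OF n]
        have "{\<mu> \<in> space N. \<epsilon> k n * sup_norm E k \<le> \<bar>k \<mu> - \<beta> * Gn n k \<mu>\<bar>} \<in> sets N" by measurable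
        then have "En n \<inter> {\<mu> \<in> space N. \<epsilon> k n * sup_norm E k \<le> \<bar>k \<mu> - \<beta> * Gn n k \<mu>\<bar>} \<in> sets N"
          using En_sets[OF n] by (rule sets.Int[rotated])
        moreover have "En n \<inter> {\<mu> \<in> space N. \<epsilon> k n * sup_norm E k \<le> \<bar>k \<mu> - \<beta> * Gn n k \<mu>\<bar>}
            = {\<mu> \<in> En n. \<epsilon> k n * sup_norm E k \<le> \<bar>k \<mu> - \<beta> * Gn n k \<mu>\<bar>}"
          using sets.sets_into_space[OF En_sets[OF n]] by blast
        ultimately show "{\<mu> \<in> En n. \<epsilon> k n * sup_norm E k \<le> \<bar>k \<mu> - \<beta> * Gn n k \<mu>\<bar>} \<in> sets N" by simp
      qed simp
      have EB_sets: "E - B k \<in> sets N" using sets.compl_sets[OF B_sets] space_N by simp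
      \<comment> \<open>\<open>escape_estimate\<close> controls times strictly below its horizon;
        one more unit of time includes T0.\<close>
      let ?T = "T0 + 1"
      let ?b = "\<lambda>n. exp (\<beta> * ?T) * (\<epsilon> k n + C * I n / (\<eta> / 4))"
      \<comment> \<open>The threshold \<eta> is shared out: \<eta> / 4 for the potential and less
        than \<eta> / 4 for its distance to k off \<open>B k\<close>, so k stays below \<eta> along
        the path.\<close>
      have "(\<lambda>n. \<epsilon> k n * sup_norm E k) \<longlonglongrightarrow> 0 * sup_norm E k" by (intro tendsto_intros \<epsilon>_lim)
      then have ev1: "\<forall>\<^sub>F n in sequentially. \<epsilon> k n * sup_norm E k < \<eta> / 4"
        using \<eta> by (intro order_tendstoD) auto
      have "?b \<longlonglongrightarrow> exp (\<beta> * ?T) * (0 + C * 0 / (\<eta> / 4))" using \<eta> by (intro tendsto_intros \<epsilon>_lim I_lim) simp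
      then have ev2: "\<forall>\<^sub>F n in sequentially. ?b n < \<delta>" using pos(3) by (intro order_tendstoD) auto
      show ?thesis
        using ev1 ev2 eventually_ge_at_top[of 1]
      proof eventually_elim
        case (elim n)
        interpret markov_potential E dE "M n" "pn n" "\<Omega>n n" "Xn n" "Pn n" k \<beta> by (rule potential[OF elim(3)])
        let ?G = "(E - B k) \<inter> En n"
        have dom: "ennreal (k \<mu>) \<le> pot \<mu> + ennreal (\<epsilon> k n * sup_norm E k)" if "\<mu> \<in> ?G" "\<mu> \<in> M n" for \<mu>
        proof -
          \<comment> \<open>A state outside the union \<open>B k\<close> is in particular outside
            its n-th member, the one that compares k with the potential of the n-th process.\<close>
          have "\<mu> \<notin> {\<mu> \<in> En n. \<bar>k \<mu> - \<beta> * Gn n k \<mu>\<bar> \<ge> \<epsilon> k n * sup_norm E k}"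
            using that(1) elim(3) unfolding B by blast
          then have "k \<mu> \<le> \<beta> * Gn n k \<mu> + \<epsilon> k n * sup_norm E k" using that(1) by auto
          then have "ennreal (k \<mu>) \<le> ennreal (\<beta> * Gn n k \<mu> + \<epsilon> k n * sup_norm E k)" by (rule ennreal_leI)
          also have "\<dots> = ennreal (\<beta> * Gn n k \<mu>) + ennreal (\<epsilon> k n * sup_norm E k)"
            using pot_eq_resolvent(2)[OF that(2) kc] \<beta> \<epsilon>_nonneg[OF elim(3)] sup unfolding Gn by (intro ennreal_plus) auto
          also have "ennreal (\<beta> * Gn n k \<mu>) = pot \<mu>"
            unfolding Gn by (rule pot_eq_resolvent(1)[OF that(2) kc, symmetric])
          finally show ?thesis .
        qed
        have G_sets: "?G \<in> sets (borel_of S.mtopology)"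
          using sets.Int[OF EB_sets En_sets[OF elim(3)]] N_eq by simp
        obtain R where R: "R \<in> sets (\<Omega>n n)" "measure (P\<psi> n) R \<le> ?b n"
          "\<And>\<omega> t. \<omega> \<in> space (\<Omega>n n) - R \<Longrightarrow> 0 \<le> t \<Longrightarrow> t < ?T \<Longrightarrow> k (Xn n t \<omega>) \<le> \<eta> / 4 + \<epsilon> k n * sup_norm E k"
        proof (rule escape_estimate[where \<nu> = "\<nu> n" and \<psi> = "\<psi> n" and C = C and Q = "P\<psi> n" and I = "I n"
              and G = ?G and \<eta> = "\<epsilon> k n * sup_norm E k" and \<epsilon> = "\<epsilon> k n" and a = "\<eta> / 4" and T = ?T])
          show "sets (\<nu> n) = sets (borel_of S.mtopology)" using \<nu>'(1)[OF elim(3)] N_eq by simp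
          show "\<psi> n \<in> borel_measurable (\<nu> n)" by (rule \<psi>_meas[OF elim(3)])
          show "AE \<mu> in \<nu> n. \<psi> n \<mu> \<le> C" using \<psi>_bounds(2)[OF elim(3)] by (auto elim: eventually_mono)
          show "prob_space (density (\<nu> n) (\<lambda>\<mu>. ennreal (\<psi> n \<mu>)))"
            "emeasure (density (\<nu> n) (\<lambda>\<mu>. ennreal (\<psi> n \<mu>))) (M n) = 1"
            using m(1,2)[OF elim(3)] unfolding m_def by simp_all
          show "P\<psi> n = start_from (M n) (density (\<nu> n) (\<lambda>\<mu>. ennreal (\<psi> n \<mu>))) (Pn n)" by (rule P\<psi>)
          show "(\<integral>\<^sup>+\<mu>. pot \<mu> * indicator (M n) \<mu> \<partial>\<nu> n) = ennreal (I n)" by (rule pot_int[OF elim(3)])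
          show "expected_discount (P\<psi> n) \<beta> (exit_time (Xn n) ?G) \<le> ennreal (\<epsilon> k n)"
            by (rule exit[OF k(1) True elim(3)])
        qed (use dom G_sets I_nonneg \<psi>_bounds(1) \<eta> sup \<epsilon>_nonneg[OF elim(3)] pos in auto)
        have "dE \<mu>\<^sub>0 (Xn n t \<omega>) \<le> r" if "\<omega> \<in> space (P\<psi> n) - R" "0 \<le> t" "t \<le> T0" for \<omega> t
        proof -
          have \<omega>: "\<omega> \<in> space (\<Omega>n n) - R" using that(1) P\<psi>'(3)[OF elim(3)] by simp
          have "k (Xn n t \<omega>) < \<eta>" using R(3)[OF \<omega> that(2)] that(3) elim(1) \<eta> by simp
          moreover have "Xn n t \<omega> \<in> E" using X_in[OF that(2), of \<omega>] \<omega> S_subset by auto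
          ultimately show ?thesis using detect by (intro less_imp_le)
        qed
        then show ?case
          using R(1,2) elim(2) P\<psi>'(2)[OF elim(3)] by (intro bexI[of _ R]) auto
      qed
    qed
  qed

  have fixed: "measure (p t \<mu>\<^sub>0) {\<mu>\<^sub>0} = 1" if "0 \<le> t" for t
    using T_L2 that \<mu>0_E unfolding \<nu>_lim N_eq by (intro L.point_mass_fixed)
  have const: "AE \<omega> in P \<mu>\<^sub>0. path_of X \<omega> = (\<lambda>t\<in>{0..}. \<mu>\<^sub>0)"
    by (rule L.AE_path_const[OF S(2) fixed])
  have start: "start_from S \<nu>_lim P = P \<mu>\<^sub>0"
    unfolding \<nu>_lim N_eq by (rule L.start_from_return[OF S(2)])
  interpret P0: prob_space "P \<mu>\<^sub>0" by (rule L.P(3)[OF S(2)])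
  show ?thesis
    unfolding weakly_converges_def
  proof (intro allI impI, elim conjE exE)
    fix f :: "(real \<Rightarrow> 'a measure) \<Rightarrow> real" and Cf
    assume f: "continuous_map (skorohod_topology E q) euclideanreal f"
      and Cf: "\<forall>x\<in>topspace (skorohod_topology E q). \<bar>f x\<bar> \<le> Cf"
    have f_meas: "f \<in> borel_measurable (borel_of (skorohod_topology E q))" by (rule continuous_map_borel_of[OF f])
    have lim: "(\<lambda>n. \<integral>\<omega>. f (path_of (Xn n) \<omega>) \<partial>P\<psi> n) \<longlonglongrightarrow> f (\<lambda>t\<in>{0..}. \<mu>\<^sub>0)"
    proof (rule S.tendsto_integral_const_path)
      show "continuous_map (dist_topology S.cadlag (skorohod_dist dE)) euclideanreal f" using f sk by simp
      show "\<bar>f x\<bar> \<le> Cf" if "x \<in> S.cadlag" for x using Cf that sk by simp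
    qed (use \<mu>0_E P\<psi>'(1) path_n sk small in auto)
    have law: "(\<integral>x. f x \<partial>path_law E q (P\<psi> n) (Xn n)) = (\<integral>\<omega>. f (path_of (Xn n) \<omega>) \<partial>P\<psi> n)" if "n \<ge> 1" for n
      unfolding path_law_def by (rule integral_distr[OF path_n[OF that] f_meas])
    \<comment> \<open>The hypotheses concern n \<ge> 1 only, so the integrals of the laws are
      identified eventually rather than for all n.\<close>
    have ev: "\<forall>\<^sub>F n in sequentially. (\<integral>\<omega>. f (path_of (Xn n) \<omega>) \<partial>P\<psi> n) = (\<integral>x. f x \<partial>path_law E q (P\<psi> n) (Xn n))"
      using eventually_ge_at_top[of 1] by eventually_elim (rule law[symmetric])
    have "(\<integral>x. f x \<partial>path_law E q (start_from S \<nu>_lim P) X) = f (\<lambda>t\<in>{0..}. \<mu>\<^sub>0)"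
    proof -
      have "(\<integral>x. f x \<partial>path_law E q (start_from S \<nu>_lim P) X) = (\<integral>\<omega>. f (path_of X \<omega>) \<partial>P \<mu>\<^sub>0)"
        unfolding path_law_def start by (rule integral_distr[OF path f_meas])
      also have "\<dots> = (\<integral>\<omega>. f (\<lambda>t\<in>{0..}. \<mu>\<^sub>0) \<partial>P \<mu>\<^sub>0)"
        using const measurable_compose[OF path f_meas] by (intro integral_cong_AE) (auto elim: eventually_mono)
      finally show ?thesis by (simp add: P0.prob_space)
    qed
    then show "(\<lambda>n. \<integral>x. f x \<partial>path_law E q (P\<psi> n) (Xn n)) \<longlonglongrightarrow> (\<integral>x. f x \<partial>path_law E q (start_from S \<nu>_lim P) X)"
      using Lim_transform_eventually[OF lim ev] by simp
  qed
qed

end
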